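(* Let $K$ be a virtual knot and let $n$ be the minimum, over all diagrams of $K$, of the number of real (non-virtual) crossings of the diagram. Let $z^{e_{\max}}$ and $z^{e_{\min}}$ be, respectively, the highest and lowest powers of $z$ appearing in the z-Parity Alexander Polynomial of $K$, and set $e=\max(|e_{\max}|,|e_{\min}|)$. If $e>0$, then $e+1\le n$.
   Context: Virtual knots. A virtual knot diagram is an oriented closed curve immersed in the plane whose double points are transverse and each is either a classical (real) crossing, with over/under information, or a virtual crossing. A virtual knot is an equivalence class of such diagrams under planar isotopy, the classical Reidemeister moves I, II, III, and the virtual moves (virtual Reidemeister I, II, III, and the mixed move passing a strand with two consecutive virtual crossings across a classical crossing). Each classical crossing has the usual sign (positive or negative). Parity. Traversing the diagram once from a base point and recording each passage through a classical crossing gives a cyclic word (Gauss code) in which each classical crossing occurs twice. A classical crossing $v$ is even if the number of letters between its two occurrences is even, and odd otherwise. z-Parity Alexander Polynomial. Let $D$ be a diagram of $K$ with $m$ classical crossings. The arcs of $D$ are the $2m$ segments between consecutive passages through classical crossings (virtual crossings are ignored); if $m=0$ there is one arc $x$ with the trivial relation $x=x$. At each classical crossing let $o_{in},o_{out}$ be the incoming and outgoing arcs of the over-strand and $u_{in},u_{out}$ those of the under-strand. Impose the relations over $\mathbb{Z}[s^{\pm1},t^{\pm1},z^{\pm1}]$: - even positive crossing: $o_{out}=s\,o_{in}$, $u_{out}=t\,u_{in}+(1-st)\,o_{in}$; - even negative crossing: $o_{out}=s^{-1}o_{in}$, $u_{out}=t^{-1}u_{in}+(1-s^{-1}t^{-1})\,o_{in}$;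 - odd positive crossing: $o_{out}=z\,o_{in}$, $u_{out}=z^{-1}u_{in}$; - odd negative crossing: $o_{out}=z^{-1}o_{in}$, $u_{out}=z\,u_{in}$. Each arc is the outgoing arc of exactly one strand passage, so these relations can be written as $Mx=x$, where $x$ is the vector of arcs and $M$ is a square matrix. The z-Parity Alexander Polynomial of $K$ is $\det(M-I)$, regarded up to multiplication by $\pm s^{a}t^{b}$, $a,b\in\mathbb{Z}$; up to this ambiguity it is an invariant of $K$, so the exponents of $z$ appearing in it are well defined. If the polynomial is $0$, set $e=0$. *)

theory Defs
  imports
    "HOL-Analysis.Analysis"
    "HOL-Library.Poly_Mapping"
    "Jordan_Normal_Form.Determinant"
begin

section \<open>Virtual knot diagrams\<close>

text \<open>
  A diagram is a 1-periodic parametrization of a closed plane curve, oriented by increasing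
  parameter. The sets \<open>overs\<close> and \<open>unders\<close> consist of the parameters at which the curve passes
  over, respectively under, at a classical crossing. The double points whose parameters are in
  neither set are the virtual crossings.
\<close>

record vdiagram =
  curve :: "real \<Rightarrow> complex"
  overs :: "real set"
  unders :: "real set"

definition crossing :: "vdiagram \<Rightarrow> real \<Rightarrow> real \<Rightarrow> bool" where
  "crossing D t u \<longleftrightarrow> curve D t = curve D u \<and> t - u \<notin> \<int>"

abbreviation velocity :: "vdiagram \<Rightarrow> real \<Rightarrow> complex" where
  "velocity D t \<equiv> vector_derivative (curve D) (at t)"

definition cross_prod :: "complex \<Rightarrow> complex \<Rightarrow> real" where
  "cross_prod v w = Re v * Im w - Im v * Re w"

text \<open>
  The last two conditions say that a classical crossing has one over-passage and one
  under-passage; they imply that \<open>overs\<close> and \<open>unders\<close> are 1-periodic.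
\<close>

definition is_diagram :: "vdiagram \<Rightarrow> bool" where
  "is_diagram D \<longleftrightarrow>
     (\<forall>t. curve D (t + 1) = curve D t) \<and>
     curve D C1_differentiable_on UNIV \<and>
     (\<forall>t. velocity D t \<noteq> 0) \<and>
     finite {curve D t |t u. crossing D t u} \<and>
     (\<forall>t u v. crossing D t u \<and> crossing D t v \<longrightarrow> u - v \<in> \<int>) \<and>
     (\<forall>t u. crossing D t u \<longrightarrow> cross_prod (velocity D t) (velocity D u) \<noteq> 0) \<and>
     overs D \<inter> unders D = {} \<and>
     (\<forall>t \<in> overs D \<union> unders D. \<exists>u. crossing D t u) \<and>
     (\<forall>t u. crossing D t u \<longrightarrow> (t \<in> overs D \<longleftrightarrow> u \<in> unders D))"


section \<open>Planar isotopy and the moves\<close>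

definition reparametrization :: "vdiagram \<Rightarrow> vdiagram \<Rightarrow> bool" where
  "reparametrization D D' \<longleftrightarrow>
     (\<exists>\<psi>. \<psi> C1_differentiable_on UNIV \<and>
          (\<forall>t. vector_derivative \<psi> (at t) > (0 :: real)) \<and>
          (\<forall>t. \<psi> (t + 1) = \<psi> t + 1) \<and>
          curve D' = curve D \<circ> \<psi> \<and>
          overs D' = \<psi> -` overs D \<and>
          unders D' = \<psi> -` unders D)"

text \<open>An ambient isotopy of the plane through \<open>C\<^sup>1\<close> diffeomorphisms.\<close>

definition ambient_isotopy :: "(real \<Rightarrow> complex \<Rightarrow> complex) \<Rightarrow> bool" where
  "ambient_isotopy H \<longleftrightarrow>
     H 0 = id \<and>
     continuous_on ({0..1} \<times> UNIV) (\<lambda>(u, p). H u p) \<and>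
     (\<forall>u \<in> {0..1}. bij (H u)) \<and>
     (\<exists>J. (\<forall>u \<in> {0..1}. \<forall>p. (H u has_derivative J u p) (at p) \<and> inj (J u p)) \<and>
          (\<forall>v. continuous_on ({0..1} \<times> UNIV) (\<lambda>(u, p). J u p v)))"

definition planar_isotopy :: "vdiagram \<Rightarrow> vdiagram \<Rightarrow> bool" where
  "planar_isotopy D D' \<longleftrightarrow>
     (\<exists>H. ambient_isotopy H \<and>
          curve D' = H 1 \<circ> curve D \<and> overs D' = overs D \<and> unders D' = unders D)"

text \<open>
  The remaining moves change a diagram inside a disc only. Since planar isotopies and
  reparametrizations are available, it suffices to perform them in the fixed window
  \<open>[-1,1] \<times> [-1,1]\<close>, for diagrams whose parameter \<open>0\<close> lies outside the window. The strands in the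
  window are listed by their parameter intervals; the order of the list is unrelated to the order
  in which the strands are traversed.
\<close>

abbreviation strand_times :: "(real \<times> real) list \<Rightarrow> nat \<Rightarrow> real set" where
  "strand_times S i \<equiv> {fst (S ! i) .. snd (S ! i)}"

abbreviation strand_interior :: "(real \<times> real) list \<Rightarrow> nat \<Rightarrow> real set" where
  "strand_interior S i \<equiv> {fst (S ! i) <..< snd (S ! i)}"

definition window_strands :: "vdiagram \<Rightarrow> (real \<times> real) list \<Rightarrow> bool" where
  "window_strands D S \<longleftrightarrow>
     (\<forall>(a, b) \<in> set S. 0 < a \<and> a < b \<and> b < 1) \<and>
     disjoint_family_on (strand_times S) {..<length S} \<and>
     (\<forall>t \<in> {0..1}. curve D t \<in> cbox (Complex (-1) (-1)) (Complex 1 1) \<longleftrightarrow>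
        t \<in> (\<Union>i<length S. strand_times S i)) \<and>
     (\<forall>t \<in> {0..1}. curve D t \<in> box (Complex (-1) (-1)) (Complex 1 1) \<longleftrightarrow>
        t \<in> (\<Union>i<length S. strand_interior S i))"

definition local_change :: "(real \<times> real) list \<Rightarrow> vdiagram \<Rightarrow> vdiagram \<Rightarrow> bool" where
  "local_change S D D' \<longleftrightarrow>
     window_strands D S \<and> window_strands D' S \<and>
     (\<forall>t \<in> {0..1} - (\<Union>i<length S. strand_times S i).
        curve D t = curve D' t \<and>
        (t \<in> overs D \<longleftrightarrow> t \<in> overs D') \<and>
        (t \<in> unders D \<longleftrightarrow> t \<in> unders D'))"

definition traces_graph :: "vdiagram \<Rightarrow> real set \<Rightarrow> (real \<Rightarrow> real) \<Rightarrow> bool" where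
  "traces_graph D I f \<longleftrightarrow>
     inj_on (curve D) I \<and> curve D ` I = (\<lambda>x. Complex x (f x)) ` {-1..1}"

text \<open>
  Which strands pass over which at classical crossings inside the window.
\<close>

definition layers :: "vdiagram \<Rightarrow> (real \<times> real) list \<Rightarrow> (nat \<times> nat) set" where
  "layers D S = {(i, j). i < length S \<and> j < length S \<and>
     (\<exists>t \<in> strand_times S i. \<exists>u \<in> strand_times S j. crossing D t u \<and> t \<in> overs D)}"

text \<open>
  Move I: an embedded arc is replaced by an arc with exactly one self-crossing. The crossing may be
  of any type; the move is the classical or the virtual move accordingly.
\<close>

definition move_I :: "vdiagram \<Rightarrow> vdiagram \<Rightarrow> bool" where
  "move_I D D' \<longleftrightarrow>
     (\<exists>a b. local_change [(a, b)] D D' \<and>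
        inj_on (curve D) {a..b} \<and>
        (\<exists>c d. a < c \<and> c < d \<and> d < b \<and>
           (\<forall>t \<in> {a..b}. \<forall>u \<in> {a..b}.
              t < u \<longrightarrow> (curve D' t = curve D' u \<longleftrightarrow> t = c \<and> u = d))))"

text \<open>
  Move II: one strand runs along the real axis; the other one lies above it in \<open>D\<close> and crosses it
  exactly twice in \<open>D'\<close>. All crossings of the first strand are of the same kind: both over, both
  under (classical move), or both virtual (virtual move).
\<close>

definition move_II :: "vdiagram \<Rightarrow> vdiagram \<Rightarrow> bool" where
  "move_II D D' \<longleftrightarrow>
     (\<exists>S f g. length S = 2 \<and> local_change S D D' \<and>
        traces_graph D (strand_times S 0) (\<lambda>x. 0) \<and>
        traces_graph D' (strand_times S 0) (\<lambda>x. 0) \<and>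
        traces_graph D (strand_times S 1) f \<and>
        traces_graph D' (strand_times S 1) g \<and>
        (\<forall>x \<in> {-1..1}. f x > 0) \<and>
        card {x \<in> {-1..1}. g x = 0} = 2 \<and>
        (\<forall>t \<in> strand_times S 0. \<forall>u \<in> strand_times S 0.
           (\<exists>t'. crossing D' t t') \<and> (\<exists>u'. crossing D' u u') \<longrightarrow>
             (t \<in> overs D' \<longleftrightarrow> u \<in> overs D') \<and> (t \<in> unders D' \<longleftrightarrow> u \<in> unders D')))"

text \<open>
  Move III: two strands run along the lines \<open>y = x/2\<close> and \<open>y = -x/2\<close>. The third one meets each of
  these once and is moved from one side of their intersection to the other. The admissible crossing
  types are: all virtual; exactly one classical, so that one strand has two consecutive virtual
  crossings (mixed move); all classical with a top, a middle and a bottom strand.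
\<close>

definition move_III :: "vdiagram \<Rightarrow> vdiagram \<Rightarrow> bool" where
  "move_III D D' \<longleftrightarrow>
     (\<exists>S f g. length S = 3 \<and> local_change S D D' \<and>
        (\<forall>E \<in> {D, D'}. traces_graph E (strand_times S 0) (\<lambda>x. x / 2) \<and>
                       traces_graph E (strand_times S 1) (\<lambda>x. - x / 2)) \<and>
        traces_graph D (strand_times S 2) f \<and>
        traces_graph D' (strand_times S 2) g \<and>
        f 0 > 0 \<and> g 0 < 0 \<and>
        (\<forall>h \<in> {f, g}. \<bar>h (-1)\<bar> < 1 / 2 \<and> \<bar>h 1\<bar> < 1 / 2 \<and>
           (\<exists>!x. x \<in> {-1..1} \<and> h x = x / 2) \<and>
           (\<exists>!x. x \<in> {-1..1} \<and> h x = - x / 2)) \<and>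
        layers D S = layers D' S \<and>
        (layers D S = {} \<or>
         (\<exists>i j. layers D S = {(i, j)}) \<or>
         (\<exists>i j k. distinct [i, j, k] \<and> layers D S = {(i, j), (i, k), (j, k)})))"

definition diagram_step :: "vdiagram \<Rightarrow> vdiagram \<Rightarrow> bool" where
  "diagram_step D D' \<longleftrightarrow> is_diagram D \<and> is_diagram D' \<and>
     (reparametrization D D' \<or> planar_isotopy D D' \<or>
      move_I D D' \<or> move_II D D' \<or> move_III D D')"

definition virtual_knots :: "vdiagram set set" where
  "virtual_knots = {D. is_diagram D} // {(D, D'). is_diagram D \<and> equivclp diagram_step D D'}"

definition real_crossings :: "vdiagram \<Rightarrow> complex set" where
  "real_crossings D = curve D ` overs D"

definition crossing_number :: "vdiagram set \<Rightarrow> nat" where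
  "crossing_number K = (LEAST n. \<exists>D \<in> K. n = card (real_crossings D))"


section \<open>Gauss code, parity and signs\<close>

text \<open>Crossings are named by their positions in the plane.\<close>

definition passages :: "vdiagram \<Rightarrow> real list" where
  "passages D = sorted_list_of_set ((overs D \<union> unders D) \<inter> {0..<1})"

definition gauss_code :: "vdiagram \<Rightarrow> complex list" where
  "gauss_code D = map (curve D) (passages D)"

definition over_passage :: "vdiagram \<Rightarrow> nat \<Rightarrow> bool" where
  "over_passage D k \<longleftrightarrow> passages D ! k \<in> overs D"

text \<open>The index of the other passage through the crossing of passage \<open>k\<close>.\<close>

definition other_passage :: "vdiagram \<Rightarrow> nat \<Rightarrow> nat" where
  "other_passage D k =
     (THE l. l < length (gauss_code D) \<and> l \<noteq> k \<and> gauss_code D ! l = gauss_code D ! k)"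

definition even_passage :: "vdiagram \<Rightarrow> nat \<Rightarrow> bool" where
  "even_passage D k \<longleftrightarrow>
     even (max k (other_passage D k) - min k (other_passage D k) - 1)"

text \<open>
  A crossing is positive if the tangent vectors of the over- and the under-strand, in this order,
  form a positively oriented basis of the plane.
\<close>

definition passage_sign :: "vdiagram \<Rightarrow> nat \<Rightarrow> int" where
  "passage_sign D k =
     (let l = other_passage D k;
          (p, q) = (if over_passage D k then (k, l) else (l, k))
      in if cross_prod (velocity D (passages D ! p)) (velocity D (passages D ! q)) > 0
         then 1 else -1)"


section \<open>The z-Parity Alexander Polynomial\<close>

text \<open>
  \<open>\<int>[s\<^sup>\<plusminus>\<^sup>1, t\<^sup>\<plusminus>\<^sup>1, z\<^sup>\<plusminus>\<^sup>1]\<close> as the group ring of \<open>\<int> \<times> \<int> \<times> \<int>\<close>: finitely supported functions on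
  exponent triples with convolution product.
\<close>

type_synonym laurent = "(int \<times> int \<times> int) \<Rightarrow>\<^sub>0 int"

definition monom_stz :: "int \<Rightarrow> int \<Rightarrow> int \<Rightarrow> laurent" where
  "monom_stz a b c = Poly_Mapping.single (a, b, c) 1"

text \<open>
  Arc \<open>k\<close> is the incoming arc of passage \<open>k\<close>, hence arc \<open>k + 1\<close> (cyclically) is its outgoing arc.
  \<open>arc_coeff D k l\<close> is the coefficient of arc \<open>l\<close> in the relation for the outgoing arc of
  passage \<open>k\<close>.
\<close>

definition arc_coeff :: "vdiagram \<Rightarrow> nat \<Rightarrow> nat \<Rightarrow> laurent" where
  "arc_coeff D k l =
     (let \<epsilon> = passage_sign D k in
      if even_passage D k then
        if over_passage D k then (if l = k then monom_stz \<epsilon> 0 0 else 0)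
        else if l = k then monom_stz 0 \<epsilon> 0
        else if l = other_passage D k then 1 - monom_stz \<epsilon> \<epsilon> 0
        else 0
      else
        if l = k then monom_stz 0 0 (if over_passage D k then \<epsilon> else - \<epsilon>) else 0)"

definition arc_matrix :: "vdiagram \<Rightarrow> laurent mat" where
  "arc_matrix D =
     (let n = length (passages D) in
      if n = 0 then 1\<^sub>m 1
      else Matrix.mat n n (\<lambda>(i, l). arc_coeff D ((i + n - 1) mod n) l))"

definition zpa_det :: "vdiagram \<Rightarrow> laurent" where
  "zpa_det D = Determinant.det (arc_matrix D - 1\<^sub>m (dim_row (arc_matrix D)))"

text \<open>\<open>P\<close> represents the polynomial of \<open>K\<close>, which is defined up to \<open>\<plusminus>s\<^sup>at\<^sup>b\<close> only.\<close>

definition is_z_parity_alexander :: "vdiagram set \<Rightarrow> laurent \<Rightarrow> bool" where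
  "is_z_parity_alexander K P \<longleftrightarrow>
     (\<exists>D \<in> K. \<exists>a b. P = monom_stz a b 0 * zpa_det D \<or> P = - (monom_stz a b 0 * zpa_det D))"

definition z_exponents :: "laurent \<Rightarrow> int set" where
  "z_exponents P = (\<lambda>(a, b, c). c) ` Poly_Mapping.keys P"

definition z_bound :: "laurent \<Rightarrow> int" where
  "z_bound P =
     (if P = 0 then 0 else max \<bar>Max (z_exponents P)\<bar> \<bar>Min (z_exponents P)\<bar>)"

end

theory Submission
  imports Defs
begin

text \<open>
  Both kinds of crossings give relations \<open>o_out = a o_in\<close>, \<open>u_out = b u_in + (1 - a b) o_in\<close> with
  units \<open>a\<close>, \<open>b\<close>, where \<open>a b = 1\<close> at the odd crossings. Hence the determinant depends only on the
  cyclic order of the passages, their pairing, the choice of the over-passages and the units, and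
  it does not change when trivial passages are inserted. Its behaviour under a move follows by
  eliminating the arcs inside the disc of the move; for move III this uses that an odd number of
  the three crossings is even.

  In the Leibniz expansion every odd crossing contributes a power of \<open>z\<close> between \<open>-1\<close> and \<open>1\<close>
  and every even crossing contributes none. If all crossings are odd, a potential on the arcs
  shows that only \<open>z\<^sup>0\<close> occurs. So \<open>e > 0\<close> forces an even crossing, and \<open>e\<close> is at most the number
  of the other ones.
\<close>

section \<open>Determinants over finite index sets\<close>

text \<open>The polynomial may be read from one diagram of \<open>K\<close> and the crossing number
  from another, so the degree bound for a single diagram needs invariance up to
  \<plusminus>\<open>s^a t^b\<close>. The obstacle is that the moves change the size of the matrix.
  Determinants are therefore indexed by the passage times themselves, and the crossings that a move
  creates are not deleted but turned into trivial passages at the same times, so that two diagrams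
  are compared entry by entry on one index set. A marked time also gives a diagram without crossings
  the zero matrix of size one, as the convention demands.

  Parities and signs inside the window are not data of a move. Passages adjacent on a strand have
  ranks of opposite parity; at move III the six ranks thus have odd sum, which forces an odd number
  of even crossings. Signs come from intermediate value arguments and transversality.

  In the expansion the two passages of an odd crossing carry opposite powers of \<open>z\<close>, so
  each such crossing raises or lowers the exponent by at most one.\<close>

definition det_on :: "'b set \<Rightarrow> ('b \<Rightarrow> 'b \<Rightarrow> 'a) \<Rightarrow> 'a :: comm_ring_1" where
  "det_on T A = (\<Sum>\<pi> | \<pi> permutes T. of_int (sign \<pi>) * (\<Prod>p\<in>T. A p (\<pi> p)))"

lemma det_on_cong:
  assumes "\<And>p l. p \<in> T \<Longrightarrow> l \<in> T \<Longrightarrow> A p l = B p l"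
  shows "det_on T A = det_on T B"
  unfolding det_on_def
  by (intro sum.cong refl arg_cong2[where f = "(*)"] prod.cong)
     (auto intro!: assms simp: permutes_in_image)

lemma det_on_relabel:
  assumes f: "bij_betw f S T" and fin: "finite S"
  shows "det_on T A = det_on S (\<lambda>p l. A (f p) (f l))"
proof -
  have inj: "inj_on f S" and im: "f ` S = T"
    using f by (auto simp: bij_betw_def)
  define g where "g = inv_into S f"
  have g: "bij_betw g T S" unfolding g_def by (rule bij_betw_inv_into[OF f])
  have gf: "g (f x) = x" if "x \<in> S" for x
    using that inj by (simp add: g_def)
  have fg: "f (g x) = x" if "x \<in> T" for x
    using that f by (simp add: g_def bij_betw_inv_into_right)
  show ?thesis
    unfolding det_on_def
  proof (rule sum.reindex_bij_witness[of _ "map_permutation S f" "map_permutation T g"])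
    fix \<pi> assume "\<pi> \<in> {\<pi>. \<pi> permutes S}"
    hence \<pi>: "\<pi> permutes S" by simp
    show "map_permutation T g (map_permutation S f \<pi>) = \<pi>"
      by (rule map_permutation_compose_inv[OF f \<pi>]) (rule gf)
    show "map_permutation S f \<pi> \<in> {\<pi>. \<pi> permutes T}"
      using map_permutation_permutes[OF f \<pi>] by simp
  next
    fix \<pi> assume "\<pi> \<in> {\<pi>. \<pi> permutes T}"
    hence \<pi>: "\<pi> permutes T" by simp
    show "map_permutation S f (map_permutation T g \<pi>) = \<pi>"
      by (rule map_permutation_compose_inv[OF g \<pi>]) (rule fg)
    show "map_permutation T g \<pi> \<in> {\<pi>. \<pi> permutes S}"
      using map_permutation_permutes[OF g \<pi>] by simp
    have finT: "finite T" using fin im by auto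
    have injg: "inj_on g T" using g by (simp add: bij_betw_def)
    have s: "sign (map_permutation T g \<pi>) = sign \<pi>"
      by (rule sign_map_permutation[OF injg \<pi> finT])
    have "(\<Prod>p\<in>S. A (f p) (f (map_permutation T g \<pi> p))) = (\<Prod>p\<in>T. A p (\<pi> p))"
    proof (rule prod.reindex_bij_witness[of _ g f])
      fix p assume p: "p \<in> S"
      have fp: "f p \<in> T" using p im by auto
      have "f (map_permutation T g \<pi> p) = \<pi> (f p)"
        using map_permutation_apply[OF injg fp, of \<pi>] gf[OF p] fg permutes_in_image[OF \<pi>] fp by auto
      thus "A (f p) (\<pi> (f p)) = A (f p) (f (map_permutation T g \<pi> p))" by simp
    qed (use gf fg f g in \<open>auto simp: bij_betw_def\<close>)
    thus "of_int (sign (map_permutation T g \<pi>)) * (\<Prod>p\<in>S. A (f p) (f (map_permutation T g \<pi> p)))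
      = of_int (sign \<pi>) * (\<Prod>p\<in>T. A p (\<pi> p))" using s by simp
  qed
qed

lemma det_on_mat:
  "det_on {0..<n} A = Determinant.det (Matrix.mat n n (\<lambda>(i, j). A i j))"
proof -
  have "p i < n" if "p permutes {0..<n}" "i < n" for p i
    using permutes_in_image[OF that(1), of i] that(2) by simp
  hence "(\<Prod>i = 0..<n. Matrix.mat n n (\<lambda>(i, j). A i j) $$ (i, p i)) = (\<Prod>i = 0..<n. A i (p i))"
    if "p permutes {0..<n}" for p
    using that by (intro prod.cong) simp_all
  thus ?thesis
    unfolding det_on_def det_def'[OF mat_carrier] by (intro sum.cong) simp_all
qed

lemma ex_enum:
  assumes "finite (T :: 'b set)"
  obtains f where "bij_betw f {0..<card T} T"
  using ex_bij_betw_nat_finite[OF assms] by blast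

text \<open>Enumerating \<open>T\<close> reduces this to \<open>det_addrow\<close>. All later row
  additions and, through \<open>det_on_transpose\<close>, all column additions come from this
  case.\<close>

lemma det_on_add_row:
  assumes fin: "finite T" and kl: "k \<in> T" "l \<in> T" "k \<noteq> l"
  shows "det_on T (\<lambda>p j. if p = k then c * A l j + A k j else A p j) = det_on T A"
proof -
  obtain f where f: "bij_betw f {0..<card T} T" using ex_enum[OF fin] .
  let ?n = "card T"
  let ?M = "Matrix.mat ?n ?n (\<lambda>(i, j). A (f i) (f j))"
  have "k \<in> f ` {0..<?n}" "l \<in> f ` {0..<?n}"
    using kl f by (auto simp: bij_betw_def)
  then obtain k' l' where k': "k' < ?n" "f k' = k" and l': "l' < ?n" "f l' = l"
    by auto
  have ne: "k' \<noteq> l'" using kl k' l' by auto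
  have inj: "f i = k \<longleftrightarrow> i = k'" if "i < ?n" for i
    using f k' that by (auto simp: bij_betw_def inj_on_def)
  have "det_on T (\<lambda>p j. if p = k then c * A l j + A k j else A p j) =
     Determinant.det (addrow c k' l' ?M)"
    unfolding det_on_relabel[OF f finite_atLeastLessThan] det_on_mat
  proof (rule arg_cong[where f = Determinant.det], rule eq_matI)
    fix i j assume "i < dim_row (addrow c k' l' ?M)" "j < dim_col (addrow c k' l' ?M)"
    hence ij: "i < ?n" "j < ?n" by simp_all
    show "Matrix.mat ?n ?n (\<lambda>(i, j). if f i = k then c * A l (f j) + A k (f j) else A (f i) (f j)) $$ (i, j)
       = addrow c k' l' ?M $$ (i, j)"
      using ij l'(1) k'(1) by (cases "i = k'") (simp_all add: inj[OF ij(1)] k'(2) l'(2))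
  qed simp_all
  also have "\<dots> = Determinant.det ?M"
    by (rule det_addrow[OF l'(1) ne]) simp
  also have "\<dots> = det_on T A"
    unfolding det_on_relabel[OF f finite_atLeastLessThan] det_on_mat ..
  finally show ?thesis .
qed

lemma det_on_transpose:
  assumes fin: "finite T"
  shows "det_on T (\<lambda>p l. A l p) = det_on T A"
proof -
  obtain f where f: "bij_betw f {0..<card T} T" using ex_enum[OF fin] .
  let ?n = "card T"
  let ?M = "Matrix.mat ?n ?n (\<lambda>(i, j). A (f i) (f j))"
  have "det_on T (\<lambda>p l. A l p) = Determinant.det (transpose_mat ?M)"
    unfolding det_on_relabel[OF f finite_atLeastLessThan] det_on_mat
    by (rule arg_cong[where f = Determinant.det], rule eq_matI) auto
  also have "\<dots> = Determinant.det ?M"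
    by (rule Determinant.det_transpose[of _ ?n]) simp
  also have "\<dots> = det_on T A"
    unfolding det_on_relabel[OF f finite_atLeastLessThan] det_on_mat ..
  finally show ?thesis .
qed

text \<open>Needed because the rows of \<open>arc_matrix\<close> are indexed by outgoing arcs and
  those of \<open>relation_matrix\<close> by passages, which differ by a cyclic shift.\<close>

lemma det_on_permute_rows:
  assumes fin: "finite T" and \<rho>: "\<rho> permutes T"
  shows "det_on T (\<lambda>p l. A (\<rho> p) l) = of_int (sign \<rho>) * det_on T A"
proof -
  have "det_on T (\<lambda>p l. A (\<rho> p) l) =
    (\<Sum>\<pi> | \<pi> permutes T. of_int (sign (\<pi> \<circ> \<rho>)) * (\<Prod>p\<in>T. A (\<rho> p) ((\<pi> \<circ> \<rho>) p)))"
    unfolding det_on_def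
    by (rule sum.reindex_bij_witness[of _ "\<lambda>\<pi>. \<pi> \<circ> \<rho>" "\<lambda>\<pi>. \<pi> \<circ> inv_into UNIV \<rho>"])
       (auto simp: o_assoc[symmetric] permutes_inv_o[OF \<rho>] permutes_compose \<rho> permutes_inv)
  also have "\<dots> = (\<Sum>\<pi> | \<pi> permutes T. of_int (sign \<rho>) * (of_int (sign \<pi>) * (\<Prod>p\<in>T. A p (\<pi> p))))"
  proof (intro sum.cong refl)
    fix \<pi> assume "\<pi> \<in> {\<pi>. \<pi> permutes T}"
    hence \<pi>: "\<pi> permutes T" by simp
    have "sign (\<pi> \<circ> \<rho>) = sign \<pi> * sign \<rho>"
      using fin \<pi> \<rho> by (intro sign_compose) (auto simp: permutation_permutes)
    moreover have "(\<Prod>p\<in>T. A (\<rho> p) ((\<pi> \<circ> \<rho>) p)) = (\<Prod>p\<in>T. A p (\<pi> p))"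
      unfolding o_def
      by (rule prod.reindex_bij_betw[OF permutes_imp_bij[OF \<rho>], of "\<lambda>p. A p (\<pi> p)"])
    ultimately show "of_int (sign (\<pi> \<circ> \<rho>)) * (\<Prod>p\<in>T. A (\<rho> p) ((\<pi> \<circ> \<rho>) p)) =
        of_int (sign \<rho>) * (of_int (sign \<pi>) * (\<Prod>p\<in>T. A p (\<pi> p)))"
      by (simp add: mult_ac)
  qed
  finally show ?thesis by (simp add: det_on_def sum_distrib_left)
qed

lemma det_on_add_rows:
  assumes fin: "finite T" and l: "l \<in> T" and K: "K \<subseteq> T - {l}"
  shows "det_on T (\<lambda>p j. if p \<in> K then A p j + c p * A l j else A p j) = det_on T A"
proof -
  have "finite K" using K fin finite_subset by auto
  thus ?thesis using K
  proof (induction K)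
    case empty show ?case by simp
  next
    case (insert k K)
    let ?B = "\<lambda>p j. if p \<in> K then A p j + c p * A l j else A p j"
    have "det_on T (\<lambda>p j. if p \<in> insert k K then A p j + c p * A l j else A p j) =
      det_on T (\<lambda>p j. if p = k then c k * ?B l j + ?B k j else ?B p j)"
      using insert by (intro det_on_cong) auto
    also have "\<dots> = det_on T ?B"
      using insert by (intro det_on_add_row fin l) auto
    finally show ?case using insert by simp
  qed
qed

lemma det_on_scale_row:
  assumes fin: "finite T" and k: "k \<in> T"
  shows "det_on T (\<lambda>p j. if p = k then c * A p j else A p j) = c * det_on T A"
proof -
  have "(\<Prod>p\<in>T. if p = k then c * A p (\<pi> p) else A p (\<pi> p)) = c * (\<Prod>p\<in>T. A p (\<pi> p))" for \<pi>
    by (subst (1 2) prod.remove[OF fin k]) (simp add: mult_ac)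
  thus ?thesis unfolding det_on_def by (simp add: sum_distrib_left mult_ac)
qed

text \<open>Only permutations fixing \<open>p\<close> survive in the expansion, and these are the
  permutations of \<open>T\<close>.\<close>

lemma det_on_unit_row:
  assumes fin: "finite T" and p: "p \<notin> T"
    and row: "\<And>l. l \<in> insert p T \<Longrightarrow> A p l = (if l = p then 1 else 0)"
  shows "det_on (insert p T) A = det_on T A"
proof -
  have z: "(\<Prod>q\<in>insert p T. A q (\<pi> q)) = (if \<pi> p = p then (\<Prod>q\<in>T. A q (\<pi> q)) else 0)"
    if "\<pi> permutes insert p T" for \<pi>
    using fin p row[of "\<pi> p"] permutes_in_image[OF that, of p] by simp
  have "det_on (insert p T) A = (\<Sum>\<pi> | \<pi> permutes insert p T.
      (if \<pi> p = p then of_int (sign \<pi>) * (\<Prod>q\<in>T. A q (\<pi> q)) else 0))"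
    unfolding det_on_def by (intro sum.cong refl) (simp add: z)
  also have "\<dots> = (\<Sum>\<pi> | \<pi> permutes insert p T \<and> \<pi> p = p.
      of_int (sign \<pi>) * (\<Prod>q\<in>T. A q (\<pi> q)))"
    using fin by (subst sum.inter_filter[symmetric]) (auto simp: finite_permutations)
  also have "{\<pi>. \<pi> permutes insert p T \<and> \<pi> p = p} = {\<pi>. \<pi> permutes T}"
  proof (intro Collect_cong iffI)
    fix \<pi> assume "\<pi> permutes insert p T \<and> \<pi> p = p"
    thus "\<pi> permutes T" using p by (intro permutes_superset[of \<pi> "insert p T" T]) auto
  next
    fix \<pi> assume "\<pi> permutes T"
    thus "\<pi> permutes insert p T \<and> \<pi> p = p"
      using p by (auto intro: permutes_subset simp: permutes_not_in)
  qed
  finally show ?thesis by (simp add: det_on_def)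
qed

text \<open>Elimination of the unknown \<open>q\<close> by means of row \<open>p\<close>, whose pivot has inverse \<open>u\<close>.\<close>

definition eliminate :: "'b \<Rightarrow> 'b \<Rightarrow> 'a \<Rightarrow> ('b \<Rightarrow> 'b \<Rightarrow> 'a) \<Rightarrow> 'b \<Rightarrow> 'b \<Rightarrow> 'a :: comm_ring_1" where
  "eliminate p q u A k l =
     (if k = p then (if l = q then 1 else 0) else A k l - A k q * u * A p l)"

text \<open>Multiples of row \<open>p\<close> clear column \<open>q\<close>; then, after
  transposition, multiples of column \<open>q\<close> clear row \<open>p\<close>. Pulling out the
  pivot leaves a unit row. The index set stays \<open>T\<close>, so that eliminations can be
  iterated and their results compared entrywise for two matrices.\<close>

lemma det_on_eliminate:
  assumes fin: "finite T" and pq: "p \<in> T" "q \<in> T" and u: "A p q * u = 1"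
  shows "det_on T A = A p q * det_on T (eliminate p q u A)"
proof -
  let ?B = "\<lambda>k l. if k \<in> T - {p} then A k l + (- (A k q * u)) * A p l else A k l"
  have "det_on T A = det_on T ?B"
    by (rule det_on_add_rows[symmetric, OF fin pq(1)]) auto
  also have "\<dots> = det_on T (\<lambda>l k. ?B k l)"
    by (rule det_on_transpose[symmetric, OF fin])
  also have "\<dots> = det_on T (\<lambda>l k. if l \<in> T - {q} then ?B k l + (- (A p l * u)) * ?B k q else ?B k l)"
    by (rule det_on_add_rows[symmetric, OF fin pq(2)]) auto
  also have "\<dots> = det_on T (\<lambda>k l. if l \<in> T - {q} then ?B k l + (- (A p l * u)) * ?B k q else ?B k l)"
    by (rule det_on_transpose[OF fin])
  also have "\<dots> = det_on T (\<lambda>k l. if k = p then A p q * eliminate p q u A k l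
                                  else eliminate p q u A k l)"
  proof (rule det_on_cong)
    fix k l assume "k \<in> T" "l \<in> T"
    have e: "x * u * A p q = x" for x
      using u by (simp add: mult.assoc mult.commute[of u])
    have "?B k q = (if k = p then A p q else 0)"
      using \<open>k \<in> T\<close> e[of "A k q"] by simp
    thus "(if l \<in> T - {q} then ?B k l + (- (A p l * u)) * ?B k q else ?B k l) =
       (if k = p then A p q * eliminate p q u A k l else eliminate p q u A k l)"
      using \<open>k \<in> T\<close> \<open>l \<in> T\<close> e[of "A p l"] e[of "A k q"] by (auto simp: eliminate_def)
  qed
  also have "\<dots> = A p q * det_on T (eliminate p q u A)"
    by (rule det_on_scale_row[OF fin pq(1)])
  finally show ?thesis .
qed

section \<open>Relation matrices of cyclically ordered passages\<close>

text \<open>A sole element succeeds itself; this is what gives a single trivial passage the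
  determinant 0.\<close>

definition cyc_next :: "real set \<Rightarrow> real \<Rightarrow> real" where
  "cyc_next T p = (if \<exists>q\<in>T. p < q then Min {q \<in> T. p < q} else Min T)"

lemma cyc_next_mem:
  assumes "finite T" "p \<in> T"
  shows "cyc_next T p \<in> T"
proof (cases "\<exists>q\<in>T. p < q")
  case True
  hence "Min {q \<in> T. p < q} \<in> {q \<in> T. p < q}" using assms by (intro Min_in) auto
  thus ?thesis using True by (simp add: cyc_next_def)
next
  case False
  moreover have "Min T \<in> T" using assms by (intro Min_in) auto
  ultimately show ?thesis by (simp add: cyc_next_def)
qed

text \<open>A description free of \<open>Min\<close>, from which the later facts follow by order
  reasoning. The second disjunct is the step from the largest element back to the smallest,
  including the case of a singleton.\<close>

lemma cyc_next_eq_iff: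
  assumes fin: "finite T" and p: "p \<in> T" and q: "q \<in> T"
  shows "cyc_next T p = q \<longleftrightarrow>
    (p < q \<and> (\<forall>r\<in>T. \<not> (p < r \<and> r < q))) \<or> (q \<le> p \<and> (\<forall>r\<in>T. r \<le> p \<and> q \<le> r))"
proof (cases "\<exists>q\<in>T. p < q")
  case True
  have "Min {q \<in> T. p < q} = q \<longleftrightarrow> q \<in> {q \<in> T. p < q} \<and> (\<forall>r\<in>{q \<in> T. p < q}. q \<le> r)"
    using True fin by (intro Min_eq_iff) auto
  thus ?thesis using True q by (auto simp: cyc_next_def not_less)
next
  case False
  have "Min T = q \<longleftrightarrow> q \<in> T \<and> (\<forall>r\<in>T. q \<le> r)"
    using q fin by (intro Min_eq_iff) auto
  thus ?thesis using False q by (auto simp: cyc_next_def not_less)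
qed

lemma cyc_next_inj:
  assumes fin: "finite T"
  shows "inj_on (cyc_next T) T"
proof (rule inj_onI)
  fix p p' assume pp: "p \<in> T" "p' \<in> T" and eq: "cyc_next T p = cyc_next T p'"
  define q where "q = cyc_next T p"
  have q: "q \<in> T" using cyc_next_mem[OF fin pp(1)] by (simp add: q_def)
  have 1: "(p < q \<and> (\<forall>r\<in>T. \<not> (p < r \<and> r < q))) \<or> (q \<le> p \<and> (\<forall>r\<in>T. r \<le> p \<and> q \<le> r))"
    using cyc_next_eq_iff[OF fin pp(1) q] by (simp add: q_def)
  have 2: "(p' < q \<and> (\<forall>r\<in>T. \<not> (p' < r \<and> r < q))) \<or> (q \<le> p' \<and> (\<forall>r\<in>T. r \<le> p' \<and> q \<le> r))"
    using cyc_next_eq_iff[OF fin pp(2) q] eq by (simp add: q_def)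
  show "p = p'" using 1 2 pp q by (smt (verit))
qed

lemma cyc_next_eq_cancel:
  "finite T \<Longrightarrow> p \<in> T \<Longrightarrow> q \<in> T \<Longrightarrow> cyc_next T p = cyc_next T q \<longleftrightarrow> p = q"
  using cyc_next_inj by (auto dest: inj_onD)

text \<open>\<open>f\<close> moves an initial segment \<open>L\<close> of \<open>S\<close> behind the rest.\<close>

lemma cyc_next_rotate:
  assumes fin: "finite S" and bij: "bij_betw f S T" and p: "p \<in> S"
    and 1: "\<And>x y. x \<in> S \<Longrightarrow> y \<in> S \<Longrightarrow> L x = L y \<Longrightarrow> x < y \<Longrightarrow> f x < f y"
    and 2: "\<And>x y. x \<in> S \<Longrightarrow> y \<in> S \<Longrightarrow> L x \<Longrightarrow> \<not> L y \<Longrightarrow> x < y \<and> f y < f x"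
  shows "cyc_next T (f p) = f (cyc_next S p)"
proof -
  have finT: "finite T" and im: "T = f ` S" using fin bij bij_betw_finite by (auto simp: bij_betw_def)
  define q where "q = cyc_next S p"
  have q: "q \<in> S" using cyc_next_mem[OF fin p] by (simp add: q_def)
  have q1: "(p < q \<and> (\<forall>r\<in>S. \<not> (p < r \<and> r < q))) \<or> (q \<le> p \<and> (\<forall>r\<in>S. r \<le> p \<and> q \<le> r))"
    using cyc_next_eq_iff[OF fin p q] by (simp add: q_def)
  have lt: "f x < f y \<longleftrightarrow> (if L x = L y then x < y else L y)" if "x \<in> S" "y \<in> S" for x y
    using 1[OF that] 1[OF that(2,1)] 2[OF that] 2[OF that(2,1)] by (cases x y rule: linorder_cases) fastforce+
  have lt2: "x < y" if "x \<in> S" "y \<in> S" "L x" "\<not> L y" for x y using 2 that by blast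
  have "cyc_next T (f p) = f q \<longleftrightarrow> (f p < f q \<and> (\<forall>r\<in>S. \<not> (f p < f r \<and> f r < f q)))
      \<or> (f q \<le> f p \<and> (\<forall>r\<in>S. f r \<le> f p \<and> f q \<le> f r))"
    using p q finT by (subst cyc_next_eq_iff) (auto simp: im)
  \<comment> \<open>A successor pair inside one block stays of its kind; at a boundary between the
    blocks the plain step and the wrap-around change places.\<close>
  also have "\<dots>" using q1
  proof
    assume a: "p < q \<and> (\<forall>r\<in>S. \<not> (p < r \<and> r < q))"
    have "if L p = L q then f p < f q \<and> \<not> (f p < f r \<and> f r < f q)
        else \<not> f p < f q \<and> \<not> f p < f r \<and> \<not> f r < f q"
      if r: "r \<in> S" for r
      unfolding lt[OF p q] lt[OF p r] lt[OF r q]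
      using a r lt2[OF p r] lt2[OF r p] lt2[OF r q] lt2[OF q r] lt2[OF q p]
      by (cases "L p"; cases "L q"; cases "L r") auto
    thus ?thesis using p by (cases "L p = L q") (auto simp: not_less)
  next
    assume a: "q \<le> p \<and> (\<forall>r\<in>S. r \<le> p \<and> q \<le> r)"
    have "if L p = L q then \<not> f p < f q \<and> \<not> f p < f r \<and> \<not> f r < f q
        else f p < f q \<and> \<not> (f p < f r \<and> f r < f q)"
      if r: "r \<in> S" for r
      unfolding lt[OF p q] lt[OF p r] lt[OF r q]
      using a r lt2[OF p r] lt2[OF r p] lt2[OF r q] lt2[OF q r] lt2[OF p q]
      by (cases "L p"; cases "L q"; cases "L r") auto
    thus ?thesis using p by (cases "L p = L q") (auto simp: not_less)
  qed
  finally show ?thesis by (simp add: q_def)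
qed

lemma cyc_next_mono:
  assumes "finite S" "bij_betw f S T" "p \<in> S"
    and "\<And>x y. x \<in> S \<Longrightarrow> y \<in> S \<Longrightarrow> x < y \<Longrightarrow> f x < f y"
  shows "cyc_next T (f p) = f (cyc_next S p)"
  by (rule cyc_next_rotate[of S f T p "\<lambda>_. True"]) (use assms in auto)

text \<open>
  Rows are indexed by passages, columns by incoming arcs. A marked point that is no crossing is
  an over-passage of weight \<open>1\<close>.
\<close>

definition relation_matrix ::
    "real set \<Rightarrow> (real \<Rightarrow> 'a) \<Rightarrow> (real \<Rightarrow> real) \<Rightarrow> (real \<Rightarrow> bool) \<Rightarrow> real \<Rightarrow> real \<Rightarrow> 'a :: comm_ring_1" where
  "relation_matrix T lam oth ov p l =
     (if l = p then lam p else 0)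
     + (if l = oth p \<and> \<not> ov p then 1 - lam p * lam (oth p) else 0)
     - (if l = cyc_next T p then 1 else 0)"

definition alex_det where
  "alex_det T lam oth ov = det_on T (relation_matrix T lam oth ov)"

lemma alex_det_cong:
  assumes "finite T" "\<And>p. p \<in> T \<Longrightarrow> lam p = lam' p" "\<And>p. p \<in> T \<Longrightarrow> ov p = ov' p"
    "\<And>p. p \<in> T \<Longrightarrow> \<not> ov p \<Longrightarrow> oth p = oth' p \<and> oth p \<in> T"
  shows "alex_det T lam oth ov = alex_det T lam' oth' ov'"
  unfolding alex_det_def
proof (rule det_on_cong)
  fix p l assume p: "p \<in> T" and "l \<in> T"
  show "relation_matrix T lam oth ov p l = relation_matrix T lam' oth' ov' p l"
  proof (cases "ov p")
    case False
    hence "oth' p = oth p" "lam (oth p) = lam' (oth p)" using assms(2,4) p by metis+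
    thus ?thesis by (simp add: relation_matrix_def assms(2,3)[OF p])
  qed (simp add: relation_matrix_def assms(2) assms(3)[OF p] p)
qed

lemma alex_det_relabel:
  assumes fin: "finite S" and bij: "bij_betw f S T"
    and nxt: "\<And>p. p \<in> S \<Longrightarrow> cyc_next T (f p) = f (cyc_next S p)"
    and oth: "\<And>p. p \<in> S \<Longrightarrow> \<not> ov p \<Longrightarrow> oth p \<in> S \<and> oth' (f p) = f (oth p)"
    and lam: "\<And>p. p \<in> S \<Longrightarrow> lam' (f p) = lam p" and ov: "\<And>p. p \<in> S \<Longrightarrow> ov' (f p) = ov p"
  shows "alex_det T lam' oth' ov' = alex_det S lam oth ov"
  unfolding alex_det_def det_on_relabel[OF bij fin]
proof (rule det_on_cong)
  fix p l assume pl: "p \<in> S" "l \<in> S"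
  have inj: "f x = f y \<longleftrightarrow> x = y" if "x \<in> S" "y \<in> S" for x y
    using bij that by (auto simp: bij_betw_def inj_on_def)
  show "relation_matrix T lam' oth' ov' (f p) (f l) = relation_matrix S lam oth ov p l"
    using pl oth[OF pl(1)] lam ov[OF pl(1)] cyc_next_mem[OF fin pl(1)]
    by (cases "ov p") (simp_all add: relation_matrix_def nxt inj)
qed

section \<open>Trivial passages\<close>

lemma cyc_next_insert:
  assumes fin: "finite T" and T: "T \<noteq> {}" and p: "p \<notin> T" and k: "k \<in> T"
  shows "cyc_next T k = (if cyc_next (insert p T) k = p then cyc_next (insert p T) p else cyc_next (insert p T) k)"
proof -
  let ?S = "insert p T"
  have finS: "finite ?S" using fin by simp
  define q where "q = cyc_next ?S k"
  have q: "q \<in> ?S" unfolding q_def using k by (intro cyc_next_mem[OF finS]) simp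
  have kS: "k \<in> ?S" and pS: "p \<in> ?S" using k by auto
  have q1: "(k < q \<and> (\<forall>r\<in>?S. \<not> (k < r \<and> r < q))) \<or> (q \<le> k \<and> (\<forall>r\<in>?S. r \<le> k \<and> q \<le> r))"
    using cyc_next_eq_iff[OF finS kS q] by (simp add: q_def)
  show ?thesis
  proof (cases "q = p")
    case False
    hence "cyc_next T k = q" using q q1 by (subst cyc_next_eq_iff[OF fin k]) auto
    thus ?thesis using False by (simp add: q_def)
  next
    case True
    define r where "r = cyc_next ?S p"
    have r: "r \<in> ?S" unfolding r_def by (intro cyc_next_mem[OF finS]) simp
    have r1: "(p < r \<and> (\<forall>x\<in>?S. \<not> (p < x \<and> x < r))) \<or> (r \<le> p \<and> (\<forall>x\<in>?S. x \<le> p \<and> r \<le> x))"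
      using cyc_next_eq_iff[OF finS pS r] by (simp add: r_def)
    have kp: "k \<noteq> p" using k p by auto
    have "r \<noteq> p" using r1 T p k by fastforce
    hence rT: "r \<in> T" using r by simp
    have "cyc_next T k = r"
    proof (subst cyc_next_eq_iff[OF fin k rT])
      show "k < r \<and> (\<forall>x\<in>T. \<not> (k < x \<and> x < r)) \<or> r \<le> k \<and> (\<forall>x\<in>T. x \<le> k \<and> r \<le> x)"
        using q1 r1 True kp k rT p by (smt (verit) insert_iff)
    qed
    thus ?thesis using True by (simp add: q_def r_def)
  qed
qed

text \<open>The relation at \<open>p\<close> merely identifies its incoming with its outgoing arc.
  Adding column \<open>p\<close> to the column of the next arc makes row \<open>p\<close> a unit row
  and performs this identification in all other rows. Non-emptiness of \<open>T\<close> makes the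
  two arcs different.\<close>

lemma alex_det_insert_trivial:
  assumes fin: "finite T" and T: "T \<noteq> {}" and p: "p \<notin> T"
    and triv: "lam p = 1" "ov p" and oth: "\<And>k. k \<in> T \<Longrightarrow> \<not> ov k \<Longrightarrow> oth k \<in> T"
  shows "alex_det (insert p T) lam oth ov = alex_det T lam oth ov"
proof -
  let ?S = "insert p T"
  let ?A = "relation_matrix ?S lam oth ov"
  define q where "q = cyc_next ?S p"
  have finS: "finite ?S" using fin by simp
  have qS: "q \<in> ?S" unfolding q_def by (rule cyc_next_mem[OF finS]) simp
  have qp: "q \<noteq> p"
  proof
    assume "q = p"
    hence "\<forall>r\<in>T. r = p" using cyc_next_eq_iff[OF finS, of p p] by (auto simp: q_def)
    thus False using T p by auto
  qed
  define B where "B = (\<lambda>k l. if l = q then 1 * ?A k p + ?A k q else ?A k l)"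
  have rowp: "?A p l = (if l = p then 1 else 0) - (if l = q then 1 else 0)" for l
    by (simp add: relation_matrix_def triv q_def)
  have "det_on ?S ?A = det_on ?S (\<lambda>l k. ?A k l)"
    by (rule det_on_transpose[symmetric, OF finS])
  also have "\<dots> = det_on ?S (\<lambda>l k. if l = q then 1 * ?A k p + ?A k q else ?A k l)"
    by (rule det_on_add_row[symmetric, OF finS qS _ qp]) simp
  also have "\<dots> = det_on ?S B"
    unfolding B_def by (rule det_on_transpose[OF finS])
  also have "\<dots> = det_on T B"
    using qp by (intro det_on_unit_row fin p) (auto simp: B_def rowp)
  also have "\<dots> = det_on T (relation_matrix T lam oth ov)"
  proof (rule det_on_cong)
    fix k l assume k: "k \<in> T" and l: "l \<in> T"
    have kp: "k \<noteq> p" "l \<noteq> p" using k l p by auto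
    have nk: "cyc_next T k = (if cyc_next ?S k = p then q else cyc_next ?S k)"
      unfolding q_def by (rule cyc_next_insert[OF fin T p k])
    have nkq: "cyc_next ?S k \<noteq> q"
      using cyc_next_eq_cancel[OF finS, of k p] k kp by (auto simp: q_def)
    have "\<not> ov k \<Longrightarrow> oth k \<noteq> p" using oth[OF k] p by auto
    thus "B k l = relation_matrix T lam oth ov k l"
      using kp qp nkq by (auto simp: B_def relation_matrix_def nk)
  qed
  finally show ?thesis by (simp add: alex_det_def)
qed

lemma alex_det_union_trivial:
  assumes finX: "finite X" and fin: "finite T" and T: "T \<noteq> {}" and X: "X \<inter> T = {}"
    and triv: "\<And>p. p \<in> X \<Longrightarrow> lam p = 1 \<and> ov p" and oth: "\<And>k. k \<in> T \<Longrightarrow> \<not> ov k \<Longrightarrow> oth k \<in> T"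
  shows "alex_det (X \<union> T) lam oth ov = alex_det T lam oth ov"
  using finX X triv
proof (induction X)
  case (insert p X)
  have "alex_det (insert p (X \<union> T)) lam oth ov = alex_det (X \<union> T) lam oth ov"
    using insert T oth fin by (intro alex_det_insert_trivial) auto
  thus ?case using insert by simp
qed simp

section \<open>Effect of the three moves on the determinant\<close>

lemma cyc_next_unique:
  assumes "finite T" "p \<in> T" "k \<in> T" "k \<noteq> p" "cyc_next T p = q"
  shows "cyc_next T k \<noteq> q"
  using cyc_next_eq_cancel[of T k p] assms by auto

text \<open>The arc from \<open>p\<close> to \<open>q\<close> is the loop, and it is eliminated on
  both sides. If the loop is entered over, its value is \<open>lam p\<close> times the incoming one
  and the under-passage restores the latter. If it is entered under, the loop is also the incoming
  over-arc of its own relation, so the pivot is \<open>- (lam p * lam q)\<close> instead of -1. This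
  pivot has to be invertible and is the factor that makes the polynomial well defined only up to
  units.\<close>

lemma alex_det_move_I:
  fixes lam :: "real \<Rightarrow> 'a :: comm_ring_1"
  assumes fin: "finite T" and p: "p \<in> T" and q: "q \<in> T" "q \<noteq> p" and nxt: "cyc_next T p = q"
    and oth: "oth p = q" "oth q = p" and ov: "ov p \<longleftrightarrow> \<not> ov q" and u: "lam p * lam q * u = 1"
    and other: "\<And>k. k \<in> T - {p, q} \<Longrightarrow> \<not> ov k \<Longrightarrow> oth k \<notin> {p, q}"
  shows "\<exists>w \<in> {1, lam p * lam q}. alex_det T lam oth ov =
    w * alex_det T (lam(p := 1, q := 1)) oth (ov(p := True, q := True))"
proof -
  let ?A = "relation_matrix T lam oth ov"
  let ?B = "relation_matrix T (lam(p := 1, q := 1)) oth (ov(p := True, q := True))"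
  have nq: "cyc_next T k \<noteq> q" if "k \<in> T" "k \<noteq> p" for k
    using cyc_next_unique[OF fin p that nxt] .
  have B: "det_on T ?B = (- 1) * det_on T (eliminate p q (- 1) ?B)"
    using det_on_eliminate[OF fin p q(1), of ?B "- 1"] q(2) nxt by (simp add: relation_matrix_def)
  have row: "?A k q = 0" "?A k l = ?B k l" "?B k q = 0" if "k \<in> T" "k \<noteq> p" "k \<noteq> q" for k l
    using that nq[of k] other[of k] by (auto simp: relation_matrix_def)
  show ?thesis
  proof (cases "ov p")
    case True
    have Apq: "?A p q = - 1" using q(2) nxt True by (simp add: relation_matrix_def)
    have "det_on T ?A = (- 1) * det_on T (eliminate p q (- 1) ?A)"
      using det_on_eliminate[OF fin p q(1), of ?A "- 1"] Apq by simp
    also have "det_on T (eliminate p q (- 1) ?A) = det_on T (eliminate p q (- 1) ?B)"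
    proof (rule det_on_cong)
      fix k l assume "k \<in> T" "l \<in> T"
      consider "k = p" | "k = q" | "k \<noteq> p" "k \<noteq> q" by blast
      thus "eliminate p q (- 1) ?A k l = eliminate p q (- 1) ?B k l"
      proof cases
        case 2
        have "cyc_next T q \<noteq> q" using nq q by auto
        thus ?thesis using 2 True ov q(2) oth nxt
          by (auto simp: eliminate_def relation_matrix_def algebra_simps)
      qed (use row \<open>k \<in> T\<close> in \<open>auto simp: eliminate_def\<close>)
    qed
    finally have "det_on T ?A = det_on T ?B" using B by simp
    thus ?thesis by (auto simp: alex_det_def)
  next
    case False
    have Apq: "?A p q = - (lam p * lam q)"
      using q(2) nxt False oth by (simp add: relation_matrix_def)
    have "det_on T ?A = - (lam p * lam q) * det_on T (eliminate p q (- u) ?A)"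
      using det_on_eliminate[OF fin p q(1), of ?A "- u"] Apq u by simp
    also have "det_on T (eliminate p q (- u) ?A) = det_on T (eliminate p q (- 1) ?B)"
    proof (rule det_on_cong)
      fix k l assume "k \<in> T" "l \<in> T"
      consider "k = p" | "k = q" | "k \<noteq> p" "k \<noteq> q" by blast
      thus "eliminate p q (- u) ?A k l = eliminate p q (- 1) ?B k l"
      proof cases
        case 2
        have "cyc_next T q \<noteq> q" using nq q by auto
        moreover have "lam q * u * lam p = 1"
          using u by (simp add: mult_ac)
        moreover have "lam q * u * (lam p * lam q) = lam q * (lam p * lam q * u)"
          by (simp add: mult_ac)
        hence "lam q * u * (lam p * lam q) = lam q" by (simp add: u)
        ultimately show ?thesis using 2 False ov q(2) oth nxt
          by (simp add: eliminate_def relation_matrix_def)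
      qed (use row \<open>k \<in> T\<close> in \<open>auto simp: eliminate_def\<close>)
    qed
    finally have "det_on T ?A = lam p * lam q * det_on T ?B" using B by simp
    thus ?thesis by (auto simp: alex_det_def)
  qed
qed

text \<open>After elimination of both inner arcs, with pivots -1, each strand leaves with the value
  with which it entered: the two contributions of the over-strand to the under-strand cancel. The
  disjunction in \<open>oth\<close> distinguishes whether the under-strand meets the two crossings
  in the same order as the over-strand or in the opposite one.\<close>

lemma alex_det_move_II:
  fixes lam :: "real \<Rightarrow> 'a :: comm_ring_1"
  assumes fin: "finite T" and mem: "p0 \<in> T" "q0 \<in> T" "p1 \<in> T" "q1 \<in> T"
    and dist: "distinct [p0, q0, p1, q1]"
    and nxt: "cyc_next T p0 = q0" "cyc_next T p1 = q1"
    and oth: "(oth p1 = p0 \<and> oth q1 = q0) \<or> (oth p1 = q0 \<and> oth q1 = p0)"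
    and ov: "ov p0" "ov q0" "\<not> ov p1" "\<not> ov q1"
    and lam: "lam p0 * lam q0 = 1" "lam p1 * lam q1 = 1"
    and other: "\<And>k. k \<in> T - {p0, q0, p1, q1} \<Longrightarrow> \<not> ov k \<Longrightarrow> oth k \<notin> {p0, q0, p1, q1}"
  shows "alex_det T lam oth ov =
    alex_det T (lam(p0 := 1, q0 := 1, p1 := 1, q1 := 1)) oth (ov(p1 := True, q1 := True))"
proof -
  let ?A = "relation_matrix T lam oth ov"
  let ?B = "relation_matrix T (lam(p0 := 1, q0 := 1, p1 := 1, q1 := 1)) oth (ov(p1 := True, q1 := True))"
  let ?E = "\<lambda>A. eliminate p1 q1 (- 1) (eliminate p0 q0 (- 1) A)"
  have nq0: "cyc_next T k \<noteq> q0" if "k \<in> T" "k \<noteq> p0" for k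
    using cyc_next_unique[OF fin mem(1) that nxt(1)] .
  have nq1: "cyc_next T k \<noteq> q1" if "k \<in> T" "k \<noteq> p1" for k
    using cyc_next_unique[OF fin mem(3) that nxt(2)] .
  have d: "p0 \<noteq> q0" "p0 \<noteq> p1" "p0 \<noteq> q1" "q0 \<noteq> p1" "q0 \<noteq> q1" "p1 \<noteq> q1"
     "q0 \<noteq> p0" "p1 \<noteq> p0" "q1 \<noteq> p0" "p1 \<noteq> q0" "q1 \<noteq> q0" "q1 \<noteq> p1" using dist by auto
  have E: "det_on T A = det_on T (?E A)" if A: "A p0 q0 = - 1" "A p1 q1 - A p1 q0 * (- 1) * A p0 q1 = - 1" for A :: "real \<Rightarrow> real \<Rightarrow> 'a"
  proof -
    have "det_on T A = (- 1) * det_on T (eliminate p0 q0 (- 1) A)"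
      using det_on_eliminate[OF fin mem(1,2), of A "- 1"] A(1) by simp
    also have "eliminate p0 q0 (- 1) A p1 q1 = - 1" using A(2) d by (simp add: eliminate_def)
    hence "det_on T (eliminate p0 q0 (- 1) A) = (- 1) * det_on T (?E A)"
      using det_on_eliminate[OF fin mem(3,4), of "eliminate p0 q0 (- 1) A" "- 1"] by simp
    finally show ?thesis by simp
  qed
  have n: "cyc_next T q0 \<noteq> q0" "cyc_next T q0 \<noteq> q1" "cyc_next T q1 \<noteq> q0" "cyc_next T q1 \<noteq> q1"
    using nq0 nq1 mem d by auto
  have row: "?A k q0 = 0" "?A k q1 = 0" "?A k l = ?B k l"
    if k: "k \<in> T" "k \<notin> {p0, q0, p1, q1}" for k l
  proof -
    have kn: "k \<noteq> p0" "k \<noteq> q0" "k \<noteq> p1" "k \<noteq> q1" using k(2) by simp_all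
    have "q0 \<noteq> cyc_next T k" "q1 \<noteq> cyc_next T k"
      using nq0[OF k(1) kn(1)] nq1[OF k(1) kn(3)] by simp_all
    moreover have "ov k \<or> oth k \<notin> {p0, q0, p1, q1}" using other[of k] k by blast
    ultimately have kn': "ov k \<or> p0 \<noteq> oth k \<and> q0 \<noteq> oth k \<and> p1 \<noteq> oth k \<and> q1 \<noteq> oth k
        \<and> oth k \<noteq> p0 \<and> oth k \<noteq> q0 \<and> oth k \<noteq> p1 \<and> oth k \<noteq> q1"
      "q0 \<noteq> cyc_next T k" "q1 \<noteq> cyc_next T k" "q0 \<noteq> k" "q1 \<noteq> k" using kn by auto
    show "?A k q0 = 0" using kn kn' by (cases "ov k") (simp_all add: relation_matrix_def)
    show "?A k q1 = 0" using kn kn' by (cases "ov k") (simp_all add: relation_matrix_def)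
    show "?A k l = ?B k l" using kn kn' by (cases "ov k") (simp_all add: relation_matrix_def)
  qed
  have "det_on T ?A = det_on T (?E ?A)"
    using oth by (intro E; elim disjE; simp add: relation_matrix_def d nxt ov)
  also have "\<dots> = det_on T (?E ?B)"
  proof (rule det_on_cong)
    fix k l assume kl: "k \<in> T" "l \<in> T"
    have lam': "lam p0 * (lam q0 * x) = x" "lam p1 * (lam q1 * x) = x" for x
      using lam by (simp_all flip: mult.assoc)
    hence "lam p0 * (lam p1 * (lam q0 * lam q1)) = 1"
      using lam by (simp add: mult.left_commute[of "lam p1" "lam q0"])
    note lam' = this lam'
    consider "k = p0" | "k = q0" | "k = p1" | "k = q1" | "k \<notin> {p0, q0, p1, q1}" by blast
    thus "?E ?A k l = ?E ?B k l"
    proof cases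
      case 5
      thus ?thesis using row[OF kl(1) 5] row(3)[OF kl(1) 5, of q0] row(3)[OF kl(1) 5, of q1]
        by (auto simp: eliminate_def)
    next
      case 4
      from oth show ?thesis
      proof
        assume "oth p1 = p0 \<and> oth q1 = q0"
        thus ?thesis using 4 d n nxt ov lam
          by (simp add: eliminate_def relation_matrix_def) (simp add: algebra_simps lam')
      next
        assume "oth p1 = q0 \<and> oth q1 = p0"
        thus ?thesis using 4 d n nxt ov lam
          by (simp add: eliminate_def relation_matrix_def) (simp add: algebra_simps lam')
      qed
    next
      case 1
      thus ?thesis using d n nxt ov by (simp add: eliminate_def relation_matrix_def)
    next
      case 2
      thus ?thesis using d n nxt ov lam
        by (simp add: eliminate_def relation_matrix_def) (simp add: algebra_simps lam')?
    next
      case 3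
      thus ?thesis using d n nxt ov by (simp add: eliminate_def)
    qed
  qed
  also have "\<dots> = det_on T ?B"
    by (rule E[symmetric]) (simp_all add: relation_matrix_def d nxt ov)
  finally show ?thesis by (simp add: alex_det_def)
qed

text \<open>
  Three strands with two passages \<open>p\<^sub>i\<close>, \<open>q\<^sub>i\<close> each; \<open>cross_coeff x y\<close> is the coefficient of arc \<open>y\<close> in
  the relation of passage \<open>x\<close>. Eliminating the three inner arcs expresses the outgoing arcs by the
  incoming ones.
\<close>

definition cross_coeff ::
    "(real \<Rightarrow> 'a) \<Rightarrow> (real \<Rightarrow> real) \<Rightarrow> (real \<Rightarrow> bool) \<Rightarrow> real \<Rightarrow> real \<Rightarrow> 'a :: comm_ring_1" where
  "cross_coeff lam oth ov x y = (if \<not> ov x \<and> oth x = y then 1 - lam x * lam y else 0)"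

lemma relation_matrix_cross_coeff:
  "relation_matrix T lam oth ov k l =
     (if l = k then lam k else 0) + cross_coeff lam oth ov k l - (if l = cyc_next T k then 1 else 0)"
  by (simp add: relation_matrix_def cross_coeff_def)

text \<open>The rows \<open>q0\<close>, \<open>q1\<close>, \<open>q2\<close> hold a lower triangular
  matrix that takes the three incoming arcs to the outgoing ones, with diagonal \<open>t0\<close>,
  \<open>t1\<close>, \<open>t2\<close>. It is triangular because strand 0 is on top and a strand is
  influenced only by those above it. The rows \<open>p0\<close>, \<open>p1\<close>,
  \<open>p2\<close> are unit rows left by elimination.\<close>

definition transfer_matrix where
  "transfer_matrix T A p0 q0 p1 q1 p2 q2 t0 t1 m10 t2 m21 m20 k l =
    (if k = p0 then (if l = q0 then 1 else 0)
     else if k = p1 then (if l = q1 then 1 else 0)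
     else if k = p2 then (if l = q2 then 1 else 0)
     else if k = q0 then (if l = p0 then t0 else 0) - (if l = cyc_next T q0 then 1 else 0)
     else if k = q1 then (if l = p1 then t1 else 0) + (if l = p0 then m10 else 0) - (if l = cyc_next T q1 then 1 else 0)
     else if k = q2 then (if l = p2 then t2 else 0) + (if l = p1 then m21 else 0)
       + (if l = p0 then m20 else 0) - (if l = cyc_next T q2 then 1 else 0)
     else A k l)"

text \<open>The inner arcs are eliminated from the top strand downwards, so that each pivot is still
  -1 when its turn comes; the sign is the product of the three pivots. By \<open>other\<close>, no
  row outside the window contains an inner arc.\<close>

lemma det_on_transfer:
  fixes lam :: "real \<Rightarrow> 'a :: comm_ring_1"
  assumes fin: "finite T" and mem: "p0 \<in> T" "q0 \<in> T" "p1 \<in> T" "q1 \<in> T" "p2 \<in> T" "q2 \<in> T"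
    and dist: "distinct [p0, q0, p1, q1, p2, q2]"
    and nxt: "cyc_next T p0 = q0" "cyc_next T p1 = q1" "cyc_next T p2 = q2"
    and ov0: "ov p0" "ov q0"
    and oth1: "\<forall>x \<in> {p1, q1}. \<not> ov x \<longrightarrow> oth x \<in> {p0, q0}"
    and oth2: "\<forall>x \<in> {p2, q2}. \<not> ov x \<longrightarrow> oth x \<in> {p0, q0, p1, q1}"
    and other: "\<forall>k \<in> T - {p0, q0, p1, q1, p2, q2}. \<not> ov k \<longrightarrow> oth k \<notin> {p0, q0, p1, q1, p2, q2}"
  defines "c \<equiv> cross_coeff lam oth ov"
  shows "alex_det T lam oth ov = - det_on T (transfer_matrix T (relation_matrix T lam oth ov) p0 q0 p1 q1 p2 q2
      (lam q0 * lam p0)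
      (lam q1 * lam p1)
      (lam q1 * (c p1 p0 + c p1 q0 * lam p0) + c q1 p0 + c q1 q0 * lam p0)
      (lam q2 * lam p2)
      (lam q2 * (c p2 p1 + c p2 q1 * lam p1) + c q2 p1 + c q2 q1 * lam p1)
      (lam q2 * (c p2 p0 + c p2 q0 * lam p0 + c p2 q1 * (c p1 p0 + c p1 q0 * lam p0))
        + c q2 p0 + c q2 q0 * lam p0 + c q2 q1 * (c p1 p0 + c p1 q0 * lam p0)))"
proof -
  let ?A = "relation_matrix T lam oth ov"
  let ?E0 = "eliminate p0 q0 (- 1) ?A"
  let ?E1 = "eliminate p1 q1 (- 1) ?E0"
  let ?E2 = "eliminate p2 q2 (- 1) ?E1"
  have d: "p0 \<noteq> q0" "p0 \<noteq> p1" "p0 \<noteq> q1" "p0 \<noteq> p2" "p0 \<noteq> q2" "q0 \<noteq> p1" "q0 \<noteq> q1" "q0 \<noteq> p2" "q0 \<noteq> q2"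
    "p1 \<noteq> q1" "p1 \<noteq> p2" "p1 \<noteq> q2" "q1 \<noteq> p2" "q1 \<noteq> q2" "p2 \<noteq> q2" using dist by simp_all
  note d = d d[symmetric]
  have nq0: "q0 \<noteq> cyc_next T k" if "k \<in> T" "k \<noteq> p0" for k
    using cyc_next_unique[OF fin mem(1) that nxt(1)] by simp
  have nq1: "q1 \<noteq> cyc_next T k" if "k \<in> T" "k \<noteq> p1" for k
    using cyc_next_unique[OF fin mem(3) that nxt(2)] by simp
  have nq2: "q2 \<noteq> cyc_next T k" if "k \<in> T" "k \<noteq> p2" for k
    using cyc_next_unique[OF fin mem(5) that nxt(3)] by simp
  have c0: "c p0 l = 0" "c q0 l = 0" for l using ov0 by (simp_all add: c_def cross_coeff_def)
  have c1: "c x l = (if l = p0 then c x p0 else 0) + (if l = q0 then c x q0 else 0)" if "x \<in> {p1, q1}" for x l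
    using bspec[OF oth1 that] d by (auto simp: c_def cross_coeff_def)
  have c2: "c x l = (if l = p0 then c x p0 else 0) + (if l = q0 then c x q0 else 0)
      + (if l = p1 then c x p1 else 0) + (if l = q1 then c x q1 else 0)" if "x \<in> {p2, q2}" for x l
    using bspec[OF oth2 that] d by (auto simp: c_def cross_coeff_def)
  have A: "?A k l = (if l = k then lam k else 0) + c k l - (if l = cyc_next T k then 1 else 0)" for k l
    by (simp add: relation_matrix_cross_coeff c_def)
  have rp0: "?A p0 l = (if l = p0 then lam p0 else 0) - (if l = q0 then 1 else 0)" for l
    by (simp add: A c0 nxt)
  have rq0: "?A q0 l = (if l = q0 then lam q0 else 0) - (if l = cyc_next T q0 then 1 else 0)" for l
    by (simp add: A c0)
  have rp1: "?A p1 l = (if l = p1 then lam p1 else 0) + (if l = p0 then c p1 p0 else 0)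
     + (if l = q0 then c p1 q0 else 0) - (if l = q1 then 1 else 0)" for l
    using c1[of p1 l] by (simp add: A nxt)
  have rq1: "?A q1 l = (if l = q1 then lam q1 else 0) + (if l = p0 then c q1 p0 else 0)
     + (if l = q0 then c q1 q0 else 0) - (if l = cyc_next T q1 then 1 else 0)" for l
    using c1[of q1 l] by (simp add: A)
  have rp2: "?A p2 l = (if l = p2 then lam p2 else 0) + (if l = p0 then c p2 p0 else 0)
     + (if l = q0 then c p2 q0 else 0) + (if l = p1 then c p2 p1 else 0)
     + (if l = q1 then c p2 q1 else 0) - (if l = q2 then 1 else 0)" for l
    using c2[of p2 l] by (simp add: A nxt)
  have rq2: "?A q2 l = (if l = q2 then lam q2 else 0) + (if l = p0 then c q2 p0 else 0)
     + (if l = q0 then c q2 q0 else 0) + (if l = p1 then c q2 p1 else 0)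
     + (if l = q1 then c q2 q1 else 0) - (if l = cyc_next T q2 then 1 else 0)" for l
    using c2[of q2 l] by (simp add: A)
  have n: "q0 \<noteq> cyc_next T q0" "q1 \<noteq> cyc_next T q0" "q2 \<noteq> cyc_next T q0"
     "q0 \<noteq> cyc_next T q1" "q1 \<noteq> cyc_next T q1" "q2 \<noteq> cyc_next T q1"
     "q0 \<noteq> cyc_next T q2" "q1 \<noteq> cyc_next T q2" "q2 \<noteq> cyc_next T q2"
    using nq0 nq1 nq2 mem d by simp_all
  note n = n n[symmetric]
  have e0: "det_on T ?A = (- 1) * det_on T ?E0"
    using det_on_eliminate[OF fin mem(1,2), of ?A "- 1"] d by (simp add: rp0)
  have "?E0 p1 q1 = - 1" using d by (simp add: eliminate_def rp0 rp1)
  hence e1: "det_on T ?E0 = (- 1) * det_on T ?E1"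
    using det_on_eliminate[OF fin mem(3,4), of ?E0 "- 1"] by simp
  have "?E1 p2 q2 = - 1" using d by (simp add: eliminate_def rp0 rp1 rp2)
  hence e2: "det_on T ?E1 = (- 1) * det_on T ?E2"
    using det_on_eliminate[OF fin mem(5,6), of ?E1 "- 1"] by simp
  have r: "?A k q0 = 0" "?A k q1 = 0" "?A k q2 = 0"
    if k: "k \<in> T" "k \<notin> {p0, q0, p1, q1, p2, q2}" for k
  proof -
    have kn: "k \<noteq> p0" "k \<noteq> q0" "k \<noteq> p1" "k \<noteq> q1" "k \<noteq> p2" "k \<noteq> q2" using k(2) by simp_all
    have "q0 \<noteq> cyc_next T k" "q1 \<noteq> cyc_next T k" "q2 \<noteq> cyc_next T k"
      using nq0[OF k(1) kn(1)] nq1[OF k(1) kn(3)] nq2[OF k(1) kn(5)] by simp_all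
    moreover have "ov k \<or> oth k \<notin> {p0, q0, p1, q1, p2, q2}" using other k by blast
    ultimately show "?A k q0 = 0" "?A k q1 = 0" "?A k q2 = 0"
      using kn by (auto simp: relation_matrix_def)
  qed
  show ?thesis
    unfolding alex_det_def e0 e1 e2
  proof (simp, rule det_on_cong)
    fix k l assume kl: "k \<in> T" "l \<in> T"
    consider "k = p0" | "k = q0" | "k = p1" | "k = q1" | "k = p2" | "k = q2" | "k \<notin> {p0, q0, p1, q1, p2, q2}" by blast
    thus "?E2 k l = transfer_matrix T (relation_matrix T lam oth ov) p0 q0 p1 q1 p2 q2
      (lam q0 * lam p0)
      (lam q1 * lam p1)
      (lam q1 * (c p1 p0 + c p1 q0 * lam p0) + c q1 p0 + c q1 q0 * lam p0)
      (lam q2 * lam p2)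
      (lam q2 * (c p2 p1 + c p2 q1 * lam p1) + c q2 p1 + c q2 q1 * lam p1)
      (lam q2 * (c p2 p0 + c p2 q0 * lam p0 + c p2 q1 * (c p1 p0 + c p1 q0 * lam p0))
        + c q2 p0 + c q2 q0 * lam p0 + c q2 q1 * (c p1 p0 + c p1 q0 * lam p0)) k l"
    proof cases
      case 1 thus ?thesis using d by (simp add: eliminate_def transfer_matrix_def)
    next
      case 3 thus ?thesis using d by (simp add: eliminate_def transfer_matrix_def)
    next
      case 5 thus ?thesis using d by (simp add: eliminate_def transfer_matrix_def)
    next
      case 2 thus ?thesis using d n
        by (simp add: eliminate_def transfer_matrix_def rp0 rq0)
    next
      case 4 thus ?thesis using d n
        by (simp add: eliminate_def transfer_matrix_def rp0 rq0 rp1 rq1)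
    next
      case 6 thus ?thesis using d n
        by (simp add: eliminate_def transfer_matrix_def rp0 rq0 rp1 rq1 rp2 rq2)
    next
      case 7
      thus ?thesis using r[OF kl(1) 7] by (simp add: eliminate_def transfer_matrix_def)
    qed
  qed
qed

text \<open>The indices 1, 2, 3 stand for the crossings top-middle, top-bottom, middle-bottom, with
  over-weights \<open>a1\<close>, \<open>a2\<close>, \<open>a3\<close> and under-weights
  \<open>b1\<close>, \<open>b2\<close>, \<open>b3\<close>. The flags \<open>m\<close> and
  \<open>b\<close> tell whether the middle and the bottom strand meet the top strand first. The
  three conjuncts equate the entries \<open>m10\<close>, \<open>m21\<close>, \<open>m20\<close> of
  the transfer matrices before and after the move.\<close>

definition triangle_weights :: "bool \<Rightarrow> bool \<Rightarrow> 'a \<Rightarrow> 'a \<Rightarrow> 'a \<Rightarrow> 'a \<Rightarrow> 'a \<Rightarrow> 'a :: comm_ring_1 \<Rightarrow> bool" where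
  "triangle_weights m b a1 b1 a2 b2 a3 b3 \<longleftrightarrow>
    (let c1 = 1 - b1 * a1; c2 = 1 - b2 * a2; c3 = 1 - b3 * a3 in
      (if m then a3 * c1 = c1 * a2 else a3 * (c1 * a2) = c1) \<and>
      (if m = b then b2 * c3 = c3 * b1 else b2 * (c3 * b1) = c3) \<and>
      (if m \<and> b then b3 * (c2 * a1) + c3 * c1 = c2
       else if m then b2 * (c3 * c1) + c2 * a1 = b3 * c2
       else if b then b3 * (c2 * a1) = b2 * (c3 * (c1 * a2)) + c2
       else b3 * c2 + c3 * (c1 * a2) = c2 * a1))"

text \<open>The six times stay fixed while the two crossings on each strand trade places, so a
  weight travels with its crossing from one time of the strand to the other. Diagonal transfer
  entries agree by commutativity, the remaining ones by \<open>triangle_weights\<close>. The top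
  strand is assumed to meet the middle strand before the bottom one.\<close>

lemma alex_det_move_III:
  fixes lam :: "real \<Rightarrow> 'a :: comm_ring_1"
  assumes fin: "finite T" and mem: "p0 \<in> T" "q0 \<in> T" "p1 \<in> T" "q1 \<in> T" "p2 \<in> T" "q2 \<in> T"
    and dist: "distinct [p0, q0, p1, q1, p2, q2]"
    and nxt: "cyc_next T p0 = q0" "cyc_next T p1 = q1" "cyc_next T p2 = q2"
    and m: "(mt, mb) = (if m then (p1, q1) else (q1, p1))" and b: "(bt, bm) = (if b then (p2, q2) else (q2, p2))"
    and ov: "ov p0" "ov q0" "\<not> ov mt" "ov mb" "\<not> ov bt" "\<not> ov bm"
    and oth: "oth mt = p0" "oth bt = q0" "oth bm = mb"
    and ov': "ov' p0" "ov' q0" "ov' mt" "\<not> ov' mb" "\<not> ov' bt" "\<not> ov' bm"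
    and oth': "oth' mb = q0" "oth' bm = p0" "oth' bt = mt"
    and lam: "lam p0 = a1" "lam mt = b1" "lam q0 = a2" "lam bt = b2" "lam mb = a3" "lam bm = b3"
    and lam': "lam' q0 = a1" "lam' mb = b1" "lam' p0 = a2" "lam' bm = b2" "lam' mt = a3" "lam' bt = b3"
    and other: "\<And>k. k \<in> T - {p0, q0, p1, q1, p2, q2} \<Longrightarrow> \<not> ov k \<Longrightarrow> oth k \<notin> {p0, q0, p1, q1, p2, q2}"
    and same: "\<And>k. k \<in> T - {p0, q0, p1, q1, p2, q2} \<Longrightarrow> lam' k = lam k \<and> ov' k = ov k"
    and same': "\<And>k. k \<in> T - {p0, q0, p1, q1, p2, q2} \<Longrightarrow> \<not> ov k \<Longrightarrow> oth' k = oth k \<and> lam' (oth k) = lam (oth k)"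
    and w: "triangle_weights m b a1 b1 a2 b2 a3 b3"
  shows "alex_det T lam' oth' ov' = alex_det T lam oth ov"
proof -
  have d: "p0 \<noteq> q0" "p0 \<noteq> p1" "p0 \<noteq> q1" "p0 \<noteq> p2" "p0 \<noteq> q2" "q0 \<noteq> p1" "q0 \<noteq> q1" "q0 \<noteq> p2" "q0 \<noteq> q2"
    "p1 \<noteq> q1" "p1 \<noteq> p2" "p1 \<noteq> q2" "q1 \<noteq> p2" "q1 \<noteq> q2" "p2 \<noteq> q2" using dist by simp_all
  note d = d d[symmetric]
  have M: "mt = (if m then p1 else q1)" "mb = (if m then q1 else p1)" using m by (simp_all split: if_splits)
  have B: "bt = (if b then p2 else q2)" "bm = (if b then q2 else p2)" using b by (simp_all split: if_splits)
  have t: "transfer_matrix T (relation_matrix T lam' oth' ov') p0 q0 p1 q1 p2 q2 t0 t1 m10 t2 m21 m20 k l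
     = transfer_matrix T (relation_matrix T lam oth ov) p0 q0 p1 q1 p2 q2 t0 t1 m10 t2 m21 m20 k l"
     if "k \<in> T" for k l t0 t1 m10 t2 m21 m20
  proof (cases "k \<in> {p0, q0, p1, q1, p2, q2}")
    case False
    hence "k \<in> T - {p0, q0, p1, q1, p2, q2}" using that by simp
    from same[OF this] same'[OF this]
    have "relation_matrix T lam' oth' ov' k l = relation_matrix T lam oth ov k l"
      by (cases "ov k") (simp_all add: relation_matrix_def)
    thus ?thesis by (simp add: transfer_matrix_def)
  qed (auto simp: transfer_matrix_def)
  let ?X = "{p0, q0, p1, q1, p2, q2}"
  have 1: "\<forall>x \<in> {p1, q1}. \<not> ov x \<longrightarrow> oth x \<in> {p0, q0}" "\<forall>x \<in> {p2, q2}. \<not> ov x \<longrightarrow> oth x \<in> {p0, q0, p1, q1}"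
    using ov oth by (auto simp: M B split: if_splits)
  have 2: "\<forall>x \<in> {p1, q1}. \<not> ov' x \<longrightarrow> oth' x \<in> {p0, q0}" "\<forall>x \<in> {p2, q2}. \<not> ov' x \<longrightarrow> oth' x \<in> {p0, q0, p1, q1}"
    using ov' oth' by (auto simp: M B split: if_splits)
  have 3: "\<forall>k \<in> T - ?X. \<not> ov k \<longrightarrow> oth k \<notin> ?X"
    using other by blast
  have 4: "\<forall>k \<in> T - ?X. \<not> ov' k \<longrightarrow> oth' k \<notin> ?X"
  proof (intro ballI impI)
    fix k assume k: "k \<in> T - ?X" and "\<not> ov' k"
    hence "\<not> ov k" using same[OF k] by simp
    thus "oth' k \<notin> ?X" using other[OF k] same'[OF k] by simp
  qed
  note T1 = det_on_transfer[OF fin mem dist nxt, where lam = lam, OF ov(1,2) 1 3]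
  note T2 = det_on_transfer[OF fin mem dist nxt, where lam = lam', OF ov'(1,2) 2 4]
  note w' = w[unfolded triangle_weights_def Let_def]
  note c = cross_coeff_def
  have X: "lam x * lam y = lam y * lam x" for x y by (simp add: mult.commute)
  have Y: "lam q0 * lam p0 = lam' q0 * lam' p0" "lam q1 * lam p1 = lam' q1 * lam' p1"
     "lam q2 * lam p2 = lam' q2 * lam' p2"
    using lam lam' by (auto simp: M B mult.commute split: if_splits)
  let ?c = "cross_coeff lam oth ov" and ?c' = "cross_coeff lam' oth' ov'"
  have Z1: "lam q1 * (?c p1 p0 + ?c p1 q0 * lam p0) + ?c q1 p0 + ?c q1 q0 * lam p0
     = lam' q1 * (?c' p1 p0 + ?c' p1 q0 * lam' p0) + ?c' q1 p0 + ?c' q1 q0 * lam' p0"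
    using d ov ov' oth oth' lam lam' by (cases m; simp add: M c)
      (insert w', simp_all add: mult_ac add_ac)
  have Z2: "lam q2 * (?c p2 p1 + ?c p2 q1 * lam p1) + ?c q2 p1 + ?c q2 q1 * lam p1
     = lam' q2 * (?c' p2 p1 + ?c' p2 q1 * lam' p1) + ?c' q2 p1 + ?c' q2 q1 * lam' p1"
    using d ov ov' oth oth' lam lam' by (cases m; cases b; simp add: M B c)
      (insert w', simp_all add: mult_ac add_ac)
  have Z3: "lam q2 * (?c p2 p0 + ?c p2 q0 * lam p0 + ?c p2 q1 * (?c p1 p0 + ?c p1 q0 * lam p0))
        + ?c q2 p0 + ?c q2 q0 * lam p0 + ?c q2 q1 * (?c p1 p0 + ?c p1 q0 * lam p0)
     = lam' q2 * (?c' p2 p0 + ?c' p2 q0 * lam' p0 + ?c' p2 q1 * (?c' p1 p0 + ?c' p1 q0 * lam' p0))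
        + ?c' q2 p0 + ?c' q2 q0 * lam' p0 + ?c' q2 q1 * (?c' p1 p0 + ?c' p1 q0 * lam' p0)"
    using d ov ov' oth oth' lam lam' by (cases m; cases b; simp add: M B c)
      (insert w', simp_all add: mult_ac add_ac)
  show ?thesis
    unfolding T1 T2 Y Z1 Z2 Z3
    by (intro arg_cong[where f = uminus] det_on_cong t)
qed

section \<open>Laurent polynomials up to units\<close>

lemma monom_stz_mult [simp]: "monom_stz a b c * monom_stz a' b' c' = monom_stz (a + a') (b + b') (c + c')"
  by (simp add: monom_stz_def Poly_Mapping.mult_single)

lemma monom_stz_0 [simp]: "monom_stz 0 0 0 = 1"
  by (simp add: monom_stz_def zero_prod_def[symmetric])

lemma monom_stz_mult_left: "monom_stz a b c * (monom_stz a' b' c' * x) = monom_stz (a + a') (b + b') (c + c') * x"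
  by (simp flip: mult.assoc)

lemma z_exponents_altdef: "z_exponents P = (\<lambda>x. snd (snd x)) ` Poly_Mapping.keys P"
  by (auto simp: z_exponents_def case_prod_unfold)

lemma z_exponents_0 [simp]: "z_exponents 0 = {}"
  by (simp add: z_exponents_def)

lemma z_exponents_1 [simp]: "z_exponents 1 = {0}"
  by (simp add: z_exponents_altdef)

lemma z_exponents_monom [simp]: "z_exponents (monom_stz a b c) = {c}"
  by (simp add: z_exponents_def monom_stz_def)

lemma z_exponents_uminus [simp]: "z_exponents (- P) = z_exponents P"
  by (simp add: z_exponents_def)

lemma z_exponents_add: "z_exponents (P + Q) \<subseteq> z_exponents P \<union> z_exponents Q"
  using Poly_Mapping.keys_add[of P Q] unfolding z_exponents_altdef by blast

lemma z_exponents_diff: "z_exponents (P - Q) \<subseteq> z_exponents P \<union> z_exponents Q"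
  using z_exponents_add[of P "- Q"] by simp

lemma z_exponents_sum: "z_exponents (sum f A) \<subseteq> (\<Union>x\<in>A. z_exponents (f x))"
proof (induction A rule: infinite_finite_induct)
  case (insert x A)
  thus ?case using z_exponents_add[of "f x" "sum f A"] by auto
qed auto

lemma z_exponents_mult: "z_exponents (P * Q) \<subseteq> {i + j |i j. i \<in> z_exponents P \<and> j \<in> z_exponents Q}"
proof
  fix k assume "k \<in> z_exponents (P * Q)"
  then obtain x where x: "x \<in> Poly_Mapping.keys (P * Q)" "k = snd (snd x)"
    by (auto simp: z_exponents_altdef)
  then obtain y z where "y \<in> Poly_Mapping.keys P" "z \<in> Poly_Mapping.keys Q" "x = y + z"
    using Poly_Mapping.keys_mult[of P Q] by blast
  thus "k \<in> {i + j |i j. i \<in> z_exponents P \<and> j \<in> z_exponents Q}"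
    using x by (auto simp: z_exponents_altdef)
qed

lemma z_exponents_mult_interval:
  assumes "z_exponents P \<subseteq> {a..b}" "z_exponents Q \<subseteq> {c..d}"
  shows "z_exponents (P * Q) \<subseteq> {a + c..b + d}"
  using z_exponents_mult[of P Q] assms by (fastforce simp: subset_iff)

lemma z_exponents_prod_interval:
  assumes "\<And>x. x \<in> A \<Longrightarrow> z_exponents (f x) \<subseteq> {a x..b x}"
  shows "z_exponents (prod f A) \<subseteq> {sum a A..sum b A}"
  using assms
proof (induction A rule: infinite_finite_induct)
  case (insert x A)
  thus ?case using z_exponents_mult_interval[of "f x" "a x" "b x" "prod f A"] by auto
qed auto

text \<open>The potential \<open>g\<close> cancels along every permutation.\<close>

lemma z_exponents_det_on:
  assumes A: "\<And>p l. p \<in> T \<Longrightarrow> l \<in> T \<Longrightarrow> z_exponents (A p l) \<subseteq> {a p + g p - g l..b p + g p - g l}"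
  shows "z_exponents (det_on T A) \<subseteq> {sum a T..sum b T}"
proof -
  have "z_exponents (of_int (sign \<pi>) * (\<Prod>p\<in>T. A p (\<pi> p))) \<subseteq> {sum a T..sum b T}" if \<pi>: "\<pi> permutes T" for \<pi>
  proof -
    have "(\<Sum>p\<in>T. g (\<pi> p)) = sum g T"
      using sum.permute[OF \<pi>, of g] by (simp add: o_def)
    hence "(\<Sum>p\<in>T. a p + g p - g (\<pi> p)) = sum a T" "(\<Sum>p\<in>T. b p + g p - g (\<pi> p)) = sum b T"
      by (simp_all add: sum.distrib sum_subtractf)
    hence "z_exponents (\<Prod>p\<in>T. A p (\<pi> p)) \<subseteq> {sum a T..sum b T}"
      using z_exponents_prod_interval[of T "\<lambda>p. A p (\<pi> p)" "\<lambda>p. a p + g p - g (\<pi> p)" "\<lambda>p. b p + g p - g (\<pi> p)"]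
        A permutes_in_image[OF \<pi>] by simp
    thus ?thesis by (cases \<pi> rule: sign_cases) simp_all
  qed
  thus ?thesis unfolding det_on_def
    by (intro order_trans[OF z_exponents_sum] UN_least) simp
qed

section \<open>Equality up to units, and weights of passages\<close>

definition unit_equiv :: "laurent \<Rightarrow> laurent \<Rightarrow> bool" where
  "unit_equiv P Q \<longleftrightarrow> (\<exists>a b. P = monom_stz a b 0 * Q \<or> P = - (monom_stz a b 0 * Q))"

lemma unit_equiv_refl: "unit_equiv P P"
  unfolding unit_equiv_def by (rule exI[of _ 0], rule exI[of _ 0]) simp

lemma unit_equiv_minus: "unit_equiv P (- P)"
  unfolding unit_equiv_def by (rule exI[of _ 0], rule exI[of _ 0]) simp

lemma unit_equiv_monom: "unit_equiv (monom_stz a b 0 * P) P"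
  unfolding unit_equiv_def by blast

lemma unit_equiv_sym: "unit_equiv P Q \<Longrightarrow> unit_equiv Q P"
proof -
  assume "unit_equiv P Q"
  then obtain a b where "P = monom_stz a b 0 * Q \<or> P = - (monom_stz a b 0 * Q)"
    by (auto simp: unit_equiv_def)
  hence "Q = monom_stz (- a) (- b) 0 * P \<or> Q = - (monom_stz (- a) (- b) 0 * P)"
    by (auto simp: monom_stz_mult_left)
  thus ?thesis unfolding unit_equiv_def by blast
qed

lemma unit_equiv_trans: "unit_equiv P Q \<Longrightarrow> unit_equiv Q R \<Longrightarrow> unit_equiv P R"
proof -
  assume "unit_equiv P Q" "unit_equiv Q R"
  then obtain a b a' b' where "P = monom_stz a b 0 * Q \<or> P = - (monom_stz a b 0 * Q)"
    "Q = monom_stz a' b' 0 * R \<or> Q = - (monom_stz a' b' 0 * R)"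
    by (auto simp: unit_equiv_def)
  hence "P = monom_stz (a + a') (b + b') 0 * R \<or> P = - (monom_stz (a + a') (b + b') 0 * R)"
    by (auto simp: monom_stz_mult_left)
  thus ?thesis unfolding unit_equiv_def by blast
qed

lemma z_exponents_unit_equiv:
  assumes "unit_equiv P Q"
  shows "z_exponents P = z_exponents Q"
proof -
  have "z_exponents P \<subseteq> z_exponents Q" if PQ: "unit_equiv P Q" for P Q
  proof -
    from PQ obtain a b where "P = monom_stz a b 0 * Q \<or> P = - (monom_stz a b 0 * Q)"
      by (auto simp: unit_equiv_def)
    hence "z_exponents P = z_exponents (monom_stz a b 0 * Q)" by auto
    thus ?thesis using z_exponents_mult[of "monom_stz a b 0" Q] by auto
  qed
  thus ?thesis using assms unit_equiv_sym by blast
qed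

lemma z_exponents_empty_iff: "z_exponents P = {} \<longleftrightarrow> P = 0"
  by (simp add: z_exponents_def)

lemma finite_z_exponents: "finite (z_exponents P)"
  by (simp add: z_exponents_def)

lemma z_bound_le:
  assumes "z_exponents P \<subseteq> {- n..n}" "n \<ge> 0"
  shows "z_bound P \<le> n"
proof (cases "P = 0")
  case False
  hence "Max (z_exponents P) \<in> z_exponents P" "Min (z_exponents P) \<in> z_exponents P"
    using finite_z_exponents z_exponents_empty_iff by (auto intro!: Max_in Min_in)
  hence "Max (z_exponents P) \<in> {- n..n}" "Min (z_exponents P) \<in> {- n..n}" using assms by blast+
  thus ?thesis using False by (auto simp: z_bound_def)
qed (use assms in \<open>simp add: z_bound_def\<close>)

text \<open>Here \<open>i\<close> is the orientation of the pair formed by this strand and the other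
  one, that is, the crossing sign at an over-passage and its negative at an under-passage. This is
  why an odd passage has weight \<open>z^i\<close> in both roles, while the exponent of
  \<open>t\<close> needs a minus sign.\<close>

definition passage_weight :: "bool \<Rightarrow> bool \<Rightarrow> int \<Rightarrow> laurent" where
  "passage_weight ev ov i =
    (if ev then if ov then monom_stz i 0 0 else monom_stz 0 (- i) 0 else monom_stz 0 0 i)"

lemma passage_weight_inverse:
  "passage_weight e v i * passage_weight e v (- i) = 1"
  by (simp add: passage_weight_def)

text \<open>Once geometry has expressed two orientations by the third and the orders
  \<open>m\<close>, \<open>b\<close>, finitely many identities between monomials remain. The parity
  condition excludes exactly two even crossings, where a power of \<open>z\<close> would have to
  equal one of \<open>s\<close> or \<open>t\<close>.\<close>

lemma triangle_weights_passage_weight: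
  assumes k: "k = 1 \<or> k = - 1" and e: "e1 \<longleftrightarrow> (e2 \<longleftrightarrow> e3)"
    and k1: "k1 = (if b then k else - k)" and k2: "k2 = (if m then k else - k)"
  shows "triangle_weights m b
     (passage_weight e1 True k1) (passage_weight e1 False (- k1))
     (passage_weight e2 True k2) (passage_weight e2 False (- k2))
     (passage_weight e3 True k) (passage_weight e3 False (- k))"
  using k e unfolding k1 k2
  by (cases m; cases b; cases e1; cases e2; cases e3)
    (auto simp: triangle_weights_def passage_weight_def algebra_simps monom_stz_mult_left)

section \<open>Passages of a diagram\<close>

definition passage_set :: "vdiagram \<Rightarrow> real set" where
  "passage_set D = (overs D \<union> unders D) \<inter> {0..<1}"

definition partner :: "vdiagram \<Rightarrow> real \<Rightarrow> real" where
  "partner D t = (THE u. 0 \<le> u \<and> u < 1 \<and> crossing D t u)"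

definition turn :: "vdiagram \<Rightarrow> real \<Rightarrow> real \<Rightarrow> int" where
  "turn D t u = (if cross_prod (velocity D t) (velocity D u) > 0 then 1 else - 1)"

definition passage_rank :: "vdiagram \<Rightarrow> real \<Rightarrow> nat" where
  "passage_rank D t = card (passage_set D \<inter> {..<t})"

text \<open>Between letters of ranks \<open>k\<close> and \<open>l\<close> there are
  \<open>|k - l| - 1\<close> others, an even number iff \<open>k + l\<close> is odd. In this form
  only ranks modulo 2 have to be followed through a move.\<close>

definition is_even :: "vdiagram \<Rightarrow> real \<Rightarrow> bool" where
  "is_even D t \<longleftrightarrow> odd (passage_rank D t + passage_rank D (partner D t))"

definition weight :: "vdiagram \<Rightarrow> real \<Rightarrow> laurent" where
  "weight D t = passage_weight (is_even D t) (t \<in> overs D) (turn D t (partner D t))"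

text \<open>The times in \<open>X\<close> act as trivial passages. They pad the index set of a
  diagram to that of one with more crossings, and keep it non-empty when there are no
  crossings.\<close>

definition marked_det :: "vdiagram \<Rightarrow> real set \<Rightarrow> laurent" where
  "marked_det D X = alex_det (passage_set D \<union> X) (\<lambda>p. if p \<in> passage_set D then weight D p else 1)
     (partner D) (\<lambda>p. p \<in> passage_set D \<longrightarrow> p \<in> overs D)"

lemma cross_prod_commute: "cross_prod w v = - cross_prod v w"
  by (simp add: cross_prod_def)

lemma crossing_sym: "crossing D t u \<longleftrightarrow> crossing D u t"
proof -
  have "t - u \<in> \<int> \<longleftrightarrow> u - t \<in> \<int>" by (metis Ints_minus minus_diff_eq)
  thus ?thesis by (auto simp: crossing_def)
qed

lemma Ints_unique:
  assumes "x - y \<in> \<int>" "0 \<le> x" "x < 1" "0 \<le> y" "y < (1 :: real)"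
  shows "x = y"
proof -
  from assms(1) obtain n where "x - y = of_int n" by (auto elim: Ints_cases)
  moreover from this assms have "\<bar>real_of_int n\<bar> < 1" by linarith
  hence "n = 0" by linarith
  ultimately show ?thesis by simp
qed

locale diagram =
  fixes D :: vdiagram
  assumes is_diagram: "is_diagram D"
begin

lemma curve_period: "curve D (t + 1) = curve D t"
  using is_diagram by (simp add: is_diagram_def)

lemma curve_period_nat: "curve D (t + of_nat n) = curve D t"
proof (induction n)
  case (Suc n)
  have "curve D (t + of_nat (Suc n)) = curve D ((t + of_nat n) + 1)" by (simp add: add_ac)
  thus ?case using Suc curve_period by simp
qed simp

lemma curve_period_int: "curve D (t + of_int n) = curve D t"
proof (cases "n \<ge> 0")
  case True
  thus ?thesis using curve_period_nat[of t "nat n"] by simp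
next
  case False
  thus ?thesis using curve_period_nat[of "t + of_int n" "nat (- n)"] by simp
qed

lemma curve_frac: "curve D (frac t) = curve D t"
  using curve_period_int[of "frac t" "\<lfloor>t\<rfloor>"] by (simp add: frac_def)

lemma crossing_shift: "crossing D t (u + of_int n) \<longleftrightarrow> crossing D t u"
proof -
  have "t - (u + of_int n) \<in> \<int> \<longleftrightarrow> t - u \<in> \<int>"
    using Ints_add[of "t - (u + of_int n)" "of_int n"] Ints_diff[of "t - u" "of_int n"]
    by (auto simp: algebra_simps)
  thus ?thesis by (simp add: crossing_def curve_period_int)
qed

lemma crossing_frac: "crossing D t (frac u) \<longleftrightarrow> crossing D t u"
  using crossing_shift[of t "frac u" "\<lfloor>u\<rfloor>"] by (simp add: frac_def)

lemma crossing_unique: "crossing D t u \<Longrightarrow> crossing D t v \<Longrightarrow> u - v \<in> \<int>"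
  using is_diagram unfolding is_diagram_def by blast

lemma cross_prod_nonzero: "crossing D t u \<Longrightarrow> cross_prod (velocity D t) (velocity D u) \<noteq> 0"
  using is_diagram by (simp add: is_diagram_def)

lemma overs_iff_unders: "crossing D t u \<Longrightarrow> t \<in> overs D \<longleftrightarrow> u \<in> unders D"
  using is_diagram by (simp add: is_diagram_def)

lemma unders_iff_overs: "crossing D t u \<Longrightarrow> t \<in> unders D \<longleftrightarrow> u \<in> overs D"
  using overs_iff_unders[of u t] crossing_sym[of D t u] by simp

lemma overs_unders_disjoint: "t \<in> overs D \<Longrightarrow> t \<notin> unders D"
  using is_diagram by (auto simp: is_diagram_def)

lemma crossing_exists: "t \<in> overs D \<union> unders D \<Longrightarrow> \<exists>u. crossing D t u"
  using is_diagram by (simp add: is_diagram_def)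

lemma overs_shift: "t + of_int n \<in> overs D \<longleftrightarrow> t \<in> overs D" (is ?thesis1)
  and unders_shift: "t + of_int n \<in> unders D \<longleftrightarrow> t \<in> unders D" (is ?thesis2)
proof -
  have *: "(t + of_int n \<in> overs D \<longleftrightarrow> t \<in> overs D) \<and> (t + of_int n \<in> unders D \<longleftrightarrow> t \<in> unders D)"
    if "crossing D t u" for t u n
  proof -
    have "crossing D (t + of_int n) u" using crossing_shift[of u t n] that crossing_sym by blast
    thus ?thesis using that overs_iff_unders unders_iff_overs by blast
  qed
  have "?thesis1 \<and> ?thesis2"
  proof (cases "\<exists>u. crossing D t u")
    case True
    thus ?thesis using * by blast
  next
    case False
    hence "\<not> (\<exists>u. crossing D (t + of_int n) u)" using crossing_shift crossing_sym by blast
    thus ?thesis using False crossing_exists by blast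
  qed
  thus ?thesis1 ?thesis2 by blast+
qed

lemma partner_eqI: "crossing D t u \<Longrightarrow> 0 \<le> u \<Longrightarrow> u < 1 \<Longrightarrow> partner D t = u"
  unfolding partner_def by (rule the_equality) (auto intro!: Ints_unique dest: crossing_unique)

lemma
  assumes "crossing D t u"
  shows crossing_partner: "crossing D t (partner D t)" and partner_bounds: "0 \<le> partner D t" "partner D t < 1"
proof -
  have "crossing D t (frac u)" using assms crossing_frac by simp
  hence "partner D t = frac u" by (rule partner_eqI) (simp_all add: frac_ge_0 frac_lt_1)
  thus "crossing D t (partner D t)" "0 \<le> partner D t" "partner D t < 1"
    using assms crossing_frac by (simp_all add: frac_lt_1)
qed

lemma passage_crossing:
  assumes "p \<in> passage_set D"
  shows "crossing D p (partner D p)" "0 \<le> partner D p" "partner D p < 1"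
proof -
  obtain u where "crossing D p u" using crossing_exists[of p] assms by (auto simp: passage_set_def)
  thus "crossing D p (partner D p)" "0 \<le> partner D p" "partner D p < 1"
    by (rule crossing_partner partner_bounds)+
qed

lemma partner_in:
  assumes p: "p \<in> passage_set D"
  shows "partner D p \<in> passage_set D"
proof -
  have "p \<in> overs D \<union> unders D" using p by (simp add: passage_set_def)
  hence "partner D p \<in> overs D \<union> unders D"
    using overs_iff_unders[OF passage_crossing(1)[OF p]] unders_iff_overs[OF passage_crossing(1)[OF p]] by blast
  thus ?thesis using passage_crossing[OF p] by (simp add: passage_set_def)
qed

lemma partner_partner:
  assumes p: "p \<in> passage_set D"
  shows "partner D (partner D p) = p"
proof (rule partner_eqI)
  show "crossing D (partner D p) p" using passage_crossing(1)[OF p] crossing_sym by blast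
qed (use p in \<open>simp_all add: passage_set_def\<close>)

lemma partner_neq: "p \<in> passage_set D \<Longrightarrow> partner D p \<noteq> p"
  using passage_crossing(1)[of p] by (auto simp: crossing_def)

lemma partner_overs:
  assumes p: "p \<in> passage_set D"
  shows "partner D p \<in> overs D \<longleftrightarrow> p \<notin> overs D"
proof -
  have "p \<in> overs D \<union> unders D" using p by (simp add: passage_set_def)
  thus ?thesis
    using unders_iff_overs[OF passage_crossing(1)[OF p]] overs_unders_disjoint[of p] by blast
qed

lemma turn_neg:
  assumes "crossing D t u"
  shows "turn D u t = - turn D t u"
  using cross_prod_nonzero[OF assms] cross_prod_commute[of "velocity D t" "velocity D u"]
  by (auto simp: turn_def)

lemma same_point:
  assumes "curve D t = curve D u" "0 \<le> t" "t < 1" "0 \<le> u" "u < 1" "t \<noteq> u"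
  shows "crossing D t u"
  using assms Ints_unique[of t u] by (auto simp: crossing_def)

text \<open>There are finitely many double points, and at most two times of the unit interval lie
  over each.\<close>

lemma finite_passage_set: "finite (passage_set D)"
proof -
  let ?C = "{curve D t |t u. crossing D t u}"
  have "passage_set D \<subseteq> (\<Union>x\<in>?C. {p \<in> passage_set D. curve D p = x})"
    using passage_crossing(1) by blast
  moreover have "finite {p \<in> passage_set D. curve D p = x}" for x
  proof (cases "{p \<in> passage_set D. curve D p = x} = {}")
    case False
    then obtain p where p: "p \<in> passage_set D" "curve D p = x" by blast
    have "q = p \<or> q = partner D p" if "q \<in> passage_set D" "curve D q = x" for q
      using p that same_point[of p q] partner_eqI[of p q] by (auto simp: passage_set_def)
    hence "{p \<in> passage_set D. curve D p = x} \<subseteq> {p, partner D p}" by blast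
    thus ?thesis by (rule finite_subset) simp
  qed (simp only: finite.emptyI)
  moreover have "finite ?C" using is_diagram by (simp add: is_diagram_def)
  ultimately show ?thesis using finite_subset by blast
qed

abbreviation "n_pass \<equiv> card (passage_set D)"

lemma length_passages: "length (passages D) = n_pass"
  and set_passages: "set (passages D) = passage_set D"
  using finite_passage_set by (simp_all add: passages_def passage_set_def)

lemma passages_mono: "i < j \<Longrightarrow> j < n_pass \<Longrightarrow> passages D ! i < passages D ! j"
  using length_passages strict_sorted_list_of_set[of "passage_set D"]
  by (simp add: passages_def passage_set_def sorted_wrt_nth_less)

lemma passages_in: "i < n_pass \<Longrightarrow> passages D ! i \<in> passage_set D"
  using nth_mem[of i "passages D"] by (simp add: length_passages set_passages)

lemma passages_inj: "i < n_pass \<Longrightarrow> j < n_pass \<Longrightarrow> passages D ! i = passages D ! j \<longleftrightarrow> i = j"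
  using passages_mono[of i j] passages_mono[of j i] by (cases i j rule: linorder_cases) auto

lemma passages_less_iff: "i < n_pass \<Longrightarrow> j < n_pass \<Longrightarrow> passages D ! i < passages D ! j \<longleftrightarrow> i < j"
  using passages_mono[of i j] passages_mono[of j i] by (cases i j rule: linorder_cases) auto

lemma passages_index:
  assumes "p \<in> passage_set D"
  obtains i where "i < n_pass" "passages D ! i = p"
  using assms set_passages length_passages by (metis in_set_conv_nth)

lemma passages_bij: "bij_betw (\<lambda>i. passages D ! i) {0..<n_pass} (passage_set D)"
proof (rule bij_betwI')
  fix p assume "p \<in> passage_set D"
  then obtain i where "i < n_pass" "passages D ! i = p" by (rule passages_index)
  thus "\<exists>i\<in>{0..<n_pass}. p = passages D ! i" by force
qed (simp_all add: passages_inj passages_in)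

lemma passage_rank_passages:
  assumes i: "i < n_pass"
  shows "passage_rank D (passages D ! i) = i"
proof -
  have "passage_set D \<inter> {..<passages D ! i} = (\<lambda>j. passages D ! j) ` {0..<i}"
  proof (intro equalityI subsetI)
    fix p assume "p \<in> passage_set D \<inter> {..<passages D ! i}"
    then obtain j where "j < n_pass" "passages D ! j = p" "p < passages D ! i" by (auto elim: passages_index)
    thus "p \<in> (\<lambda>j. passages D ! j) ` {0..<i}" using passages_less_iff i by auto
  qed (use i passages_in passages_mono in auto)
  moreover have "inj_on (\<lambda>j. passages D ! j) {0..<i}"
    using i passages_inj by (auto simp: inj_on_def)
  ultimately show ?thesis by (simp add: passage_rank_def card_image)
qed

lemma other_passage_eq:
  assumes k: "k < n_pass"
  shows "other_passage D k < n_pass" "passages D ! other_passage D k = partner D (passages D ! k)"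
proof -
  let ?p = "passages D ! k"
  note p = passages_in[OF k]
  obtain l where l: "l < n_pass" "passages D ! l = partner D ?p" using passages_index[OF partner_in[OF p]] .
  have lk: "l \<noteq> k" using l partner_neq[OF p] by auto
  have eq: "curve D (partner D ?p) = curve D ?p" using passage_crossing(1)[OF p] by (simp add: crossing_def)
  have "other_passage D k = l"
    unfolding other_passage_def
  proof (rule the_equality)
    show "l < length (gauss_code D) \<and> l \<noteq> k \<and> gauss_code D ! l = gauss_code D ! k"
      using l lk k eq by (simp add: gauss_code_def length_passages)
  next
    fix j assume j: "j < length (gauss_code D) \<and> j \<noteq> k \<and> gauss_code D ! j = gauss_code D ! k"
    hence jn: "j < n_pass" by (simp add: gauss_code_def length_passages)
    have "curve D ?p = curve D (passages D ! j)" "?p \<noteq> passages D ! j"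
      using j k jn passages_inj by (auto simp: gauss_code_def length_passages)
    hence "crossing D ?p (passages D ! j)"
      using p passages_in[OF jn] by (intro same_point) (auto simp: passage_set_def)
    hence "partner D ?p = passages D ! j"
      using passages_in[OF jn] by (intro partner_eqI) (auto simp: passage_set_def)
    thus "j = l" using l jn passages_inj by auto
  qed
  thus "other_passage D k < n_pass" "passages D ! other_passage D k = partner D ?p" using l by auto
qed

lemma other_passage_neq: "k < n_pass \<Longrightarrow> other_passage D k \<noteq> k"
  using other_passage_eq[of k] partner_neq[OF passages_in[of k]] by auto

lemma is_even_passages: "k < n_pass \<Longrightarrow> is_even D (passages D ! k) \<longleftrightarrow> even_passage D k"
proof -
  assume k: "k < n_pass"
  let ?l = "other_passage D k"
  have "is_even D (passages D ! k) \<longleftrightarrow> odd (k + ?l)"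
    using other_passage_eq[OF k] passage_rank_passages k by (simp add: is_even_def flip: other_passage_eq(2))
  also have "\<dots> \<longleftrightarrow> even_passage D k"
    using other_passage_neq[OF k] unfolding even_passage_def by (cases "k < ?l") (auto simp: max_def min_def)
  finally show ?thesis .
qed

lemma passage_sign_eq:
  assumes k: "k < n_pass"
  shows "passage_sign D k = (if passages D ! k \<in> overs D then turn D (passages D ! k) (partner D (passages D ! k))
    else - turn D (passages D ! k) (partner D (passages D ! k)))"
  using other_passage_eq(2)[OF k] turn_neg[OF passage_crossing(1)[OF passages_in[OF k]]]
  by (simp add: passage_sign_def over_passage_def turn_def Let_def)

lemma weight_partner:
  assumes p: "p \<in> passage_set D"
  shows "weight D (partner D p) = passage_weight (is_even D p) (p \<notin> overs D) (- turn D p (partner D p))"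
  using partner_partner[OF p] partner_overs[OF p] turn_neg[OF passage_crossing(1)[OF p]]
  by (simp add: weight_def is_even_def add.commute)

lemma arc_coeff_eq:
  assumes k: "k < n_pass" and l: "l < n_pass"
  defines "p \<equiv> passages D ! k" and "q \<equiv> passages D ! l"
  shows "arc_coeff D k l = (if q = p then weight D p else 0) +
    (if q = partner D p \<and> p \<notin> overs D then 1 - weight D p * weight D (partner D p) else 0)"
proof -
  have 1: "q = p \<longleftrightarrow> l = k" using passages_inj k l by (simp add: p_def q_def)
  have 2: "q = partner D p \<longleftrightarrow> l = other_passage D k"
    using passages_inj[OF l other_passage_eq(1)[OF k]] other_passage_eq(2)[OF k] by (simp add: p_def q_def)
  show ?thesis
    unfolding 1 2 arc_coeff_def Let_def weight_partner[OF passages_in[OF k], folded p_def]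
    using is_even_passages[OF k] passage_sign_eq[OF k] other_passage_neq[OF k]
    by (auto simp: p_def[symmetric] over_passage_def weight_def passage_weight_def)
qed

lemma cyc_next_passages:
  assumes k: "k < n_pass"
  shows "cyc_next (passage_set D) (passages D ! k) = passages D ! (Suc k mod n_pass)"
proof -
  let ?l = "Suc k mod n_pass"
  have l: "?l < n_pass" using k by (intro mod_less_divisor) auto
  show ?thesis
  proof (subst cyc_next_eq_iff[OF finite_passage_set passages_in[OF k] passages_in[OF l]], cases "Suc k < n_pass")
    case True
    hence "?l = Suc k" by simp
    moreover have "\<not> (passages D ! k < r \<and> r < passages D ! Suc k)" if r: "r \<in> passage_set D" for r
    proof -
      obtain j where "j < n_pass" "passages D ! j = r" using passages_index[OF r] .
      thus ?thesis using passages_less_iff[OF k, of j] passages_less_iff[OF _ True, of j] by auto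
    qed
    ultimately show "passages D ! k < passages D ! ?l \<and>
        (\<forall>r\<in>passage_set D. \<not> (passages D ! k < r \<and> r < passages D ! ?l)) \<or>
      passages D ! ?l \<le> passages D ! k \<and> (\<forall>r\<in>passage_set D. r \<le> passages D ! k \<and> passages D ! ?l \<le> r)"
      using passages_mono[of k "Suc k"] True by simp
  next
    case False
    hence n: "Suc k = n_pass" using k by simp
    hence "?l = 0" by simp
    moreover have "r \<le> passages D ! k \<and> passages D ! 0 \<le> r" if r: "r \<in> passage_set D" for r
    proof -
      obtain j where "j < n_pass" "passages D ! j = r" using passages_index[OF r] .
      thus ?thesis using passages_less_iff[OF k, of j] passages_less_iff[of j 0] n by (auto simp: not_less[symmetric])
    qed
    ultimately show "passages D ! k < passages D ! ?l \<and>
        (\<forall>r\<in>passage_set D. \<not> (passages D ! k < r \<and> r < passages D ! ?l)) \<or>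
      passages D ! ?l \<le> passages D ! k \<and> (\<forall>r\<in>passage_set D. r \<le> passages D ! k \<and> passages D ! ?l \<le> r)"
      using passages_in[OF k] by auto
  qed
qed

lemma zpa_det_no_passages:
  assumes "passage_set D = {}"
  shows "zpa_det D = 0"
proof -
  have A: "arc_matrix D = 1\<^sub>m 1" using assms length_passages by (simp add: arc_matrix_def)
  have "(1\<^sub>m 1 :: laurent mat) - 1\<^sub>m 1 = 0\<^sub>m 1 1"
    by (rule minus_r_inv_mat) (rule one_carrier_mat)
  thus ?thesis unfolding zpa_det_def A index_one_mat(2) by (simp only: det_zero zero_less_one)
qed

text \<open>The two matrices have the same rows, listed by passages here and by their outgoing arcs
  in \<open>arc_matrix\<close>; the reordering costs only a sign.\<close>

lemma zpa_det_eq: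
  assumes ne: "passage_set D \<noteq> {}"
  shows "unit_equiv (alex_det (passage_set D) (weight D) (partner D) (\<lambda>p. p \<in> overs D)) (zpa_det D)"
proof -
  define n where "n = n_pass"
  have n: "n > 0" unfolding n_def using ne finite_passage_set by (simp add: card_gt_0_iff)
  \<comment> \<open>The cyclic predecessor: arc \<open>i\<close> is the outgoing arc of passage
    \<open>\<rho> i\<close>.\<close>
  define \<rho> where "\<rho> = (\<lambda>i. if i < n then (i + n - 1) mod n else i)"
  have \<rho>: "\<rho> permutes {0..<n}"
  proof (rule bij_imp_permutes)
    have "Suc (\<rho> i) mod n = i" "\<rho> i < n" if "i < n" for i
      using that n by (auto simp: \<rho>_def mod_Suc_eq)
    hence "inj_on \<rho> {0..<n}" "\<rho> ` {0..<n} \<subseteq> {0..<n}"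
      by (auto intro!: inj_onI) metis
    thus "bij_betw \<rho> {0..<n} {0..<n}"
      by (simp add: bij_betw_def endo_inj_surj)
  qed (auto simp: \<rho>_def)
  let ?B = "\<lambda>k l. arc_coeff D k l - (if l = Suc k mod n then 1 else 0)"
  have "alex_det (passage_set D) (weight D) (partner D) (\<lambda>p. p \<in> overs D) = det_on {0..<n} ?B"
    unfolding alex_det_def det_on_relabel[OF passages_bij finite_atLeastLessThan] n_def[symmetric]
  proof (rule det_on_cong)
    fix k l assume "k \<in> {0..<n}" "l \<in> {0..<n}"
    hence kl: "k < n_pass" "l < n_pass" by (simp_all add: n_def)
    have "Suc k mod n_pass < n_pass" using kl by (intro mod_less_divisor) auto
    thus "relation_matrix (passage_set D) (weight D) (partner D) (\<lambda>p. p \<in> overs D) (passages D ! k) (passages D ! l)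
        = ?B k l"
      using kl by (simp add: relation_matrix_def arc_coeff_eq cyc_next_passages passages_inj n_def)
  qed
  moreover have "zpa_det D = det_on {0..<n} (\<lambda>i l. ?B (\<rho> i) l)"
  proof -
    have "arc_matrix D - 1\<^sub>m (dim_row (arc_matrix D)) = Matrix.mat n n (\<lambda>(i, l). ?B (\<rho> i) l)"
      using n by (intro eq_matI) (auto simp: arc_matrix_def length_passages n_def[symmetric] Let_def \<rho>_def mod_Suc_eq)
    thus ?thesis by (simp add: zpa_det_def det_on_mat)
  qed
  moreover have "det_on {0..<n} (\<lambda>i l. ?B (\<rho> i) l) = of_int (sign \<rho>) * det_on {0..<n} ?B"
    by (rule det_on_permute_rows[OF finite_atLeastLessThan \<rho>])
  ultimately show ?thesis
    using unit_equiv_refl unit_equiv_minus[of "det_on {0..<n} ?B"] by (cases \<rho> rule: sign_cases) auto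
qed

lemma marked_det_equiv:
  assumes X: "finite X" "passage_set D \<union> X \<noteq> {}"
  shows "unit_equiv (marked_det D X) (zpa_det D)"
proof -
  define lam where "lam = (\<lambda>p. if p \<in> passage_set D then weight D p else 1)"
  define ov where "ov = (\<lambda>p. p \<in> passage_set D \<longrightarrow> p \<in> overs D)"
  have m: "marked_det D X = alex_det (passage_set D \<union> X) lam (partner D) ov"
    by (simp add: marked_det_def lam_def ov_def)
  show ?thesis
  proof (cases "passage_set D = {}")
    case True
    then obtain x where x: "x \<in> X" using X by auto
    have "marked_det D X = alex_det ((X - {x}) \<union> {x}) lam (partner D) ov"
      using x by (simp add: m True insert_absorb)
    also have "\<dots> = alex_det {x} lam (partner D) ov"
      using X(1) True by (intro alex_det_union_trivial) (auto simp: lam_def ov_def)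
    \<comment> \<open>The only passage left succeeds itself, so the single entry is
      \<open>1 - 1\<close>; this matches the relation \<open>x = x\<close> of a diagram without
      crossings.\<close>
    also have "\<dots> = 0"
      by (simp add: alex_det_def det_on_def relation_matrix_def lam_def ov_def True cyc_next_def sign_def)
    finally show ?thesis using zpa_det_no_passages[OF True] unit_equiv_refl by simp
  next
    case False
    have "marked_det D X = alex_det ((X - passage_set D) \<union> passage_set D) lam (partner D) ov"
      by (simp add: m Un_commute)
    also have "\<dots> = alex_det (passage_set D) lam (partner D) ov"
      using X(1) finite_passage_set False partner_in
      by (intro alex_det_union_trivial) (auto simp: lam_def ov_def)
    also have "\<dots> = alex_det (passage_set D) (weight D) (partner D) (\<lambda>p. p \<in> overs D)"
      using finite_passage_set partner_in by (intro alex_det_cong) (auto simp: lam_def ov_def)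
    finally show ?thesis using zpa_det_eq[OF False] by simp
  qed
qed

end

context diagram
begin

subsection \<open>The degree bound\<close>

lemma inj_on_curve_overs: "inj_on (curve D) (passage_set D \<inter> overs D)"
proof (rule inj_onI, rule ccontr)
  fix p q assume pq: "p \<in> passage_set D \<inter> overs D" "q \<in> passage_set D \<inter> overs D" "curve D p = curve D q" "p \<noteq> q"
  hence "crossing D p q" by (intro same_point) (auto simp: passage_set_def)
  thus False using pq overs_iff_unders[of p q] overs_unders_disjoint[of q] by auto
qed

lemma card_real_crossings: "card (real_crossings D) = card (passage_set D \<inter> overs D)"
proof -
  have "curve D ` overs D = curve D ` (passage_set D \<inter> overs D)"
  proof (intro equalityI subsetI)
    fix x assume "x \<in> curve D ` overs D"
    then obtain t where t: "t \<in> overs D" "x = curve D t" by blast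
    have "frac t \<in> overs D" using overs_shift[of "frac t" "\<lfloor>t\<rfloor>"] t by (simp add: frac_def)
    hence "frac t \<in> passage_set D \<inter> overs D" by (simp add: passage_set_def frac_lt_1)
    thus "x \<in> curve D ` (passage_set D \<inter> overs D)"
      using t(2) curve_frac[of t] by (intro image_eqI[of x "curve D" "frac t"]) simp_all
  qed auto
  thus ?thesis using card_image[OF inj_on_curve_overs] by (simp add: real_crossings_def)
qed

abbreviation "pturn p \<equiv> turn D p (partner D p)"

lemma pturn_partner: "p \<in> passage_set D \<Longrightarrow> pturn (partner D p) = - pturn p"
  using turn_neg[OF passage_crossing(1)[of p]] partner_partner[of p] by simp

lemma is_even_partner: "p \<in> passage_set D \<Longrightarrow> is_even D (partner D p) = is_even D p"
  using partner_partner[of p] by (simp add: is_even_def add.commute)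

lemma pturn_cases: "pturn p = 1 \<or> pturn p = - 1"
  by (simp add: turn_def)

text \<open>The two passages of a crossing have opposite turns, so at most one of them has turn
  \<open>i\<close>. Sending a passage to the over-passage of its crossing is therefore injective
  here.\<close>

lemma card_odd_turn:
  "card {p \<in> passage_set D. \<not> is_even D p \<and> pturn p = i} \<le> card {p \<in> passage_set D \<inter> overs D. \<not> is_even D p}"
proof (rule card_inj_on_le[where f = "\<lambda>p. if p \<in> overs D then p else partner D p"])
  show "inj_on (\<lambda>p. if p \<in> overs D then p else partner D p) {p \<in> passage_set D. \<not> is_even D p \<and> pturn p = i}"
  proof (rule inj_onI)
    fix p q assume p: "p \<in> {p \<in> passage_set D. \<not> is_even D p \<and> pturn p = i}"
      and q: "q \<in> {p \<in> passage_set D. \<not> is_even D p \<and> pturn p = i}"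
      and eq: "(if p \<in> overs D then p else partner D p) = (if q \<in> overs D then q else partner D q)"
    have p': "p \<in> passage_set D" "pturn p = i" and q': "q \<in> passage_set D" "pturn q = i"
      using p q by simp_all
    have "i \<noteq> - i" using p'(2) pturn_cases[of p] by linarith
    hence "pturn (partner D p) \<noteq> i" "pturn (partner D q) \<noteq> i"
      using pturn_partner[OF p'(1)] pturn_partner[OF q'(1)] p'(2) q'(2) by simp_all
    hence "partner D p \<noteq> q" "partner D q \<noteq> p" using p'(2) q'(2) by metis+
    thus "p = q" using eq partner_partner[OF p'(1)] partner_partner[OF q'(1)]
      by (metis (full_types))
  qed
  show "(\<lambda>p. if p \<in> overs D then p else partner D p) ` {p \<in> passage_set D. \<not> is_even D p \<and> pturn p = i}
    \<subseteq> {p \<in> passage_set D \<inter> overs D. \<not> is_even D p}"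
    using partner_in partner_overs is_even_partner by (auto split: if_splits)
qed (use finite_passage_set in simp)

lemma z_exponents_weight:
  "z_exponents (weight D p) = {if is_even D p then 0 else pturn p}"
  by (simp add: weight_def passage_weight_def)

text \<open>Non-zero powers of \<open>z\<close> occur on the diagonal only: even crossings involve
  no \<open>z\<close>, and at an odd crossing the coefficient of the over-arc vanishes because the
  two weights are inverse.\<close>

lemma z_exponents_entry:
  assumes p: "p \<in> passage_set D"
  shows "z_exponents (relation_matrix (passage_set D) (weight D) (partner D) (\<lambda>p. p \<in> overs D) p l) \<subseteq>
    (if l = p then {if is_even D p then 0 else pturn p} else {}) \<union> (if is_even D p then {0} else {})
    \<union> (if l = cyc_next (passage_set D) p then {0} else {})"
proof -
  let ?w = "1 - weight D p * weight D (partner D p)"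
  have "z_exponents ?w \<subseteq> (if is_even D p then {0} else {})"
  proof (cases "is_even D p")
    case False
    have "weight D p * weight D (partner D p) = 1"
      unfolding weight_partner[OF p] using False by (simp add: weight_def passage_weight_def)
    thus ?thesis by simp
  next
    case True
    hence "z_exponents (weight D p * weight D (partner D p)) \<subseteq> {0}"
      using z_exponents_mult[of "weight D p" "weight D (partner D p)"]
      by (simp add: z_exponents_weight is_even_partner[OF p])
    thus ?thesis using True z_exponents_diff[of 1 "weight D p * weight D (partner D p)"] by auto
  qed
  moreover have "z_exponents (x + y - u) \<subseteq> z_exponents x \<union> z_exponents y \<union> z_exponents u" for x y u
    using z_exponents_diff[of "x + y" u] z_exponents_add[of x y] by blast
  ultimately show ?thesis
    unfolding relation_matrix_def by (fastforce simp: z_exponents_weight split: if_splits)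
qed

text \<open>Each row has its own exponent range: up to 1 at odd passages of turn 1, down to -1 at
  those of turn -1, and 0 elsewhere. The potential is zero here.\<close>

lemma zpa_z_exponents_even:
  assumes "\<exists>p\<in>passage_set D. is_even D p"
  defines "n \<equiv> int (card (real_crossings D)) - 1"
  shows "z_exponents (zpa_det D) \<subseteq> {- n..n}"
proof -
  let ?P = "passage_set D"
  let ?a = "\<lambda>p. if \<not> is_even D p \<and> pturn p = - 1 then - 1 else 0 :: int"
  let ?b = "\<lambda>p. if \<not> is_even D p \<and> pturn p = 1 then 1 else 0 :: int"
  have ne: "?P \<noteq> {}" using assms by auto
  have "z_exponents (relation_matrix ?P (weight D) (partner D) (\<lambda>p. p \<in> overs D) p l) \<subseteq> {?a p + 0 - 0..?b p + 0 - 0}"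
    if "p \<in> ?P" "l \<in> ?P" for p l
    by (rule order_trans[OF z_exponents_entry[OF that(1)]]) (use pturn_cases[of p] in auto)
  hence "z_exponents (alex_det ?P (weight D) (partner D) (\<lambda>p. p \<in> overs D)) \<subseteq> {sum ?a ?P..sum ?b ?P}"
    unfolding alex_det_def by (intro z_exponents_det_on[where g = "\<lambda>_. 0"])
  hence *: "z_exponents (zpa_det D) \<subseteq> {sum ?a ?P..sum ?b ?P}"
    using z_exponents_unit_equiv[OF zpa_det_eq[OF ne]] by simp
  \<comment> \<open>The crossing of \<open>p\<close> adds no power of \<open>z\<close>, so the odd
    crossings form a proper subset; this is the origin of the summand 1 in the theorem.\<close>
  obtain p where p: "p \<in> ?P" "is_even D p" using assms by blast
  have "\<exists>q\<in>?P \<inter> overs D. is_even D q"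
    using p partner_in[OF p(1)] partner_overs[OF p(1)] is_even_partner[OF p(1)] by blast
  hence "{p \<in> ?P \<inter> overs D. \<not> is_even D p} \<subset> ?P \<inter> overs D" by blast
  hence "card {p \<in> ?P \<inter> overs D. \<not> is_even D p} < card (?P \<inter> overs D)"
    using finite_passage_set by (intro psubset_card_mono) auto
  hence c: "int (card {p \<in> ?P. \<not> is_even D p \<and> pturn p = i}) \<le> n" for i
    using card_odd_turn[of i] unfolding n_def card_real_crossings by linarith
  have "sum ?b ?P = int (card {p \<in> ?P. \<not> is_even D p \<and> pturn p = 1})"
    using finite_passage_set by (simp add: sum.If_cases Int_def)
  moreover have "sum ?a ?P = - int (card {p \<in> ?P. \<not> is_even D p \<and> pturn p = - 1})"
    using finite_passage_set by (simp add: sum.If_cases Int_def)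
  ultimately have "sum ?b ?P \<le> n" "sum ?a ?P \<ge> - n" using c[of 1] c[of "- 1"] by simp_all
  thus ?thesis using * by fastforce
qed

lemma sum_pturn: "(\<Sum>p\<in>passage_set D. pturn p) = 0"
proof -
  have "(\<Sum>p\<in>passage_set D. pturn p) = (\<Sum>p\<in>passage_set D. pturn (partner D p))"
    by (rule sum.reindex_bij_witness[of _ "partner D" "partner D"])
       (simp_all add: partner_in partner_partner)
  also have "\<dots> = - (\<Sum>p\<in>passage_set D. pturn p)"
    by (simp add: pturn_partner sum_negf)
  finally show ?thesis by simp
qed

text \<open>The potential \<open>g p\<close> is the exponent of \<open>z\<close> accumulated from
  the base point up to \<open>p\<close>. It is consistent around the knot because the turns of
  partners cancel. Both kinds of entries, the weight on the diagonal and the -1 at the next arc,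
  then have exponent exactly \<open>pturn p + g p - g l\<close>, and these sum to 0 along every
  permutation.\<close>

lemma zpa_z_exponents_odd:
  assumes odd: "\<forall>p\<in>passage_set D. \<not> is_even D p"
  shows "z_exponents (zpa_det D) \<subseteq> {0}"
proof (cases "passage_set D = {}")
  case True
  thus ?thesis using zpa_det_no_passages by simp
next
  case False
  let ?P = "passage_set D"
  define g where "g = (\<lambda>p. \<Sum>q\<in>?P \<inter> {..<p}. pturn q)"
  have g: "g (cyc_next ?P p) = g p + pturn p" if p: "p \<in> ?P" for p
  proof -
    let ?q = "cyc_next ?P p"
    have q: "?q \<in> ?P" using cyc_next_mem[OF finite_passage_set p] .
    have "g p + pturn p = (\<Sum>q\<in>insert p (?P \<inter> {..<p}). pturn q)"
      using finite_passage_set by (simp add: g_def add.commute)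
    also have "insert p (?P \<inter> {..<p}) = ?P \<inter> {..p}" using p by auto
    also have "(\<Sum>q\<in>?P \<inter> {..p}. pturn q) = g ?q"
      using cyc_next_eq_iff[OF finite_passage_set p q, THEN iffD1, OF refl]
    proof
      assume "p < ?q \<and> (\<forall>r\<in>?P. \<not> (p < r \<and> r < ?q))"
      hence "?P \<inter> {..p} = ?P \<inter> {..<?q}" by force
      thus ?thesis by (simp add: g_def)
    next
      assume *: "?q \<le> p \<and> (\<forall>r\<in>?P. r \<le> p \<and> ?q \<le> r)"
      hence "?P \<inter> {..p} = ?P" "?P \<inter> {..<?q} = {}" by (auto simp: not_less[symmetric])
      thus ?thesis by (simp add: g_def sum_pturn)
    qed
    finally show ?thesis by simp
  qed
  have "z_exponents (relation_matrix ?P (weight D) (partner D) (\<lambda>p. p \<in> overs D) p l) \<subseteq>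
      {pturn p + g p - g l..pturn p + g p - g l}"
    if "p \<in> ?P" "l \<in> ?P" for p l
  proof -
    \<comment> \<open>A passage succeeding itself would have turn 0. Hence the weight and the -1
      never share an entry.\<close>
    have "cyc_next ?P p \<noteq> p" using g[OF that(1)] pturn_cases[of p] by auto
    hence "p \<noteq> cyc_next ?P p" by simp
    thus ?thesis
      by (intro order_trans[OF z_exponents_entry[OF that(1)]]) (use odd that g in auto)
  qed
  hence "z_exponents (alex_det ?P (weight D) (partner D) (\<lambda>p. p \<in> overs D)) \<subseteq> {sum pturn ?P..sum pturn ?P}"
    unfolding alex_det_def by (intro z_exponents_det_on)
  thus ?thesis using z_exponents_unit_equiv[OF zpa_det_eq[OF False]] by (simp add: sum_pturn)
qed

lemma z_bound_crossings:
  assumes eq: "z_exponents P = z_exponents (zpa_det D)" and pos: "z_bound P > 0"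
  shows "z_bound P + 1 \<le> int (card (real_crossings D))"
proof (cases "\<exists>p\<in>passage_set D. is_even D p")
  case True
  then obtain p where "p \<in> passage_set D" by blast
  hence "\<exists>q. q \<in> passage_set D \<inter> overs D" using partner_in[of p] partner_overs[of p] by blast
  hence "card (real_crossings D) > 0"
    unfolding card_real_crossings using finite_passage_set by (auto simp: card_gt_0_iff)
  thus ?thesis
    using zpa_z_exponents_even[OF True] z_bound_le[of P "int (card (real_crossings D)) - 1"] eq by simp
next
  case False
  hence "z_exponents P \<subseteq> {- 0..0}" using zpa_z_exponents_odd eq by auto
  hence "z_bound P \<le> 0" by (rule z_bound_le) simp
  thus ?thesis using pos by simp
qed

end

section \<open>Isotopy and reparametrization\<close>

text \<open>The factor is the determinant of \<open>L\<close>.\<close>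

lemma cross_prod_linear:
  assumes "linear L"
  shows "cross_prod (L v) (L w) = cross_prod (L 1) (L \<i>) * cross_prod v w"
proof -
  have L: "L v = Re v *\<^sub>R L 1 + Im v *\<^sub>R L \<i>" for v
  proof -
    have "v = Re v *\<^sub>R 1 + Im v *\<^sub>R \<i>" by (simp add: complex_eq_iff)
    hence "L v = L (Re v *\<^sub>R 1 + Im v *\<^sub>R \<i>)" by simp
    thus ?thesis by (simp only: linear_add[OF assms] linear_scale[OF assms])
  qed
  show ?thesis
    unfolding L[of v] L[of w] by (simp add: cross_prod_def) (simp add: algebra_simps)
qed

text \<open>The vectors \<open>?v\<close> and \<open>?w\<close> are, up to sign, the columns of the
  adjugate of the matrix of \<open>L\<close>. If the determinant is 0, then \<open>L\<close> kills
  both, so by injectivity the matrix would be zero in its first column.\<close>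

lemma cross_prod_eq_0_imp_not_inj:
  assumes "linear L" "cross_prod (L 1) (L \<i>) = 0"
  shows "\<not> inj L"
proof
  assume inj: "inj L"
  have nz: "L v \<noteq> 0" if "v \<noteq> 0" for v
    using that inj linear_0[OF assms(1)] by (metis injD)
  have "L (Complex (Re (L \<i>)) (- Re (L 1))) = Re (L \<i>) *\<^sub>R L 1 - Re (L 1) *\<^sub>R L \<i>" (is "L ?v = _")
  proof -
    have "?v = Re (L \<i>) *\<^sub>R 1 + (- Re (L 1)) *\<^sub>R \<i>" by (simp add: complex_eq_iff)
    hence "L ?v = L (Re (L \<i>) *\<^sub>R 1 + (- Re (L 1)) *\<^sub>R \<i>)" by simp
    thus ?thesis by (simp only: linear_add[OF assms(1)] linear_scale[OF assms(1)]) simp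
  qed
  also have "\<dots> = 0" using assms(2) by (simp add: complex_eq_iff cross_prod_def algebra_simps)
  finally have v: "?v = 0" using nz by blast
  have "L (Complex (Im (L \<i>)) (- Im (L 1))) = Im (L \<i>) *\<^sub>R L 1 - Im (L 1) *\<^sub>R L \<i>" (is "L ?w = _")
  proof -
    have "?w = Im (L \<i>) *\<^sub>R 1 + (- Im (L 1)) *\<^sub>R \<i>" by (simp add: complex_eq_iff)
    hence "L ?w = L (Im (L \<i>) *\<^sub>R 1 + (- Im (L 1)) *\<^sub>R \<i>)" by simp
    thus ?thesis by (simp only: linear_add[OF assms(1)] linear_scale[OF assms(1)]) simp
  qed
  also have "\<dots> = 0" using assms(2) by (simp add: complex_eq_iff cross_prod_def algebra_simps)
  finally have w: "?w = 0" using nz by blast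
  have "L 1 = 0" using v w by (simp add: complex_eq_iff)
  thus False using nz[of 1] by simp
qed

text \<open>The Jacobian determinant is continuous in the isotopy parameter, equals 1 at the start
  and never vanishes, hence it stays positive. This preserves the signs of crossings.\<close>

lemma ambient_isotopy_orientation:
  assumes "ambient_isotopy H"
  shows "\<exists>J. (\<forall>p. (H 1 has_derivative J p) (at p)) \<and> (\<forall>p. cross_prod (J p 1) (J p \<i>) > 0)"
proof -
  from assms obtain J where J: "\<And>u p. u \<in> {0..1} \<Longrightarrow> (H u has_derivative J u p) (at p)"
      "\<And>u p. u \<in> {0..1} \<Longrightarrow> inj (J u p)"
    and cont: "\<And>v. continuous_on ({0..1} \<times> UNIV) (\<lambda>(u, p). J u p v)"
    and H0: "H 0 = id"
    unfolding ambient_isotopy_def by blast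
  have "cross_prod (J 1 p 1) (J 1 p \<i>) > 0" for p
  proof (rule ccontr)
    assume neg: "\<not> cross_prod (J 1 p 1) (J 1 p \<i>) > 0"
    define d where "d = (\<lambda>u. cross_prod (J u p 1) (J u p \<i>))"
    have "continuous_on {0..1} (\<lambda>u. J u p v)" for v
    proof -
      have "continuous_on {0..1} (\<lambda>u. case (u, p) of (u, p) \<Rightarrow> J u p v)"
        by (rule continuous_on_compose2[OF cont[of v]]) (auto intro!: continuous_intros)
      thus ?thesis by simp
    qed
    hence "continuous_on {0..1} d"
      unfolding d_def cross_prod_def by (intro continuous_intros)
    moreover have "J 0 p = (\<lambda>v. v)"
      using has_derivative_unique[OF J(1)[of 0 p], of "\<lambda>v. v"] H0 by (simp add: id_def)
    hence "d 0 = 1" by (simp add: d_def cross_prod_def)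
    ultimately obtain u where u: "0 \<le> u" "u \<le> 1" "d u = 0"
      using IVT2'[of d 1 0 0] neg by (auto simp: d_def)
    thus False
      using cross_prod_eq_0_imp_not_inj[of "J u p"] J[of u p] has_derivative_linear by (auto simp: d_def)
  qed
  thus ?thesis using J(1)[of 1] by (intro exI[of _ "J 1"]) simp
qed

lemma (in diagram) velocity: "(curve D has_vector_derivative velocity D t) (at t)"
proof -
  have "curve D C1_differentiable_on UNIV" using is_diagram by (simp add: is_diagram_def)
  then obtain d where "(curve D has_vector_derivative d t) (at t)"
    unfolding C1_differentiable_on_def by blast
  thus ?thesis using vector_derivative_at by fastforce
qed

text \<open>The marked times may differ on the two sides. The index sets must be non-empty, since
  the empty determinant is 1 while a diagram without crossings has polynomial 0.\<close>

lemma zpa_det_transport: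
  assumes "diagram D" "diagram D'"
    and "unit_equiv (marked_det D' X') (marked_det D X)"
    and "finite X" "finite X'" "passage_set D \<union> X \<noteq> {}" "passage_set D' \<union> X' \<noteq> {}"
  shows "unit_equiv (zpa_det D') (zpa_det D)"
  using diagram.marked_det_equiv[OF assms(1) assms(4,6)] diagram.marked_det_equiv[OF assms(2) assms(5,7)] assms(3)
  by (meson unit_equiv_sym unit_equiv_trans)

lemma marked_det_cong:
  assumes D: "diagram D" and P: "passage_set D' = passage_set D" and X: "finite X"
    and "\<And>p. p \<in> passage_set D \<Longrightarrow> partner D' p = partner D p"
    and "\<And>p. p \<in> passage_set D \<Longrightarrow> p \<in> overs D' \<longleftrightarrow> p \<in> overs D"
    and "\<And>p. p \<in> passage_set D \<Longrightarrow> weight D' p = weight D p"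
  shows "marked_det D' X = marked_det D X"
  unfolding marked_det_def P
proof (rule alex_det_cong)
  fix p assume p: "p \<in> passage_set D \<union> X" "\<not> (p \<in> passage_set D \<longrightarrow> p \<in> overs D')"
  hence "p \<in> passage_set D" by blast
  thus "partner D' p = partner D p \<and> partner D' p \<in> passage_set D \<union> X"
    using assms(4)[of p] diagram.partner_in[OF D, of p] by simp
qed (use assms diagram.finite_passage_set[OF D] in auto)

lemma planar_isotopy_invariance:
  assumes D: "diagram D" and D': "diagram D'" and iso: "planar_isotopy D D'"
  shows "unit_equiv (zpa_det D') (zpa_det D)"
proof -
  interpret D: diagram D by fact
  interpret D': diagram D' by fact
  from iso obtain H where H: "ambient_isotopy H" and c: "curve D' = H 1 \<circ> curve D"
    and ou: "overs D' = overs D" "unders D' = unders D"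
    unfolding planar_isotopy_def by blast
  have "bij (H 1)" using H by (simp add: ambient_isotopy_def)
  hence cr: "crossing D' = crossing D"
    by (auto simp: crossing_def c fun_eq_iff bij_def inj_def)
  obtain J where J: "\<And>p. (H 1 has_derivative J p) (at p)" "\<And>p. cross_prod (J p 1) (J p \<i>) > 0"
    using ambient_isotopy_orientation[OF H] by blast
  have vel: "velocity D' t = J (curve D t) (velocity D t)" for t
  proof -
    have "((H 1 \<circ> curve D) has_derivative (J (curve D t) \<circ> (\<lambda>x. x *\<^sub>R velocity D t))) (at t)"
      using D.velocity[of t] J(1) unfolding has_vector_derivative_def by (rule diff_chain_at)
    moreover have "J (curve D t) \<circ> (\<lambda>x. x *\<^sub>R velocity D t) = (\<lambda>x. x *\<^sub>R J (curve D t) (velocity D t))"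
      using linear_scale[OF has_derivative_linear[OF J(1)]] by (simp add: fun_eq_iff)
    ultimately have "(curve D' has_vector_derivative J (curve D t) (velocity D t)) (at t)"
      by (simp add: c has_vector_derivative_def)
    thus ?thesis by (rule vector_derivative_at)
  qed
  have turn: "turn D' t u = turn D t u" if "crossing D t u" for t u
  proof -
    have "curve D u = curve D t" using that by (simp add: crossing_def)
    hence "cross_prod (velocity D' t) (velocity D' u) =
        cross_prod (J (curve D t) 1) (J (curve D t) \<i>) * cross_prod (velocity D t) (velocity D u)"
      unfolding vel by (simp add: cross_prod_linear[OF has_derivative_linear[OF J(1)], of _ "velocity D t"])
    thus ?thesis using J(2)[of "curve D t"] by (simp add: turn_def zero_less_mult_iff)
  qed
  have P: "passage_set D' = passage_set D" by (simp add: passage_set_def ou)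
  have pa: "partner D' = partner D" by (simp add: partner_def cr fun_eq_iff)
  have "weight D' p = weight D p" if "p \<in> passage_set D" for p
    using turn[OF D.passage_crossing(1)[OF that]] by (simp add: weight_def is_even_def passage_rank_def P pa ou)
  \<comment> \<open>Marking the time 0 includes diagrams without crossings.\<close>
  hence "marked_det D' {0} = marked_det D {0}"
    by (intro marked_det_cong D) (simp_all add: P pa ou)
  thus ?thesis using unit_equiv_refl by (intro zpa_det_transport[OF D D', of "{0}" "{0}"]) simp_all
qed

lemma (in diagram) velocity_frac: "velocity D (frac t) = velocity D t"
proof -
  have e: "(\<lambda>s. curve D (s + of_int \<lfloor>t\<rfloor>)) = curve D" by (simp add: curve_period_int)
  have "(curve D has_vector_derivative velocity D t) (at (frac t + of_int \<lfloor>t\<rfloor>))"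
    using velocity[of t] by (simp add: frac_def)
  hence "((\<lambda>s. curve D (s + of_int \<lfloor>t\<rfloor>)) has_vector_derivative 1 *\<^sub>R velocity D t) (at (frac t))"
    by (intro vector_diff_chain_at[unfolded o_def]) (auto intro!: derivative_eq_intros)
  thus ?thesis unfolding e by (simp add: vector_derivative_at)
qed

text \<open>Taking partners matches over-passages with under-passages. The lemma serves to move the
  base point: passages wrapped to the other end change their rank by a number of the same parity as
  the rest.\<close>

lemma (in diagram) even_card_passage_set: "even (card (passage_set D))"
proof -
  let ?O = "passage_set D \<inter> overs D"
  have "inj_on (partner D) ?O" by (rule inj_onI) (metis IntD1 partner_partner)
  hence "card (partner D ` ?O) = card ?O" by (rule card_image)
  moreover have "passage_set D = ?O \<union> partner D ` ?O"
  proof (intro equalityI subsetI)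
    fix p assume p: "p \<in> passage_set D"
    show "p \<in> ?O \<union> partner D ` ?O"
    proof (cases "p \<in> overs D")
      case False
      hence "partner D p \<in> ?O" using p partner_in partner_overs by blast
      thus ?thesis using partner_partner[OF p] by (metis UnI2 image_eqI)
    qed (use p in simp)
  qed (use partner_in in auto)
  moreover have "?O \<inter> partner D ` ?O = {}" using partner_overs by auto
  ultimately have "card (passage_set D) = card ?O + card ?O"
    using card_Un_disjoint[of ?O "partner D ` ?O"] finite_passage_set by auto
  thus ?thesis by simp
qed

text \<open>Since \<open>\<psi> 0\<close> need not be an integer, the base point may move, and the
  list of passages is rotated. The cyclic successor does not see this, and neither does parity,
  because the number of passages is even.\<close>

lemma reparametrization_invariance:
  assumes D: "diagram D" and D': "diagram D'" and rep: "reparametrization D D'"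
  shows "unit_equiv (zpa_det D') (zpa_det D)"
proof -
  interpret D: diagram D by fact
  interpret D': diagram D' by fact
  from rep obtain \<psi> where C1: "\<psi> C1_differentiable_on UNIV" and pos: "\<And>t. vector_derivative \<psi> (at t) > (0 :: real)"
    and per: "\<And>t. \<psi> (t + 1) = \<psi> t + 1" and c: "curve D' = curve D \<circ> \<psi>"
    and o: "overs D' = \<psi> -` overs D" and u: "unders D' = \<psi> -` unders D"
    unfolding reparametrization_def by blast
  define \<psi>' where "\<psi>' = (\<lambda>t. vector_derivative \<psi> (at t))"
  have der: "(\<psi> has_vector_derivative \<psi>' t) (at t)" for t
  proof -
    obtain d where "(\<psi> has_vector_derivative d t) (at t)"
      using C1 unfolding C1_differentiable_on_def by blast
    thus ?thesis unfolding \<psi>'_def using vector_derivative_at by fastforce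
  qed
  have mono: "\<psi> x < \<psi> y \<longleftrightarrow> x < y" for x y
  proof -
    have "\<psi> x < \<psi> y" if "x < y" for x y
      using der pos by (intro DERIV_pos_imp_increasing[OF that])
        (auto simp: has_real_derivative_iff_has_vector_derivative \<psi>'_def)
    thus ?thesis by (metis linorder_neqE order_less_asym)
  qed
  have inj: "\<psi> x = \<psi> y \<longleftrightarrow> x = y" for x y using mono by (metis linorder_neqE order_less_irrefl)
  have pern: "\<psi> (t + of_nat n) = \<psi> t + of_nat n" for t n
  proof (induction n)
    case (Suc n)
    have "\<psi> (t + of_nat (Suc n)) = \<psi> ((t + of_nat n) + 1)" by (simp add: add_ac)
    thus ?case using Suc per by simp
  qed simp
  have peri: "\<psi> (t + of_int n) = \<psi> t + of_int n" for t n
  proof (cases "n \<ge> 0")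
    case True
    thus ?thesis using pern[of t "nat n"] by simp
  next
    case False
    thus ?thesis using pern[of "t + of_int n" "nat (- n)"] by simp
  qed
  have Ints: "\<psi> x - \<psi> y \<in> \<int> \<longleftrightarrow> x - y \<in> \<int>" for x y
  proof
    assume "\<psi> x - \<psi> y \<in> \<int>"
    then obtain n where "\<psi> x = \<psi> (y + of_int n)" by (auto elim!: Ints_cases simp: peri algebra_simps)
    thus "x - y \<in> \<int>" by (simp add: inj)
  next
    assume "x - y \<in> \<int>"
    then obtain n where "x = y + of_int n" by (auto elim!: Ints_cases simp: algebra_simps)
    thus "\<psi> x - \<psi> y \<in> \<int>" by (simp add: peri)
  qed
  have cr: "crossing D' t u \<longleftrightarrow> crossing D (\<psi> t) (\<psi> u)" for t u
    by (simp add: crossing_def c Ints)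
  define f where "f = (\<lambda>t. frac (\<psi> t))"
  have of: "f t \<in> overs D \<longleftrightarrow> t \<in> overs D'" "f t \<in> unders D \<longleftrightarrow> t \<in> unders D'" for t
    using D.overs_shift[of "f t" "\<lfloor>\<psi> t\<rfloor>"] D.unders_shift[of "f t" "\<lfloor>\<psi> t\<rfloor>"] by (auto simp: o u f_def frac_def)
  have bnd: "0 \<le> f t" "f t < 1" for t by (simp_all add: f_def frac_lt_1)
  have fP: "f t \<in> passage_set D" if "t \<in> passage_set D'" for t
    using that of[of t] bnd by (auto simp: passage_set_def)
  have cont: "continuous_on A \<psi>" for A
    using der by (meson continuous_at_imp_continuous_on has_vector_derivative_continuous)
  have surj: "\<exists>t. \<psi> t = y" for y
  proof -
    obtain n where n: "\<bar>y - \<psi> 0\<bar> < of_nat n" using reals_Archimedean2 by blast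
    have "\<psi> (- of_nat n) = \<psi> 0 - of_nat n" "\<psi> (of_nat n) = \<psi> 0 + of_nat n"
      using pern[of "- of_nat n" n] pern[of 0 n] by simp_all
    thus ?thesis using IVT'[of \<psi> "- of_nat n" y "of_nat n"] n cont by fastforce
  qed
  have bij: "bij_betw f (passage_set D') (passage_set D)"
  proof (rule bij_betwI')
    fix x y assume xy: "x \<in> passage_set D'" "y \<in> passage_set D'"
    show "f x = f y \<longleftrightarrow> x = y"
    proof
      assume "f x = f y"
      hence "\<psi> x - \<psi> y = of_int (\<lfloor>\<psi> x\<rfloor> - \<lfloor>\<psi> y\<rfloor>)" by (simp add: f_def frac_def)
      hence "\<psi> x - \<psi> y \<in> \<int>" by (metis Ints_of_int)
      thus "x = y" using xy Ints Ints_unique[of x y] by (auto simp: passage_set_def)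
    qed simp
  next
    fix p assume p: "p \<in> passage_set D"
    obtain t where t: "\<psi> t = p" using surj by blast
    have "\<psi> (frac t) = p - of_int \<lfloor>t\<rfloor>" using peri[of "frac t" "\<lfloor>t\<rfloor>"] t by (simp add: frac_def)
    hence "f (frac t) = p" using p by (simp add: f_def passage_set_def frac_eq frac_unique_iff)
    moreover from this have "frac t \<in> passage_set D'"
      using of[of "frac t"] p by (simp add: passage_set_def frac_lt_1)
    ultimately show "\<exists>t\<in>passage_set D'. p = f t" by force
  qed (rule fP)
  \<comment> \<open>The passages met before \<open>\<psi>\<close> reaches the next integer: they
    come first in \<open>D'\<close> and last in \<open>D\<close>.\<close>
  define L where "L = (\<lambda>t. \<lfloor>\<psi> t\<rfloor> = \<lfloor>\<psi> 0\<rfloor>)"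
  have rng: "\<psi> 0 \<le> \<psi> t" "\<psi> t < \<psi> 0 + 1" if "t \<in> passage_set D'" for t
    using that mono[of t 0] mono[of t 1] per[of 0] by (auto simp: passage_set_def not_less[symmetric])
  have fl: "f t = \<psi> t - of_int \<lfloor>\<psi> 0\<rfloor> - (if L t then 0 else 1)" if "t \<in> passage_set D'" for t
  proof -
    have "\<lfloor>\<psi> t\<rfloor> = \<lfloor>\<psi> 0\<rfloor> \<or> \<lfloor>\<psi> t\<rfloor> = \<lfloor>\<psi> 0\<rfloor> + 1" using rng[OF that] by linarith
    thus ?thesis by (auto simp: f_def frac_def L_def)
  qed
  have ord1: "f x < f y" if "x \<in> passage_set D'" "y \<in> passage_set D'" "L x = L y" "x < y" for x y
    using that mono[of x y] by (simp add: fl)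
  have ord2: "x < y \<and> f y < f x" if xy: "x \<in> passage_set D'" "y \<in> passage_set D'" "L x" "\<not> L y" for x y
  proof -
    have "\<lfloor>\<psi> x\<rfloor> < \<lfloor>\<psi> y\<rfloor>" using xy(3,4) rng[OF xy(1)] rng[OF xy(2)] unfolding L_def by linarith
    hence "\<psi> x < \<psi> y" by linarith
    thus ?thesis using xy rng[OF xy(1)] rng[OF xy(2)] mono[of x y] by (simp add: fl)
  qed
  have lt: "f x < f y \<longleftrightarrow> (if L x = L y then x < y else L y)" if "x \<in> passage_set D'" "y \<in> passage_set D'" for x y
    using ord1[OF that] ord1[OF that(2,1)] ord2[OF that] ord2[OF that(2,1)]
    by (cases x y rule: linorder_cases) fastforce+
  have fin: "finite (passage_set D')" by (rule D'.finite_passage_set)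
  let ?A = "{x \<in> passage_set D'. L x}" and ?B = "{x \<in> passage_set D'. \<not> L x}"
  have evAB: "even (card ?A + card ?B)"
  proof -
    have "passage_set D' = ?A \<union> ?B" by blast
    hence "card (passage_set D') = card ?A + card ?B"
      using card_Un_disjoint[of ?A ?B] fin by auto
    thus ?thesis using D'.even_card_passage_set by simp
  qed
  \<comment> \<open>Ranks change by \<open>card ?B\<close> on \<open>?A\<close> and by
    \<open>card ?A\<close> on \<open>?B\<close>, numbers of equal parity. The common shift cancels
    in the sum of the two ranks of a crossing.\<close>
  have rank: "even (passage_rank D (f t) + passage_rank D' t + card ?A)" if t: "t \<in> passage_set D'" for t
  proof -
    have "passage_set D \<inter> {..<f t} = f ` {x \<in> passage_set D'. f x < f t}"
      using bij by (auto simp: bij_betw_def)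
    hence r: "passage_rank D (f t) = card {x \<in> passage_set D'. f x < f t}"
      using card_image[OF inj_on_subset[of f "passage_set D'"], of "{x \<in> passage_set D'. f x < f t}"] bij
      by (auto simp: passage_rank_def bij_betw_def)
    show ?thesis
    proof (cases "L t")
      case True
      have "{x \<in> passage_set D'. f x < f t} = ?B \<union> passage_set D' \<inter> {..<t}"
        using True lt t ord2 by auto
      moreover have "?B \<inter> (passage_set D' \<inter> {..<t}) = {}"
        using True t ord2 by auto (meson order_less_asym)
      ultimately have "passage_rank D (f t) = card ?B + passage_rank D' t"
        using r fin card_Un_disjoint[of ?B "passage_set D' \<inter> {..<t}"] by (simp add: passage_rank_def)
      thus ?thesis using evAB by (simp only: even_add) blast
    next
      case False
      have "passage_set D' \<inter> {..<t} = ?A \<union> {x \<in> passage_set D'. f x < f t}"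
        using False lt t ord2 by (auto split: if_splits)
      moreover have "?A \<inter> {x \<in> passage_set D'. f x < f t} = {}"
        using False lt t by auto
      ultimately have "passage_rank D' t = card ?A + passage_rank D (f t)"
        using r fin card_Un_disjoint[of ?A "{x \<in> passage_set D'. f x < f t}"] by (simp add: passage_rank_def)
      thus ?thesis by (simp only: even_add) blast
    qed
  qed
  have pa: "partner D (f t) = f (partner D' t)" if t: "t \<in> passage_set D'" for t
  proof (rule D.partner_eqI)
    have "crossing D (\<psi> t) (\<psi> (partner D' t))" using D'.passage_crossing(1)[OF t] cr by simp
    hence "crossing D (\<psi> (partner D' t)) (f t)"
      unfolding f_def D.crossing_frac using crossing_sym by blast
    hence "crossing D (f t) (\<psi> (partner D' t))" using crossing_sym by blast
    thus "crossing D (f t) (f (partner D' t))" by (simp add: f_def D.crossing_frac)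
  qed (rule bnd)+
  have vel: "velocity D' t = \<psi>' t *\<^sub>R velocity D (f t)" for t
  proof -
    have "((curve D \<circ> \<psi>) has_vector_derivative \<psi>' t *\<^sub>R velocity D (\<psi> t)) (at t)"
      by (rule vector_diff_chain_at[OF der D.velocity])
    thus ?thesis by (simp add: c vector_derivative_at f_def D.velocity_frac)
  qed
  have turn: "turn D (f t) (f s) = turn D' t s" for t s
  proof -
    have "cross_prod (velocity D' t) (velocity D' s) = \<psi>' t * \<psi>' s * cross_prod (velocity D (f t)) (velocity D (f s))"
      by (simp add: vel cross_prod_def algebra_simps)
    moreover have "0 < k * x \<longleftrightarrow> 0 < x" if "k > 0" for k x :: real
      using that by (simp add: zero_less_mult_iff)
    moreover have "\<psi>' t * \<psi>' s > 0" using pos by (simp add: \<psi>'_def)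
    ultimately show ?thesis unfolding turn_def by metis
  qed
  have w: "weight D (f t) = weight D' t" if t: "t \<in> passage_set D'" for t
  proof -
    have "is_even D (f t) = is_even D' t"
      using rank[OF t] rank[OF D'.partner_in[OF t]] by (simp add: is_even_def pa[OF t]) presburger
    thus ?thesis by (simp add: weight_def pa[OF t] of turn)
  qed
  show ?thesis
  proof (cases "passage_set D' = {}")
    case True
    hence "passage_set D = {}" using bij by (auto simp: bij_betw_def)
    thus ?thesis using True D.zpa_det_no_passages D'.zpa_det_no_passages unit_equiv_refl by simp
  next
    case False
    hence ne: "passage_set D \<noteq> {}" using fP by auto
    have "alex_det (passage_set D) (weight D) (partner D) (\<lambda>p. p \<in> overs D)
        = alex_det (passage_set D') (weight D') (partner D') (\<lambda>p. p \<in> overs D')"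
      using fin bij cyc_next_rotate[OF fin bij _ ord1 ord2] pa w of D'.partner_in
      by (intro alex_det_relabel[of _ f]) auto
    thus ?thesis
      using unit_equiv_trans[OF unit_equiv_sym[OF D'.zpa_det_eq[OF False]]] D.zpa_det_eq[OF ne] by simp
  qed
qed

section \<open>Local changes\<close>

locale local_change_diagrams =
  fixes D D' :: vdiagram and S :: "(real \<times> real) list"
  assumes D: "diagram D" and D': "diagram D'" and change: "local_change S D D'"

sublocale local_change_diagrams \<subseteq> D: diagram D by (rule D)
sublocale local_change_diagrams \<subseteq> D': diagram D' by (rule D')

context local_change_diagrams
begin

abbreviation "strand i \<equiv> strand_times S i"

definition W :: "real set" where "W = (\<Union>i<length S. strand i)"

lemma strand_bounds:
  assumes "i < length S"
  shows "0 < fst (S ! i)" "fst (S ! i) < snd (S ! i)" "snd (S ! i) < 1"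
proof -
  have "\<forall>(a, b) \<in> set S. 0 < a \<and> a < b \<and> b < 1"
    using change by (simp add: local_change_def window_strands_def)
  hence "case S ! i of (a, b) \<Rightarrow> 0 < a \<and> a < b \<and> b < 1"
    by (rule bspec) (simp add: assms)
  thus "0 < fst (S ! i)" "fst (S ! i) < snd (S ! i)" "snd (S ! i) < 1"
    by (simp_all add: case_prod_unfold)
qed

lemma strand_disjoint: "i < length S \<Longrightarrow> j < length S \<Longrightarrow> i \<noteq> j \<Longrightarrow> strand i \<inter> strand j = {}"
  using change by (simp add: local_change_def window_strands_def disjoint_family_on_def)

lemma strand_subset_W: "i < length S \<Longrightarrow> strand i \<subseteq> W"
  by (auto simp: W_def)

lemma W_bounds: "t \<in> W \<Longrightarrow> 0 < t" "t \<in> W \<Longrightarrow> t < 1"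
proof -
  show "0 < t" if t: "t \<in> W"
  proof -
    obtain i where "i < length S" "t \<in> strand i" using t by (auto simp: W_def)
    thus ?thesis using strand_bounds[of i] by auto
  qed
  show "t < 1" if t: "t \<in> W"
  proof -
    obtain i where "i < length S" "t \<in> strand i" using t by (auto simp: W_def)
    thus ?thesis using strand_bounds[of i] by auto
  qed
qed

lemma closed_W: "closed W"
  unfolding W_def by (intro closed_UN) auto

lemma in_window:
  assumes "0 \<le> t" "t \<le> 1"
  shows "curve D t \<in> cbox (Complex (-1) (-1)) (Complex 1 1) \<longleftrightarrow> t \<in> W"
    "curve D' t \<in> cbox (Complex (-1) (-1)) (Complex 1 1) \<longleftrightarrow> t \<in> W"
  using change assms unfolding local_change_def window_strands_def W_def by auto

lemma outside_eq:
  assumes "0 \<le> t" "t \<le> 1" "t \<notin> W"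
  shows "curve D t = curve D' t" "t \<in> overs D \<longleftrightarrow> t \<in> overs D'" "t \<in> unders D \<longleftrightarrow> t \<in> unders D'"
  using change assms unfolding local_change_def W_def by auto

lemma local_change_sym: "local_change_diagrams D' D S"
proof
  show "local_change S D' D" using change unfolding local_change_def by auto
qed

lemma curve_continuous: "continuous_on A (curve D)"
  using D.velocity by (meson continuous_at_imp_continuous_on has_vector_derivative_continuous)

lemma velocity_outside:
  assumes t: "0 \<le> t" "t < 1" "t \<notin> W"
  shows "velocity D t = velocity D' t"
proof -
  \<comment> \<open>The diagrams are known to agree on \<open>{0..1} - W\<close> only, but a
    derivative at \<open>t = 0\<close> needs a two-sided neighbourhood. Negative times are handled
    by periodicity, whence the translate of \<open>W\<close>.\<close>
  define U where "U = {-1<..<1} - W - (\<lambda>x. x - 1) ` W"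
  have "closed ((\<lambda>x. x - 1) ` W)"
    using closed_translation[OF closed_W, of "- 1"] by (simp add: image_def)
  hence "open U" using closed_W unfolding U_def by (intro open_Diff) auto
  moreover have "t \<in> U"
  proof -
    have "t \<noteq> x - 1" if "x \<in> W" for x using W_bounds(2)[OF that] t by simp
    thus ?thesis using t by (auto simp: U_def)
  qed
  moreover have eq: "curve D s = curve D' s" if s: "s \<in> U" for s
  proof (cases "s \<ge> 0")
    case True
    thus ?thesis using s by (intro outside_eq) (auto simp: U_def)
  next
    case False
    have "s + 1 \<notin> W" using s by (force simp: U_def image_iff)
    hence "curve D (s + 1) = curve D' (s + 1)" using s False by (intro outside_eq) (auto simp: U_def)
    thus ?thesis using D.curve_period D'.curve_period by simp
  qed
  ultimately have "(curve D has_vector_derivative velocity D' t) (at t)"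
    using has_vector_derivative_transform_within_open[OF D'.velocity[of t], of U "curve D"] by auto
  thus ?thesis by (rule vector_derivative_at)
qed

lemma crossing_inside:
  assumes "crossing D t u" "0 \<le> t" "t < 1" "0 \<le> u" "u < 1"
  shows "t \<in> W \<longleftrightarrow> u \<in> W"
  using assms in_window[of t] in_window[of u] by (auto simp: crossing_def)

lemma passage_bounds: "p \<in> passage_set D \<Longrightarrow> 0 \<le> p" "p \<in> passage_set D \<Longrightarrow> p < 1"
  by (auto simp: passage_set_def)

lemma partner_inside:
  assumes p: "p \<in> passage_set D"
  shows "partner D p \<in> W \<longleftrightarrow> p \<in> W"
  using crossing_inside[OF D.passage_crossing(1)[OF p]] passage_bounds[OF p] D.passage_crossing[OF p] by blast

lemma passage_set_outside: "passage_set D - W = passage_set D' - W"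
  using outside_eq by (auto simp: passage_set_def)

lemma
  assumes p: "p \<in> passage_set D - W"
  shows partner_outside: "partner D' p = partner D p"
    and turn_outside: "turn D' p (partner D p) = turn D p (partner D p)"
proof -
  let ?q = "partner D p"
  have pP: "p \<in> passage_set D" using p by simp
  have q: "?q \<notin> W" "0 \<le> ?q" "?q < 1" using partner_inside[OF pP] D.passage_crossing[OF pP] p by auto
  have "curve D' p = curve D' ?q"
    using outside_eq(1)[of p] outside_eq(1)[of ?q] p q passage_bounds[OF pP] D.passage_crossing(1)[OF pP]
    by (simp add: crossing_def)
  hence "crossing D' p ?q" using D.passage_crossing(1)[OF pP] by (simp add: crossing_def)
  thus "partner D' p = ?q" using q by (intro D'.partner_eqI)
  show "turn D' p ?q = turn D p ?q"
    using velocity_outside[of p] velocity_outside[of ?q] p q passage_bounds[OF pP] by (simp add: turn_def)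
qed

lemma overs_outside: "p \<in> passage_set D - W \<Longrightarrow> p \<in> overs D' \<longleftrightarrow> p \<in> overs D"
  using outside_eq(2)[of p] by (auto simp: passage_set_def)

text \<open>This makes ranks in \<open>D\<close> and \<open>D'\<close> comparable: the first summand
  is common to both, and the second depends only on the number of passages on each strand. The
  hypothesis on \<open>t\<close> also admits the starting time of a strand.\<close>

lemma rank_before_strands:
  assumes t: "\<And>j. j < length S \<Longrightarrow> t \<le> fst (S ! j) \<or> snd (S ! j) < t"
  defines "K \<equiv> {i. i < length S \<and> snd (S ! i) < t}"
  shows "passage_rank D t = card ((passage_set D - W) \<inter> {..<t}) + (\<Sum>i\<in>K. card (passage_set D \<inter> strand i))"
proof -
  let ?P = "passage_set D"
  have K: "finite K" by (simp add: K_def)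
  have "?P \<inter> {..<t} = (?P - W) \<inter> {..<t} \<union> (\<Union>i\<in>K. ?P \<inter> strand i)"
  proof (intro equalityI subsetI)
    fix p assume p: "p \<in> ?P \<inter> {..<t}"
    show "p \<in> (?P - W) \<inter> {..<t} \<union> (\<Union>i\<in>K. ?P \<inter> strand i)"
    proof (cases "p \<in> W")
      case True
      then obtain i where i: "i < length S" "p \<in> strand i" by (auto simp: W_def)
      hence "i \<in> K" using t[OF i(1)] p by (auto simp: K_def)
      thus ?thesis using i p by blast
    qed (use p in simp)
  qed (auto simp: K_def)
  moreover have "card ((?P - W) \<inter> {..<t} \<union> (\<Union>i\<in>K. ?P \<inter> strand i)) =
     card ((?P - W) \<inter> {..<t}) + card (\<Union>i\<in>K. ?P \<inter> strand i)"
    using D.finite_passage_set K strand_subset_W by (intro card_Un_disjoint) (auto simp: K_def)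
  moreover have "card (\<Union>i\<in>K. ?P \<inter> strand i) = (\<Sum>i\<in>K. card (?P \<inter> strand i))"
  proof (rule card_UN_disjoint[OF K])
    show "\<forall>i\<in>K. \<forall>j\<in>K. i \<noteq> j \<longrightarrow> ?P \<inter> strand i \<inter> (?P \<inter> strand j) = {}"
      using strand_disjoint unfolding K_def by blast
  qed (use D.finite_passage_set in simp)
  ultimately show ?thesis by (simp add: passage_rank_def)
qed

lemma outside_strands:
  assumes "t \<notin> W" "j < length S"
  shows "t \<le> fst (S ! j) \<or> snd (S ! j) < t"
proof -
  have "t \<notin> strand j" using assms strand_subset_W by blast
  thus ?thesis by auto
qed

text \<open>Whole strands lie before or after \<open>t\<close>, and each of them gains or loses an
  even number of passages. So no move affects the parity of crossings outside the window.\<close>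

lemma rank_outside:
  assumes par: "\<And>i. i < length S \<Longrightarrow> even (card (passage_set D \<inter> strand i) + card (passage_set D' \<inter> strand i))"
    and t: "t \<notin> W"
  shows "even (passage_rank D t + passage_rank D' t)"
proof -
  let ?K = "{i. i < length S \<and> snd (S ! i) < t}"
  have "passage_rank D' t = card ((passage_set D - W) \<inter> {..<t}) + (\<Sum>i\<in>?K. card (passage_set D' \<inter> strand i))"
    using local_change_diagrams.rank_before_strands[OF local_change_sym outside_strands[OF t]]
    by (simp add: passage_set_outside)
  hence "passage_rank D t + passage_rank D' t = 2 * card ((passage_set D - W) \<inter> {..<t}) +
      (\<Sum>i\<in>?K. card (passage_set D \<inter> strand i) + card (passage_set D' \<inter> strand i))"
    using rank_before_strands[OF outside_strands[OF t]] by (simp add: sum.distrib)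
  moreover have "even (\<Sum>i\<in>?K. card (passage_set D \<inter> strand i) + card (passage_set D' \<inter> strand i))"
    using par by (intro dvd_sum) simp
  ultimately show ?thesis by simp
qed

lemma weight_outside:
  assumes par: "\<And>i. i < length S \<Longrightarrow> even (card (passage_set D \<inter> strand i) + card (passage_set D' \<inter> strand i))"
    and p: "p \<in> passage_set D - W"
  shows "weight D' p = weight D p"
proof -
  have pP: "p \<in> passage_set D" using p by simp
  have "partner D p \<notin> W" using partner_inside[OF pP] p by simp
  hence "is_even D' p \<longleftrightarrow> is_even D p"
    using rank_outside[OF par, of p] rank_outside[OF par, of "partner D p"] p
    by (simp add: is_even_def partner_outside[OF p])
  moreover have "p \<in> overs D' \<longleftrightarrow> p \<in> overs D" using outside_eq(2)[of p] passage_bounds[OF pP] p by simp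
  ultimately show ?thesis
    by (simp add: weight_def partner_outside[OF p] turn_outside[OF p])
qed

text \<open>Virtual crossings leave no trace in the passage data; this settles the purely virtual
  moves.\<close>

lemma zpa_det_no_classical_crossings:
  assumes "passage_set D \<inter> W = {}" "passage_set D' \<inter> W = {}"
  shows "unit_equiv (zpa_det D') (zpa_det D)"
proof -
  have P: "passage_set D' = passage_set D" using passage_set_outside assms by blast
  have s: "passage_set D \<inter> strand i = {}" "passage_set D' \<inter> strand i = {}" if "i < length S" for i
    using strand_subset_W[OF that] assms by auto
  have out: "p \<in> passage_set D - W" if "p \<in> passage_set D" for p using that assms by blast
  have "marked_det D' {0} = marked_det D {0}"
    using out by (intro marked_det_cong D P) (simp_all add: partner_outside overs_outside weight_outside s)
  thus ?thesis using unit_equiv_refl by (intro zpa_det_transport[OF D D', of "{0}" "{0}"]) simp_all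
qed

text \<open>The link between algebra and geometry for moves I and II: once the new passages of
  \<open>D'\<close> are made trivial, what remains is the determinant of \<open>D\<close> with these
  times marked.\<close>

lemma marked_det_new_passages:
  assumes new: "passage_set D \<inter> W = {}" and X: "passage_set D' \<inter> W = X"
    and even: "\<And>i. i < length S \<Longrightarrow> even (card (X \<inter> strand i))"
    and lam: "\<And>p. p \<in> passage_set D' \<Longrightarrow> lam p = (if p \<in> X then 1 else weight D' p)"
    and ov: "\<And>p. p \<in> passage_set D' \<Longrightarrow> ov p \<longleftrightarrow> p \<in> X \<or> p \<in> overs D'"
  shows "alex_det (passage_set D') lam (partner D') ov = marked_det D X"
proof -
  have P': "passage_set D' = passage_set D \<union> X" using passage_set_outside new X by blast
  have s: "passage_set D \<inter> strand i = {}" "passage_set D' \<inter> strand i = X \<inter> strand i" if "i < length S" for i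
    using strand_subset_W[OF that] new X by auto
  show ?thesis
    unfolding marked_det_def P'[symmetric]
  proof (rule alex_det_cong[OF D'.finite_passage_set])
    fix p assume p: "p \<in> passage_set D'"
    have *: "p \<in> passage_set D - W" if "p \<notin> X" using that p P' new by blast
    have **: "p \<notin> passage_set D" if "p \<in> X" using that X new by blast
    show "lam p = (if p \<in> passage_set D then weight D p else 1)"
      using * ** weight_outside[of p] by (auto simp: lam[OF p] s even)
    show "ov p = (p \<in> passage_set D \<longrightarrow> p \<in> overs D)"
      using * ** overs_outside[of p] by (auto simp: ov[OF p])
    assume "\<not> ov p"
    hence "p \<notin> X" by (simp add: ov[OF p])
    thus "partner D' p = partner D p \<and> partner D' p \<in> passage_set D'"
      using partner_outside[OF *] D'.partner_in[OF p] by simp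
  qed
qed

lemma marked_det_empty: "marked_det D {} = alex_det (passage_set D) (weight D) (partner D) (\<lambda>p. p \<in> overs D)"
  unfolding marked_det_def Un_empty_right
  using D.finite_passage_set D.partner_in by (intro alex_det_cong) auto

lemma cyc_next_strand:
  assumes T: "finite T" "T \<inter> strand i = {p, q}" "p < q" and i: "i < length S"
  shows "cyc_next T p = q"
proof -
  have pq: "p \<in> T" "q \<in> T" "p \<in> strand i" "q \<in> strand i" using T by auto
  have "\<not> (p < r \<and> r < q)" if r: "r \<in> T" for r
  proof
    assume "p < r \<and> r < q"
    hence "r \<in> T \<inter> strand i" using pq r by auto
    thus False using T \<open>p < r \<and> r < q\<close> by auto
  qed
  thus ?thesis using cyc_next_eq_iff[OF T(1) pq(1,2)] T(3) by blast
qed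

end

section \<open>Move I\<close>

lemma passage_rank_Suc:
  assumes "finite (passage_set D)" "p \<in> passage_set D" "p < q" "\<And>r. r \<in> passage_set D \<Longrightarrow> \<not> (p < r \<and> r < q)"
  shows "passage_rank D q = Suc (passage_rank D p)"
proof -
  have "passage_set D \<inter> {..<q} = insert p (passage_set D \<inter> {..<p})"
    using assms by force
  thus ?thesis using assms(1) by (simp add: passage_rank_def)
qed

lemma (in local_change_diagrams) passage_rank_strand:
  assumes "passage_set D \<inter> strand i = {p, q}" "p < q" "i < length S"
  shows "passage_rank D q = Suc (passage_rank D p)"
proof (rule passage_rank_Suc[OF D.finite_passage_set])
  have pq: "p \<in> strand i" "q \<in> strand i" using assms by auto
  show "\<not> (p < r \<and> r < q)" if r: "r \<in> passage_set D" for r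
  proof
    assume *: "p < r \<and> r < q"
    hence "r \<in> passage_set D \<inter> strand i" using pq r by auto
    thus False using * assms(1) by auto
  qed
qed (use assms in auto)

text \<open>The passages \<open>c\<close> and \<open>d\<close> of the loop are adjacent, so a
  classical new crossing is even. Its two weights multiply to \<open>monom_stz i i 0\<close>, hence
  the factor from \<open>alex_det_move_I\<close> is a unit.\<close>

lemma move_I_invariance:
  assumes D: "diagram D" and D': "diagram D'" and move: "move_I D D'"
  shows "unit_equiv (zpa_det D') (zpa_det D)"
proof -
  from move obtain a b c d where lc: "local_change [(a, b)] D D'" and inj: "inj_on (curve D) {a..b}"
    and cd: "a < c" "c < d" "d < b"
    and eq: "\<And>t u. t \<in> {a..b} \<Longrightarrow> u \<in> {a..b} \<Longrightarrow> t < u \<Longrightarrow> curve D' t = curve D' u \<longleftrightarrow> t = c \<and> u = d"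
    unfolding move_I_def by blast
  interpret local_change_diagrams D D' "[(a, b)]"
    using D D' lc by unfold_locales (auto simp: diagram_def)
  interpret sym: local_change_diagrams D' D "[(a, b)]" by (rule local_change_sym)
  have W: "W = {a..b}" by (simp add: W_def lessThan_Suc)
  let ?P = "passage_set D" and ?P' = "passage_set D'"
  have out: "?P \<inter> W = {}"
  proof (rule ccontr)
    assume "?P \<inter> W \<noteq> {}"
    then obtain p where p: "p \<in> ?P" "p \<in> W" by blast
    hence "partner D p \<in> W" "curve D p = curve D (partner D p)"
      using partner_inside D.passage_crossing(1)[of p] by (auto simp: crossing_def)
    thus False using inj p D.partner_neq[OF p(1)] by (auto simp: W inj_on_def)
  qed
  have cdW: "c \<in> W" "d \<in> W" using cd by (auto simp: W)
  have pcd: "(p = c \<and> partner D' p = d) \<or> (p = d \<and> partner D' p = c)" if "p \<in> ?P' \<inter> W" for p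
  proof -
    have p: "p \<in> ?P'" using that by simp
    have "partner D' p \<in> {a..b}" "p \<in> {a..b}" "curve D' p = curve D' (partner D' p)"
      using sym.partner_inside[OF p] D'.passage_crossing(1)[OF p] that W by (auto simp: crossing_def)
    thus ?thesis using eq[of p "partner D' p"] eq[of "partner D' p" p] D'.partner_neq[OF p]
      by (cases p "partner D' p" rule: linorder_cases) auto
  qed
  show ?thesis
  proof (cases "?P' \<inter> W = {}")
    case True
    thus ?thesis using out by (intro zpa_det_no_classical_crossings)
  next
    case False
    have in': "c \<in> ?P'" "d \<in> ?P'" "partner D' c = d" "partner D' d = c"
    proof -
      obtain p where p: "p \<in> ?P' \<inter> W" using False by blast
      thus "c \<in> ?P'" "d \<in> ?P'" "partner D' c = d" "partner D' d = c"
        using pcd[OF p] D'.partner_in[of p] D'.partner_partner[of p] by auto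
    qed
    have P'W: "?P' \<inter> W = {c, d}" using pcd in' cdW by auto
    have P': "?P' = ?P \<union> {c, d}" using passage_set_outside P'W out by blast
    have nxt: "cyc_next ?P' c = d"
      using cyc_next_strand[of ?P' 0 c d] D'.finite_passage_set P'W cd by (simp add: W)
    have "passage_rank D' d = Suc (passage_rank D' c)"
      using sym.passage_rank_strand[of 0 c d] P'W cd by (simp add: W)
    hence ev: "is_even D' c" "is_even D' d" by (simp_all add: is_even_def in')
    have turn: "turn D' d c = - turn D' c d" "turn D' c d = 1 \<or> turn D' c d = - 1"
      using D'.turn_neg[OF D'.passage_crossing(1)[OF in'(1)]] by (auto simp: in' turn_def)
    have ovcd: "c \<in> overs D' \<longleftrightarrow> d \<notin> overs D'" using D'.partner_overs[OF in'(1)] in' by simp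
    define i where "i = (if c \<in> overs D' then turn D' c d else turn D' d c)"
    have w: "weight D' c * weight D' d = monom_stz i i 0"
      using ovcd turn ev by (auto simp: weight_def passage_weight_def in' i_def)
    let ?lam = "(weight D')(c := 1, d := 1)" and ?ov = "(\<lambda>p. p \<in> overs D')(c := True, d := True)"
    have "\<exists>v \<in> {1, weight D' c * weight D' d}. alex_det ?P' (weight D') (partner D') (\<lambda>p. p \<in> overs D') =
       v * alex_det ?P' ?lam (partner D') ?ov"
    proof (rule alex_det_move_I[OF D'.finite_passage_set in'(1,2) _ nxt])
      show "weight D' c * weight D' d * monom_stz (- i) (- i) 0 = 1" by (simp add: w)
      fix k assume k: "k \<in> ?P' - {c, d}"
      hence "k \<notin> W" using P'W by blast
      hence "partner D' k \<notin> W" using sym.partner_inside[of k] k W by auto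
      thus "partner D' k \<notin> {c, d}" using cdW by auto
    qed (use in' ovcd cd in auto)
    moreover have "alex_det ?P' ?lam (partner D') ?ov = marked_det D {c, d}"
      by (rule marked_det_new_passages[OF out P'W]) (use cd cdW in \<open>auto simp: W\<close>)
    moreover note sym.marked_det_empty
    ultimately have "\<exists>v \<in> {1, monom_stz i i 0}. marked_det D' {} = v * marked_det D {c, d}"
      by (simp only: w)
    then obtain v where "v \<in> {1, monom_stz i i 0}" "marked_det D' {} = v * marked_det D {c, d}"
      by blast
    hence "unit_equiv (marked_det D' {}) (marked_det D {c, d})"
      using unit_equiv_refl unit_equiv_monom by auto
    thus ?thesis using in' by (intro zpa_det_transport[OF D D', of "{}" "{c, d}"]) auto
  qed
qed

section \<open>Move II\<close>

text \<open>A positive derivative at \<open>t\<close> would make \<open>k\<close> negative just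
  before \<open>t\<close>, and the intermediate value theorem would give an earlier zero. Used to
  find the direction in which one strand crosses another.\<close>

lemma deriv_first_zero:
  fixes k :: "real \<Rightarrow> real"
  assumes k: "\<And>t. (k has_real_derivative k' t) (at t)" and a: "k a > 0" "a < t" and t: "k t = 0"
    and nz: "\<And>s. a \<le> s \<Longrightarrow> s < t \<Longrightarrow> k s \<noteq> 0"
  shows "k' t \<le> 0"
proof (rule ccontr)
  assume "\<not> k' t \<le> 0"
  then obtain d where d: "d > 0" "\<And>h. h > 0 \<Longrightarrow> h < d \<Longrightarrow> k (t - h) < k t"
    using DERIV_pos_inc_left[OF k, of t] by auto
  define s where "s = t - min (d / 2) (t - a)"
  have s: "a \<le> s" "s < t" "k s < 0" using d(1) a d(2)[of "min (d / 2) (t - a)"] t by (auto simp: s_def)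
  have "continuous_on {a..s} k" using k by (meson DERIV_continuous_on has_field_derivative_at_within)
  then obtain r where "a \<le> r" "r \<le> s" "k r = 0" using IVT2'[of k s 0 a] a s by auto
  thus False using nz[of r] s by auto
qed

lemma deriv_last_zero:
  fixes k :: "real \<Rightarrow> real"
  assumes k: "\<And>t. (k has_real_derivative k' t) (at t)" and b: "k b > 0" "t < b" and t: "k t = 0"
    and nz: "\<And>s. t < s \<Longrightarrow> s \<le> b \<Longrightarrow> k s \<noteq> 0"
  shows "k' t \<ge> 0"
proof (rule ccontr)
  assume "\<not> k' t \<ge> 0"
  then obtain d where d: "d > 0" "\<And>h. h > 0 \<Longrightarrow> h < d \<Longrightarrow> k (t + h) < k t"
    using has_real_derivative_neg_dec_right[OF k, of t] by auto
  define s where "s = t + min (d / 2) (b - t)"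
  have s: "s \<le> b" "t < s" "k s < 0" using d(1) b d(2)[of "min (d / 2) (b - t)"] t by (auto simp: s_def)
  have "continuous_on {s..b} k" using k by (meson DERIV_continuous_on has_field_derivative_at_within)
  then obtain r where "s \<le> r" "r \<le> b" "k r = 0" using IVT'[of k s 0 b] b s by auto
  thus False using nz[of r] s by auto
qed

section \<open>Strands tracing graphs of functions\<close>

context diagram
begin

lemma Re_derivative: "((\<lambda>t. Re (curve D t)) has_real_derivative Re (velocity D t)) (at t)"
  using bounded_linear.has_vector_derivative[OF bounded_linear_Re velocity[of t]] by (simp add: has_real_derivative_iff_has_vector_derivative)

lemma Im_derivative: "((\<lambda>t. Im (curve D t)) has_real_derivative Im (velocity D t)) (at t)"
  using bounded_linear.has_vector_derivative[OF bounded_linear_Im velocity[of t]] by (simp add: has_real_derivative_iff_has_vector_derivative)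

lemma graph_point:
  assumes "traces_graph D I h" "t \<in> I"
  shows "Im (curve D t) = h (Re (curve D t))" "- 1 \<le> Re (curve D t)" "Re (curve D t) \<le> 1"
proof -
  have "curve D t \<in> (\<lambda>x. Complex x (h x)) ` {-1..1}" using assms unfolding traces_graph_def by blast
  thus "Im (curve D t) = h (Re (curve D t))" "- 1 \<le> Re (curve D t)" "Re (curve D t) \<le> 1" by auto
qed

lemma graph_surj:
  assumes "traces_graph D I h" "- 1 \<le> x" "x \<le> 1"
  obtains t where "t \<in> I" "curve D t = Complex x (h x)"
proof -
  have "Complex x (h x) \<in> (\<lambda>x. Complex x (h x)) ` {-1..1}" using assms(2,3) by auto
  hence "Complex x (h x) \<in> curve D ` I" using assms(1) unfolding traces_graph_def by simp
  thus ?thesis using that by auto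
qed

lemma graph_inj:
  assumes "traces_graph D I h" "t \<in> I" "u \<in> I" "curve D t = curve D u"
  shows "t = u"
  using assms unfolding traces_graph_def inj_on_def by blast

lemma graph_Re_inj:
  assumes "traces_graph D I h" "t \<in> I" "u \<in> I" "Re (curve D t) = Re (curve D u)"
  shows "t = u"
  using graph_inj[OF assms(1-3)] graph_point(1)[OF assms(1,2)] graph_point(1)[OF assms(1,3)] assms(4)
  by (simp add: complex_eq_iff)

text \<open>The value \<open>s = 1\<close> means from left to right and \<open>s = - 1\<close> from
  right to left; multiplying by \<open>s\<close> treats both directions at once.\<close>

definition heading :: "real \<Rightarrow> real \<Rightarrow> real \<Rightarrow> bool" where
  "heading a b s \<longleftrightarrow> (s = 1 \<or> s = - 1) \<and> Re (curve D a) = - s \<and> Re (curve D b) = s \<and>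
     (\<forall>x\<in>{a..b}. \<forall>y\<in>{a..b}. x < y \<longrightarrow> s * Re (curve D x) < s * Re (curve D y))"

text \<open>The abscissa is continuous and injective along the strand, hence strictly monotone, and
  it attains both -1 and 1.\<close>

lemma graph_heading:
  assumes ab: "a < b" and g: "traces_graph D {a..b} h"
  obtains s where "heading a b s"
proof -
  let ?r = "\<lambda>t. Re (curve D t)"
  have "continuous_on {a..b} ?r"
    using Re_derivative by (meson DERIV_continuous_on has_field_derivative_at_within)
  moreover have "inj_on ?r {a..b}" by (rule inj_onI) (rule graph_Re_inj[OF g])
  ultimately have "strict_mono_on {a..b} ?r \<or> strict_antimono_on {a..b} ?r"
    using injective_eq_monotone_map[of "{a..b}" ?r] by (simp add: is_interval_cc)
  hence "\<exists>s. (s = 1 \<or> s = - 1) \<and> (\<forall>x\<in>{a..b}. \<forall>y\<in>{a..b}. x < y \<longrightarrow> s * ?r x < s * ?r y)"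
  proof
    assume "strict_mono_on {a..b} ?r"
    thus ?thesis by (intro exI[of _ 1]) (simp add: strict_mono_on_def)
  next
    assume "strict_antimono_on {a..b} ?r"
    thus ?thesis by (intro exI[of _ "- 1"]) (simp add: monotone_on_def)
  qed
  then obtain s where s: "s = 1 \<or> s = - 1"
    and m: "\<And>x y. x \<in> {a..b} \<Longrightarrow> y \<in> {a..b} \<Longrightarrow> x < y \<Longrightarrow> s * ?r x < s * ?r y" by blast
  have m': "s * ?r x \<le> s * ?r y" if "x \<in> {a..b}" "y \<in> {a..b}" "x \<le> y" for x y
    using m[OF that(1,2)] that(3) by (cases "x = y") auto
  obtain u where u: "u \<in> {a..b}" "curve D u = Complex (- s) (h (- s))"
    by (rule graph_surj[OF g, of "- s"]) (use s in auto)
  obtain v where v: "v \<in> {a..b}" "curve D v = Complex s (h s)"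
    by (rule graph_surj[OF g, of s]) (use s in auto)
  have "?r a = - s" using m'[of a u] u ab graph_point[OF g, of a] s by auto
  moreover have "?r b = s" using m'[of v b] v ab graph_point[OF g, of b] s by auto
  ultimately show ?thesis using that[of s] s m by (simp add: heading_def)
qed

lemma heading_velocity:
  assumes h: "heading a b s" and t: "a < t" "t < b"
  shows "s * Re (velocity D t) \<ge> 0"
proof (rule ccontr)
  assume "\<not> s * Re (velocity D t) \<ge> 0"
  hence neg: "s * Re (velocity D t) < 0" by simp
  have der: "((\<lambda>t. s * Re (curve D t)) has_real_derivative s * Re (velocity D t)) (at t)"
    by (rule DERIV_cmult[OF Re_derivative])
  obtain d where d: "d > 0" "\<And>h. h > 0 \<Longrightarrow> h < d \<Longrightarrow> s * Re (curve D (t + h)) < s * Re (curve D t)"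
    using has_real_derivative_neg_dec_right[OF der neg] by auto
  define e where "e = min (d / 2) (b - t)"
  have "e > 0" "e < d" "t + e \<le> b" using d(1) t by (auto simp: e_def)
  moreover from this have "s * Re (curve D t) < s * Re (curve D (t + e))"
    using h t unfolding heading_def by simp
  ultimately show False using d(2)[of e] by simp
qed

lemma line_velocity:
  assumes g: "traces_graph D {a..b} (\<lambda>x. c * x)" and t: "a < t" "t < b"
  shows "Im (velocity D t) = c * Re (velocity D t)"
proof -
  have "((\<lambda>t. c * Re (curve D t)) has_real_derivative c * Re (velocity D t)) (at t)"
    by (rule DERIV_cmult[OF Re_derivative])
  moreover have "((\<lambda>t. c * Re (curve D t)) has_real_derivative Im (velocity D t)) (at t)"
  proof (rule has_field_derivative_transform_within_open[OF Im_derivative])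
    show "open {a<..<b}" "t \<in> {a<..<b}" using t by auto
    show "Im (curve D s) = c * Re (curve D s)" if "s \<in> {a<..<b}" for s
      using graph_point(1)[OF g, of s] that by auto
  qed
  ultimately show ?thesis by (metis DERIV_unique)
qed

end

section \<open>Strands inside the window\<close>

context local_change_diagrams
begin

text \<open>A local change fixes the curve off the closed strands only. Each endpoint is a limit of
  such times, since the other strands are closed and disjoint from this one, and the set where the
  two curves agree is closed.\<close>

lemma strand_endpoints:
  assumes i: "i < length S"
  shows "curve D (fst (S ! i)) = curve D' (fst (S ! i))" "curve D (snd (S ! i)) = curve D' (snd (S ! i))"
proof -
  let ?C = "{t. curve D t = curve D' t}"
  let ?V = "\<Union>j\<in>{..<length S} - {i}. strand j"
  have "continuous_on UNIV (curve D)" "continuous_on UNIV (curve D')"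
    by (rule curve_continuous, rule local_change_diagrams.curve_continuous[OF local_change_sym])
  hence C: "closed ?C" by (rule closed_Collect_eq)
  have V: "closed ?V" by (intro closed_UN) auto
  have "x \<in> ?C" if x: "x \<in> strand i" and nb: "\<And>e. e > 0 \<Longrightarrow> \<exists>y. \<bar>y - x\<bar> < e \<and> y \<notin> strand i" for x
  proof (rule ccontr)
    assume "x \<notin> ?C"
    moreover have "x \<notin> ?V" using x strand_disjoint[OF i] by blast
    moreover have "x \<in> {0<..<1}" using W_bounds[of x] x strand_subset_W[OF i] by auto
    ultimately have "x \<in> {0<..<1} - ?C - ?V" by simp
    moreover have "open ({0<..<1} - ?C - ?V)" using C V by (intro open_Diff) auto
    ultimately obtain e where e: "e > 0" "ball x e \<subseteq> {0<..<1} - ?C - ?V" using openE by blast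
    obtain y where y: "\<bar>y - x\<bar> < e" "y \<notin> strand i" using nb[OF e(1)] by blast
    have "y \<in> ball x e" using y(1) by (simp add: dist_real_def abs_minus_commute)
    hence yU: "y \<in> {0<..<1} - ?C - ?V" using e(2) by blast
    hence "y \<notin> W" using y(2) unfolding W_def by blast
    thus False using outside_eq(1)[of y] yU by simp
  qed
  note * = this
  show "curve D (fst (S ! i)) = curve D' (fst (S ! i))"
  proof (rule CollectD[OF *])
    fix e :: real assume "e > 0"
    thus "\<exists>y. \<bar>y - fst (S ! i)\<bar> < e \<and> y \<notin> strand i" by (intro exI[of _ "fst (S ! i) - e / 2"]) simp
  qed (use strand_bounds[OF i] in simp)
  show "curve D (snd (S ! i)) = curve D' (snd (S ! i))"
  proof (rule CollectD[OF *])
    fix e :: real assume "e > 0"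
    thus "\<exists>y. \<bar>y - snd (S ! i)\<bar> < e \<and> y \<notin> strand i" by (intro exI[of _ "snd (S ! i) + e / 2"]) simp
  qed (use strand_bounds[OF i] in simp)
qed

lemma in_open_window:
  assumes t: "t \<in> strand i" and i: "i < length S"
    and box: "\<bar>Re (curve D t)\<bar> < 1" "\<bar>Im (curve D t)\<bar> < 1"
  shows "fst (S ! i) < t" "t < snd (S ! i)"
proof -
  have tW: "t \<in> W" using t strand_subset_W[OF i] by blast
  have "curve D t \<in> box (Complex (-1) (-1)) (Complex 1 1)" using box by (auto simp: in_box_complex_iff)
  moreover have "t \<in> {0..1}" using W_bounds[OF tW] by simp
  moreover have "\<forall>t\<in>{0..1}. curve D t \<in> box (Complex (-1) (-1)) (Complex 1 1) \<longleftrightarrow>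
      t \<in> (\<Union>j<length S. strand_interior S j)"
    using change unfolding local_change_def window_strands_def by (elim conjE)
  ultimately have "t \<in> (\<Union>j<length S. strand_interior S j)" by (metis (no_types, lifting))
  then obtain j where j: "j < length S" "t \<in> strand_interior S j" by blast
  hence "t \<in> strand j" by auto
  hence "i = j" using strand_disjoint[OF i j(1)] t by blast
  thus "fst (S ! i) < t" "t < snd (S ! i)" using j by auto
qed

lemma strand_times_bounds: "i < length S \<Longrightarrow> t \<in> strand i \<Longrightarrow> 0 \<le> t \<and> t < 1"
  using W_bounds[of t] strand_subset_W[of i] by force

lemma strand_crossing:
  assumes "i < length S" "j < length S" "t \<in> strand i" "u \<in> strand j" "i \<noteq> j" "curve D t = curve D u"
  shows "crossing D t u" "partner D t = u"
proof -
  have "t \<noteq> u" using strand_disjoint[OF assms(1,2,5)] assms(3,4) by blast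
  thus "crossing D t u"
    using assms strand_times_bounds[OF assms(1,3)] strand_times_bounds[OF assms(2,4)] by (intro D.same_point) auto
  thus "partner D t = u" using strand_times_bounds[OF assms(2,4)] by (intro D.partner_eqI) auto
qed

lemma passage_in_window:
  assumes p: "p \<in> passage_set D \<inter> W"
    and inj: "\<And>i. i < length S \<Longrightarrow> inj_on (curve D) (strand i)"
  obtains i j where "i < length S" "j < length S" "i \<noteq> j" "p \<in> strand i" "partner D p \<in> strand j"
    "curve D p = curve D (partner D p)"
proof -
  have pP: "p \<in> passage_set D" using p by simp
  have eq: "curve D p = curve D (partner D p)" using D.passage_crossing(1)[OF pP] by (simp add: crossing_def)
  have "partner D p \<in> W" using partner_inside[OF pP] p by simp
  then obtain i j where ij: "i < length S" "j < length S" "p \<in> strand i" "partner D p \<in> strand j"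
    using p by (auto simp: W_def)
  have "i \<noteq> j" using inj[OF ij(1)] ij(3,4) eq D.partner_neq[OF pP] by (auto simp: inj_on_def)
  thus ?thesis using that ij eq by blast
qed

end

text \<open>Both new crossings have the same parity, since they are adjacent on both strands, and
  opposite signs, since the second strand starts and ends above the axis. Hence the weights on each
  strand are inverse, as \<open>alex_det_move_II\<close> demands.\<close>

lemma move_II_invariance:
  assumes D: "diagram D" and D': "diagram D'" and move: "move_II D D'"
  shows "unit_equiv (zpa_det D') (zpa_det D)"
proof -
  from move obtain S f g where len: "length S = 2" and lc: "local_change S D D'"
    and g0: "traces_graph D (strand_times S 0) (\<lambda>x. 0)" and g0': "traces_graph D' (strand_times S 0) (\<lambda>x. 0)"
    and g1: "traces_graph D (strand_times S 1) f" and g1': "traces_graph D' (strand_times S 1) g"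
    and fpos: "\<forall>x \<in> {-1..1}. f x > 0" and card2: "card {x \<in> {-1..1}. g x = 0} = 2"
    and kind: "\<forall>t \<in> strand_times S 0. \<forall>u \<in> strand_times S 0.
           (\<exists>t'. crossing D' t t') \<and> (\<exists>u'. crossing D' u u') \<longrightarrow>
             (t \<in> overs D' \<longleftrightarrow> u \<in> overs D') \<and> (t \<in> unders D' \<longleftrightarrow> u \<in> unders D')"
    unfolding move_II_def by (elim exE conjE)
  interpret local_change_diagrams D D' S by (intro local_change_diagrams.intro D D' lc)
  interpret sym: local_change_diagrams D' D S by (rule local_change_sym)
  let ?P' = "passage_set D'"
  have l: "0 < length S" "1 < length S" using len by simp_all
  have i01: "i = 0 \<or> i = 1" if "i < length S" for i using that len by auto
  have inj: "inj_on (curve D) (strand i)" if "i < length S" for i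
    using i01[OF that] g0 g1 by (auto simp: traces_graph_def)
  have inj': "inj_on (curve D') (strand i)" if "i < length S" for i
    using i01[OF that] g0' g1' by (auto simp: traces_graph_def)
  \<comment> \<open>Before the move the axis separates the strands, because \<open>f\<close> is
    positive.\<close>
  have new: "passage_set D \<inter> W = {}"
  proof (rule equals0I)
    fix p assume p: "p \<in> passage_set D \<inter> W"
    obtain i j where ij: "i < length S" "j < length S" "i \<noteq> j" "p \<in> strand i" "partner D p \<in> strand j"
      and eq: "curve D p = curve D (partner D p)"
      by (rule passage_in_window[OF p inj])
    have 0: "Im (curve D t) = 0" if "t \<in> strand 0" for t
      using D.graph_point(1)[OF g0 that] .
    have 1: "Im (curve D t) > 0" if "t \<in> strand 1" for t
      using D.graph_point[OF g1 that] fpos by simp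
    from i01[OF ij(1)] i01[OF ij(2)] ij(3) have "i = 0 \<and> j = 1 \<or> i = 1 \<and> j = 0" by auto
    thus False using 0 1 ij(4,5) eq by fastforce
  qed
  have "\<forall>x\<in>{-1..1}. \<exists>t. t \<in> strand 0 \<and> curve D' t = Complex x 0"
    using D'.graph_surj[OF g0'] by (metis atLeastAtMost_iff)
  then obtain U where U: "\<And>x. x \<in> {-1..1} \<Longrightarrow> U x \<in> strand 0 \<and> curve D' (U x) = Complex x 0" by metis
  have "\<forall>x\<in>{-1..1}. \<exists>t. t \<in> strand 1 \<and> curve D' t = Complex x (g x)"
    using D'.graph_surj[OF g1'] by (metis atLeastAtMost_iff)
  then obtain V where V: "\<And>x. x \<in> {-1..1} \<Longrightarrow> V x \<in> strand 1 \<and> curve D' (V x) = Complex x (g x)" by metis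
  obtain x1 x2 where Z: "{x \<in> {-1..1}. g x = 0} = {x1, x2}" "U x1 < U x2"
  proof -
    obtain y1 y2 where y: "{x \<in> {-1..1}. g x = 0} = {y1, y2}" "y1 \<noteq> y2" using card2 by (auto simp: card_2_iff)
    hence "y1 \<in> {x \<in> {-1..1}. g x = 0}" "y2 \<in> {x \<in> {-1..1}. g x = 0}" by auto
    hence "U y1 \<noteq> U y2" using U[of y1] U[of y2] y(2) by auto
    thus ?thesis using that[of y1 y2] that[of y2 y1] y(1) by (metis insert_commute linorder_neqE)
  qed
  have "x1 \<in> {x \<in> {-1..1}. g x = 0}" "x2 \<in> {x \<in> {-1..1}. g x = 0}" unfolding Z(1) by auto
  hence x: "x1 \<in> {-1..1}" "g x1 = 0" "x2 \<in> {-1..1}" "g x2 = 0" by simp_all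
  define u1 u2 t1 t2 where "u1 = U x1" and "u2 = U x2" and "t1 = V x1" and "t2 = V x2"
  have u: "u1 \<in> strand 0" "u2 \<in> strand 0" "u1 < u2" "curve D' u1 = Complex x1 0" "curve D' u2 = Complex x2 0"
    using U[OF x(1)] U[OF x(3)] Z(2) by (simp_all add: u1_def u2_def)
  have t: "t1 \<in> strand 1" "t2 \<in> strand 1" "curve D' t1 = Complex x1 0" "curve D' t2 = Complex x2 0"
    using V[OF x(1)] V[OF x(3)] x by (simp_all add: t1_def t2_def)
  have tne: "t1 \<noteq> t2"
  proof
    assume "t1 = t2"
    hence "x1 = x2" using t(3,4) by simp
    thus False using u(3) by (simp add: u1_def u2_def)
  qed
  have cr: "crossing D' u1 t1" "crossing D' u2 t2" and pa: "partner D' u1 = t1" "partner D' u2 = t2"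
    "partner D' t1 = u1" "partner D' t2 = u2"
    using sym.strand_crossing[OF l, of u1 t1] sym.strand_crossing[OF l, of u2 t2]
      sym.strand_crossing[OF l(2,1), of t1 u1] sym.strand_crossing[OF l(2,1), of t2 u2] u t by simp_all
  have key: "p = u1 \<and> q = t1 \<or> p = u2 \<and> q = t2"
    if "p \<in> strand 0" "q \<in> strand 1" "curve D' p = curve D' q" for p q
  proof -
    have "Re (curve D' q) \<in> {x \<in> {-1..1}. g x = 0}"
      using D'.graph_point[OF g0' that(1)] D'.graph_point[OF g1' that(2)] that(3) by auto
    hence "Re (curve D' q) = x1 \<or> Re (curve D' q) = x2" unfolding Z(1) by auto
    thus ?thesis using D'.graph_Re_inj[OF g0' that(1)] D'.graph_Re_inj[OF g1' that(2)] u t that(3) by auto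
  qed
  have inW: "p \<in> {u1, u2, t1, t2}" if p: "p \<in> ?P' \<inter> W" for p
  proof -
    obtain i j where ij: "i < length S" "j < length S" "i \<noteq> j" "p \<in> strand i" "partner D' p \<in> strand j"
      and eq: "curve D' p = curve D' (partner D' p)"
      by (rule sym.passage_in_window[OF p inj'])
    from i01[OF ij(1)] i01[OF ij(2)] ij(3) consider "i = 0" "j = 1" | "i = 1" "j = 0" by auto
    thus ?thesis using key[of p "partner D' p"] key[of "partner D' p" p] ij(4,5) eq by cases auto
  qed
  show ?thesis
  proof (cases "?P' \<inter> W = {}")
    case True
    thus ?thesis using new by (intro zpa_det_no_classical_crossings)
  next
    case False
    have same: "u1 \<in> overs D' \<longleftrightarrow> u2 \<in> overs D'" "u1 \<in> unders D' \<longleftrightarrow> u2 \<in> unders D'"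
      using kind u cr by blast+
    have bd: "u1 \<in> {0..<1}" "u2 \<in> {0..<1}"
      using strand_times_bounds[OF l(1) u(1)] strand_times_bounds[OF l(1) u(2)] by auto
    obtain p where p: "p \<in> ?P' \<inter> W" using False by blast
    have "u1 \<in> ?P' \<or> u2 \<in> ?P'"
      using inW[OF p] p D'.partner_in[of p] pa by auto
    hence uP: "u1 \<in> ?P'" "u2 \<in> ?P'" using same bd by (auto simp: passage_set_def)
    hence tP: "t1 \<in> ?P'" "t2 \<in> ?P'" using D'.partner_in[of u1] D'.partner_in[of u2] pa by simp_all
    define X where "X = {u1, u2, t1, t2}"
    have inS: "u1 \<in> W" "u2 \<in> W" "t1 \<in> W" "t2 \<in> W"
      using u t strand_subset_W[OF l(1)] strand_subset_W[OF l(2)] by auto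
    have X: "?P' \<inter> W = X" using inW uP tP inS by (auto simp: X_def)
    have dj: "strand 0 \<inter> strand 1 = {}" using strand_disjoint[OF l] by simp
    have X0: "X \<inter> strand 0 = {u1, u2}" and X1: "X \<inter> strand 1 = {t1, t2}"
      using u t dj by (auto simp: X_def)
    have P0: "?P' \<inter> strand 0 = {u1, u2}" and P1: "?P' \<inter> strand 1 = {t1, t2}"
      using X X0 X1 strand_subset_W[OF l(1)] strand_subset_W[OF l(2)] by blast+
    \<comment> \<open>The crossings are numbered along the first strand, so on the second one they
      may come in either order.\<close>
    define a b where "a = min t1 t2" and "b = max t1 t2"
    have ab: "a < b" "{t1, t2} = {a, b}" using tne by (auto simp: a_def b_def)
    have abc: "(a = t1 \<and> b = t2) \<or> (a = t2 \<and> b = t1)" by (auto simp: a_def b_def)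
    have rank: "passage_rank D' u2 = Suc (passage_rank D' u1)" "passage_rank D' b = Suc (passage_rank D' a)"
      using sym.passage_rank_strand[OF P0 u(3) l(1)] sym.passage_rank_strand[OF _ ab(1) l(2)] P1 ab(2) by simp_all
    have nxt: "cyc_next ?P' u1 = u2" "cyc_next ?P' a = b"
      using cyc_next_strand[OF D'.finite_passage_set P0 u(3) l(1)]
        cyc_next_strand[OF D'.finite_passage_set _ ab(1) l(2)] P1 ab(2) by simp_all
    \<comment> \<open>From one crossing to the other both ranks change by one, so their sum keeps
      its parity.\<close>
    have ev: "is_even D' u1 \<longleftrightarrow> is_even D' u2"
      using rank ab by (cases "t1 < t2") (auto simp: is_even_def pa a_def b_def)
    have turn: "turn D' u2 t2 = - turn D' u1 t1"
    proof -
      obtain s where s: "D'.heading (fst (S ! 0)) (snd (S ! 0)) s"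
        using D'.graph_heading[OF strand_bounds(2)[OF l(1)] g0'] .
      let ?k = "\<lambda>t. Im (curve D' t)"
      \<comment> \<open>The move keeps the endpoints, and \<open>f\<close> is positive
        there.\<close>
      have ends: "?k (fst (S ! 1)) > 0" "?k (snd (S ! 1)) > 0"
        using strand_endpoints[OF l(2)] D.graph_point[OF g1, of "fst (S ! 1)"]
          D.graph_point[OF g1, of "snd (S ! 1)"] fpos strand_bounds[OF l(2)] by simp_all
      have zero: "t = t1 \<or> t = t2" if "t \<in> strand 1" "?k t = 0" for t
      proof -
        have "Re (curve D' t) \<in> {x \<in> {-1..1}. g x = 0}"
          using D'.graph_point[OF g1' that(1)] that(2) by auto
        hence "Re (curve D' t) = x1 \<or> Re (curve D' t) = x2" unfolding Z(1) by auto
        thus ?thesis using D'.graph_Re_inj[OF g1' that(1)] t by auto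
      qed
      have abk: "?k a = 0" "?k b = 0" "a \<in> strand 1" "b \<in> strand 1" using t by (auto simp: a_def b_def min_def max_def)
      have abi: "fst (S ! 1) < a" "b < snd (S ! 1)"
        using abk ends by (auto simp: order_less_le)
      have Ia: "Im (velocity D' a) \<le> 0"
      proof (rule deriv_first_zero[OF D'.Im_derivative ends(1) abi(1) abk(1)])
        fix r assume r: "fst (S ! 1) \<le> r" "r < a"
        hence "r \<in> strand 1" using abk(3) by auto
        thus "?k r \<noteq> 0" using zero[of r] r(2) by (auto simp: a_def)
      qed
      have Ib: "Im (velocity D' b) \<ge> 0"
      proof (rule deriv_last_zero[OF D'.Im_derivative ends(2) abi(2) abk(2)])
        fix r assume r: "b < r" "r \<le> snd (S ! 1)"
        hence "r \<in> strand 1" using abk(4) by auto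
        thus "?k r \<noteq> 0" using zero[of r] r(1) by (auto simp: b_def)
      qed
      \<comment> \<open>The abscissas -1 and 1 belong to the ends of the second strand, which lie
        above the axis. So the crossings are in the open window, and their times are interior on the
        first strand as well.\<close>
      have xi: "\<bar>x1\<bar> < 1" "\<bar>x2\<bar> < 1"
      proof -
        have "x \<noteq> 1 \<and> x \<noteq> -1" if "x \<in> {-1..1}" "g x = 0" for x
        proof -
          have V': "V x \<in> strand 1" "curve D' (V x) = Complex x 0" using V[OF that(1)] that(2) by auto
          obtain s1 where s1: "D'.heading (fst (S ! 1)) (snd (S ! 1)) s1"
            using D'.graph_heading[OF strand_bounds(2)[OF l(2)] g1'] .
          hence e: "s1 = 1 \<or> s1 = - 1" "Re (curve D' (fst (S ! 1))) = - s1" "Re (curve D' (snd (S ! 1))) = s1"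
            by (simp_all add: D'.heading_def)
          have m: "fst (S ! 1) \<in> strand 1" "snd (S ! 1) \<in> strand 1" using strand_bounds[OF l(2)] by simp_all
          have "V x \<noteq> fst (S ! 1)" "V x \<noteq> snd (S ! 1)" using ends V'(2) by auto
          hence "x \<noteq> - s1" "x \<noteq> s1"
            using D'.graph_Re_inj[OF g1' V'(1) m(1)] D'.graph_Re_inj[OF g1' V'(1) m(2)] e V'(2) by auto
          thus ?thesis using e(1) by auto
        qed
        thus "\<bar>x1\<bar> < 1" "\<bar>x2\<bar> < 1" using x by force+
      qed
      have R: "s * Re (velocity D' v) \<ge> 0 \<and> Im (velocity D' v) = 0" if "v = u1 \<or> v = u2" for v
      proof -
        have v: "fst (S ! 0) < v" "v < snd (S ! 0)"
          using sym.in_open_window[of v 0] that u xi l by auto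
        have "traces_graph D' (strand 0) (\<lambda>x. 0 * x)" using g0' by simp
        thus ?thesis using D'.heading_velocity[OF s v] D'.line_velocity[OF _ v, of 0] by simp
      qed
      \<comment> \<open>Transversality turns the weak inequalities into strict ones: the second
        strand goes down at its first crossing and up at its last, while the first strand keeps its
        direction.\<close>
      have c: "cross_prod (velocity D' u1) (velocity D' t1) \<noteq> 0" "cross_prod (velocity D' u2) (velocity D' t2) \<noteq> 0"
        using D'.cross_prod_nonzero cr by auto
      have eq: "cross_prod (velocity D' u1) (velocity D' t1) = Re (velocity D' u1) * Im (velocity D' t1)"
        "cross_prod (velocity D' u2) (velocity D' t2) = Re (velocity D' u2) * Im (velocity D' t2)"
        using R[of u1] R[of u2] by (simp_all add: cross_prod_def)
      have s1: "s = 1 \<or> s = - 1" using s by (simp add: D'.heading_def)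
      have "(Im (velocity D' t1) > 0 \<longleftrightarrow> Im (velocity D' t2) < 0)"
        using Ia Ib c[unfolded eq] tne by (cases "t1 < t2") (auto simp: a_def b_def)
      moreover have "(Re (velocity D' u1) > 0 \<longleftrightarrow> Re (velocity D' u2) > 0)"
        using R[of u1] R[of u2] s1 c[unfolded eq] by auto
      ultimately show ?thesis
        using c unfolding turn_def eq by (auto simp: zero_less_mult_iff mult_less_0_iff not_less order_le_less)
    qed
    have turn': "turn D' t1 u1 = - turn D' u1 t1" "turn D' t2 u2 = turn D' u1 t1"
      using D'.turn_neg[OF cr(1)] D'.turn_neg[OF cr(2)] turn by simp_all
    have evt: "is_even D' t1 = is_even D' u1" "is_even D' t2 = is_even D' u1"
      using D'.is_even_partner[OF uP(1)] D'.is_even_partner[OF uP(2)] pa ev by simp_all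
    have ovt: "t1 \<in> overs D' \<longleftrightarrow> u1 \<notin> overs D'" "t2 \<in> overs D' \<longleftrightarrow> u1 \<notin> overs D'"
      using D'.partner_overs[OF uP(1)] D'.partner_overs[OF uP(2)] pa same(1) by simp_all
    have wu: "weight D' u1 * weight D' u2 = 1"
      using passage_weight_inverse turn ev same(1) by (simp add: weight_def pa)
    have "weight D' t1 * weight D' t2 = 1"
      using passage_weight_inverse[of _ _ "- turn D' u1 t1"] turn' evt ovt by (simp add: weight_def pa)
    hence wt: "weight D' a * weight D' b = 1"
      using abc mult.commute[of "weight D' t1" "weight D' t2"] by (elim disjE conjE) simp_all
    have abP: "a \<in> ?P'" "b \<in> ?P'" using abc tP by blast+
    have "u1 \<noteq> a" "u1 \<noteq> b" "u2 \<noteq> a" "u2 \<noteq> b" using abc u(1,2) t(1,2) dj by blast+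
    hence dist: "distinct [u1, u2, a, b]" using u(3) ab(1) by simp
    have Xab: "X = {u1, u2, a, b}" using ab by (auto simp: X_def)
    have oth: "(partner D' a = u1 \<and> partner D' b = u2) \<or> (partner D' a = u2 \<and> partner D' b = u1)"
      "(partner D' u1 = a \<and> partner D' u2 = b) \<or> (partner D' u1 = b \<and> partner D' u2 = a)"
      using abc pa by blast+
    have ovab: "a \<in> overs D' \<longleftrightarrow> u1 \<notin> overs D'" "b \<in> overs D' \<longleftrightarrow> u1 \<notin> overs D'"
      using abc ovt by blast+
    have other: "partner D' k \<notin> {u1, u2, a, b}" if k: "k \<in> ?P' - {u1, u2, a, b}" for k
    proof -
      have "k \<notin> W" using k X Xab by blast
      hence "partner D' k \<notin> W" using sym.partner_inside[of k] k by auto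
      thus ?thesis using X Xab by blast
    qed
    have evX: "even (card (X \<inter> strand i))" if "i < length S" for i
      using i01[OF that] X0 X1 u(3) tne by auto
    have new_det: "alex_det ?P' lam (partner D') ov = marked_det D X"
      if "\<And>p. lam p = (if p \<in> X then 1 else weight D' p)" "\<And>p. ov p \<longleftrightarrow> p \<in> X \<or> p \<in> overs D'" for lam ov
      using that by (intro marked_det_new_passages[OF new X evX])
    \<comment> \<open>The over-strand may be either strand; the two cases exchange their roles in
      \<open>alex_det_move_II\<close>.\<close>
    have "marked_det D' {} = marked_det D X"
    proof (cases "u1 \<in> overs D'")
      case True
      have "marked_det D' {} = alex_det ?P' ((weight D')(u1 := 1, u2 := 1, a := 1, b := 1)) (partner D')
          ((\<lambda>p. p \<in> overs D')(a := True, b := True))"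
        unfolding sym.marked_det_empty
        by (rule alex_det_move_II[OF D'.finite_passage_set uP abP dist nxt oth(1) _ _ _ _ wu wt])
           (use True same ovab other in simp_all)
      also have "\<dots> = marked_det D X"
        using True same by (intro new_det) (auto simp: Xab)
      finally show ?thesis .
    next
      case False
      have dist': "distinct [a, b, u1, u2]" using dist by auto
      have other': "\<And>k. k \<in> ?P' - {a, b, u1, u2} \<Longrightarrow> partner D' k \<notin> {a, b, u1, u2}"
        using other by blast
      have "marked_det D' {} = alex_det ?P' ((weight D')(a := 1, b := 1, u1 := 1, u2 := 1)) (partner D')
          ((\<lambda>p. p \<in> overs D')(u1 := True, u2 := True))"
        unfolding sym.marked_det_empty
        by (rule alex_det_move_II[OF D'.finite_passage_set abP uP dist' nxt(2,1) oth(2) _ _ _ _ wt wu])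
           (use False same ovab other' in simp_all)
      also have "\<dots> = marked_det D X"
        using False ovab by (intro new_det) (auto simp: Xab)
      finally show ?thesis .
    qed
    thus ?thesis using uP unit_equiv_refl by (intro zpa_det_transport[OF D D', of "{}" X]) (auto simp: X_def)
  qed
qed

section \<open>Move III\<close>

text \<open>
  \<open>th i j\<close> is the time at which strand \<open>i\<close> meets strand \<open>j\<close>, and \<open>s i = 1\<close> iff strand \<open>i\<close> runs from left
  to right; \<open>e = 1\<close> iff the third strand passes above the crossing of the other two.
\<close>

definition triangle_config :: "vdiagram \<Rightarrow> (real \<times> real) list \<Rightarrow> (nat \<Rightarrow> int) \<Rightarrow> int \<Rightarrow> (nat \<Rightarrow> nat \<Rightarrow> real) \<Rightarrow> bool" where
  "triangle_config D S s e th \<longleftrightarrow>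
    (\<forall>i<3. (s i = 1 \<or> s i = - 1) \<and> Re (curve D (fst (S ! i))) = - of_int (s i)) \<and>
    (\<forall>i<3. \<forall>j<3. i \<noteq> j \<longrightarrow> th i j \<in> strand_times S i \<and> curve D (th i j) = curve D (th j i)) \<and>
    (\<forall>i<3. \<forall>j<3. \<forall>p\<in>strand_times S i. \<forall>q\<in>strand_times S j. i \<noteq> j \<longrightarrow> curve D p = curve D q \<longrightarrow> p = th i j) \<and>
    (\<forall>i<3. inj_on (curve D) (strand_times S i)) \<and>
    turn D (th 0 1) (th 1 0) = - s 0 * s 1 \<and> turn D (th 0 2) (th 2 0) = - s 0 * s 2 \<and>
    turn D (th 1 2) (th 2 1) = s 1 * s 2 \<and>
    th 0 1 \<noteq> th 0 2 \<and> th 1 0 \<noteq> th 1 2 \<and> th 2 0 \<noteq> th 2 1 \<and>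
    (th 0 1 < th 0 2 \<longleftrightarrow> s 0 = e) \<and> (th 1 0 < th 1 2 \<longleftrightarrow> s 1 = - e) \<and> (th 2 0 < th 2 1 \<longleftrightarrow> s 2 = - e)"

text \<open>Monotonicity yields only weak inequalities for the two factors; the non-vanishing cross
  product makes them strict.\<close>

lemma turn_eqI:
  assumes "cross_prod (velocity D t) (velocity D u) = A * B" "cross_prod (velocity D t) (velocity D u) \<noteq> 0"
    and "s = 1 \<or> s = - 1" "r = 1 \<or> r = - 1" "of_int s * A \<ge> 0" "of_int r * B \<ge> 0"
  shows "turn D t u = s * r"
  using assms by (auto simp: turn_def zero_less_mult_iff not_less order_le_less)

context local_change_diagrams
begin

text \<open>Everything is read off from the headings and the abscissas of the three crossings: 0 for
  the two lines, \<open>xa\<close> and \<open>xb\<close> for the third strand with either line. The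
  sign \<open>e\<close> places \<open>xa\<close> and \<open>xb\<close> on opposite sides of
  0.\<close>

lemma ex_triangle:
  assumes len: "length S = 3"
    and g0: "traces_graph D (strand 0) (\<lambda>x. x / 2)" and g1: "traces_graph D (strand 1) (\<lambda>x. - x / 2)"
    and g2: "traces_graph D (strand 2) h"
    and e: "e = 1 \<or> e = - 1" "of_int e * h 0 > 0"
    and h1: "\<bar>h (-1)\<bar> < 1 / 2" "\<bar>h 1\<bar> < 1 / 2"
    and ex1: "\<exists>!x. x \<in> {-1..1} \<and> h x = x / 2" and ex2: "\<exists>!x. x \<in> {-1..1} \<and> h x = - x / 2"
  shows "\<exists>s th. triangle_config D S s e th"
proof -
  have l: "0 < length S" "1 < length S" "2 < length S" using len by simp_all
  let ?a = "\<lambda>i. fst (S ! i)" and ?b = "\<lambda>i. snd (S ! i)" and ?r = "\<lambda>t. Re (curve D t)" and ?m = "\<lambda>t. Im (curve D t)"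
  obtain s0 where s0: "D.heading (?a 0) (?b 0) s0" using D.graph_heading[OF strand_bounds(2)[OF l(1)] g0] .
  obtain s1 where s1: "D.heading (?a 1) (?b 1) s1" using D.graph_heading[OF strand_bounds(2)[OF l(2)] g1] .
  obtain s2 where s2: "D.heading (?a 2) (?b 2) s2" using D.graph_heading[OF strand_bounds(2)[OF l(3)] g2] .
  obtain xa where xa: "xa \<in> {-1..1}" "h xa = xa / 2" "\<And>x. x \<in> {-1..1} \<Longrightarrow> h x = x / 2 \<Longrightarrow> x = xa"
    using ex1 by metis
  obtain xb where xb: "xb \<in> {-1..1}" "h xb = - xb / 2" "\<And>x. x \<in> {-1..1} \<Longrightarrow> h x = - x / 2 \<Longrightarrow> x = xb"
    using ex2 by metis
  \<comment> \<open>At the sides of the window the lines have height 1/2 or -1/2, which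
    \<open>h\<close> does not reach.\<close>
  have xa1: "\<bar>xa\<bar> < 1" proof -
    have "xa \<noteq> 1" "xa \<noteq> - 1" using xa(2) h1 by auto
    thus ?thesis using xa(1) by auto
  qed
  have xb1: "\<bar>xb\<bar> < 1" proof -
    have "xb \<noteq> 1" "xb \<noteq> - 1" using xb(2) h1 by auto
    thus ?thesis using xb(1) by auto
  qed
  \<comment> \<open>Heights above the two lines; on the third strand their zeros are its crossings
    with strands 0 and 1.\<close>
  let ?q = "\<lambda>t. ?m t - ?r t / 2" and ?p = "\<lambda>t. ?m t + ?r t / 2"
  have qd: "(?q has_real_derivative Im (velocity D t) - Re (velocity D t) / 2) (at t)" for t
    by (intro DERIV_diff D.Im_derivative DERIV_cdivide D.Re_derivative)
  have pd: "(?p has_real_derivative Im (velocity D t) + Re (velocity D t) / 2) (at t)" for t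
    by (intro DERIV_add D.Im_derivative DERIV_cdivide D.Re_derivative)
  have cont: "continuous_on A ?q" "continuous_on A ?p" for A
    by (rule DERIV_continuous_on, rule has_field_derivative_at_within, rule qd pd)+
  have pt: "?m t = h (?r t)" "?r t \<in> {-1..1}" if "t \<in> strand 2" for t
    using D.graph_point[OF g2 that] by auto
  have qz: "?r t = xa" if "t \<in> strand 2" "?q t = 0" for t using xa(3)[of "?r t"] pt[OF that(1)] that(2) by simp
  have pz: "?r t = xb" if "t \<in> strand 2" "?p t = 0" for t using xb(3)[of "?r t"] pt[OF that(1)] that(2) by simp
  obtain tm where tm: "tm \<in> strand 2" "curve D tm = Complex 0 (h 0)" by (rule D.graph_surj[OF g2, of 0]) auto
  have mono: "s2 * ?r x < s2 * ?r y" if "x \<in> strand 2" "y \<in> strand 2" "x < y" for x y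
    using s2 that by (simp add: D.heading_def)
  have s2': "s2 = 1 \<or> s2 = - 1" "?r (?a 2) = - s2" "?r (?b 2) = s2" using s2 by (simp_all add: D.heading_def)
  have ab2: "?a 2 \<in> strand 2" "?b 2 \<in> strand 2" using strand_bounds[OF l(3)] by simp_all
  define e' where "e' = real_of_int e"
  have e': "e' = 1 \<or> e' = - 1" "e' * h 0 > 0" using e by (auto simp: e'_def)
  text \<open>An endpoint \<open>y\<close> of strand 2; the functions in question change sign between \<open>y\<close> and \<open>tm\<close>.\<close>
  have between: "\<exists>t\<in>strand 2. k t = 0 \<and> ?r y * ?r t > 0"
    if y: "y \<in> strand 2" "?r y \<noteq> 0" and k: "continuous_on UNIV k" "e' * k tm > 0" "e' * k y < 0" for k y
  proof -
    have c: "continuous_on A (\<lambda>t. e' * k t)" for A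
      using k(1) by (intro continuous_on_mult_left continuous_on_subset[OF k(1)]) auto
    have "\<exists>t. min y tm \<le> t \<and> t \<le> max y tm \<and> e' * k t = 0"
    proof (cases "y \<le> tm")
      case True
      thus ?thesis using IVT'[of "\<lambda>t. e' * k t" y 0 tm] c k by auto
    next
      case False
      thus ?thesis using IVT2'[of "\<lambda>t. e' * k t" y 0 tm] c k by auto
    qed
    then obtain t where t: "min y tm \<le> t" "t \<le> max y tm" "k t = 0" using e'(1) by auto
    have tS: "t \<in> strand 2" using t y tm by (auto simp: min_def max_def split: if_splits)
    have tne: "t \<noteq> tm" "t \<noteq> y" using t(3) k by auto
    have "?r y * ?r t > 0"
    proof (cases "y < tm")
      case True
      hence "y < t" "t < tm" using t tne by auto
      hence "s2 * ?r y < s2 * ?r t" "s2 * ?r t < s2 * ?r tm"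
        using mono[OF y(1) tS] mono[OF tS tm(1)] by simp_all
      thus ?thesis using s2'(1) tm(2) by (auto simp: zero_less_mult_iff)
    next
      case False
      hence "t < y" "tm < t" using t tne by auto
      hence "s2 * ?r t < s2 * ?r y" "s2 * ?r tm < s2 * ?r t"
        using mono[OF tS y(1)] mono[OF tm(1) tS] by simp_all
      thus ?thesis using s2'(1) tm(2) by (auto simp: zero_less_mult_iff)
    qed
    thus ?thesis using tS t(3) by blast
  qed
  \<comment> \<open>At abscissa \<open>e'\<close> the value \<open>e' * ?q\<close> is
    \<open>e' * h e' - 1 / 2 < 0\<close>, in the middle it is \<open>e' * h 0 > 0\<close>; so
    \<open>xa\<close> lies on the side of \<open>e'\<close>. For \<open>?p\<close> the abscissa
    \<open>- e'\<close> plays this part.\<close>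
  obtain y1 where y1: "y1 \<in> strand 2" "?r y1 = e'"
    using s2' ab2 e'(1) by (metis minus_minus)
  obtain y2 where y2: "y2 \<in> strand 2" "?r y2 = - e'"
    using s2' ab2 e'(1) by (metis minus_minus)
  have xa_sgn: "e' * xa > 0"
  proof -
    have "e' * ?q y1 < 0" using pt[OF y1(1)] y1(2) e'(1) h1 by auto
    moreover have "e' * ?q tm > 0" using tm(2) e'(2) by simp
    ultimately obtain t where "t \<in> strand 2" "?q t = 0" "?r y1 * ?r t > 0"
      using between[OF y1(1) _ cont(1)] y1(2) e'(1) by force
    thus ?thesis using qz y1(2) by auto
  qed
  have xb_sgn: "e' * xb < 0"
  proof -
    have "e' * ?p y2 < 0" using pt[OF y2(1)] y2(2) e'(1) h1 by auto
    moreover have "e' * ?p tm > 0" using tm(2) e'(2) by simp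
    ultimately obtain t where "t \<in> strand 2" "?p t = 0" "?r y2 * ?r t > 0"
      using between[OF y2(1) _ cont(2)] y2(2) e'(1) by force
    thus ?thesis using pz y2(2) by auto
  qed
  obtain t01 where t01: "t01 \<in> strand 0" "curve D t01 = Complex 0 0"
    using D.graph_surj[OF g0, of 0] by auto
  obtain t10 where t10: "t10 \<in> strand 1" "curve D t10 = Complex 0 0"
    using D.graph_surj[OF g1, of 0] by auto
  obtain t02 where t02: "t02 \<in> strand 0" "curve D t02 = Complex xa (xa / 2)"
    by (rule D.graph_surj[OF g0, of xa]) (use xa(1) in auto)
  obtain t20 where t20: "t20 \<in> strand 2" "curve D t20 = Complex xa (xa / 2)"
    by (rule D.graph_surj[OF g2, of xa]) (use xa(1,2) in auto)
  obtain t12 where t12: "t12 \<in> strand 1" "curve D t12 = Complex xb (- xb / 2)"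
    by (rule D.graph_surj[OF g1, of xb]) (use xb(1) in auto)
  obtain t21 where t21: "t21 \<in> strand 2" "curve D t21 = Complex xb (- xb / 2)"
    by (rule D.graph_surj[OF g2, of xb]) (use xb(1,2) in auto)
  define th :: "nat \<Rightarrow> nat \<Rightarrow> real" where "th = (\<lambda>i j. if i = 0 then (if j = 1 then t01 else t02)
    else if i = 1 then (if j = 0 then t10 else t12) else (if j = 0 then t20 else t21))"
  have th: "th 0 1 = t01" "th 0 2 = t02" "th 1 0 = t10" "th 1 2 = t12" "th 2 0 = t20" "th 2 1 = t21"
    by (simp_all add: th_def)
  define s :: "nat \<Rightarrow> int" where "s = (\<lambda>i. if (if i = 0 then s0 else if i = 1 then s1 else s2) = 1 then 1 else - 1)"
  have sg: "s0 = 1 \<or> s0 = - 1" "s1 = 1 \<or> s1 = - 1" using s0 s1 by (simp_all add: D.heading_def)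
  have s_int: "s 0 = 1 \<and> s0 = 1 \<or> s 0 = - 1 \<and> s0 = - 1" "s 1 = 1 \<and> s1 = 1 \<or> s 1 = - 1 \<and> s1 = - 1"
     "s 2 = 1 \<and> s2 = 1 \<or> s 2 = - 1 \<and> s2 = - 1"
    using sg s2'(1) by (auto simp: s_def)
  hence ss: "real_of_int (s 0) = s0" "real_of_int (s 1) = s1" "real_of_int (s 2) = s2"
    by (elim disjE conjE; simp)+
  have inW: "?a 0 < t01" "t01 < ?b 0" "?a 1 < t10" "t10 < ?b 1" "?a 0 < t02" "t02 < ?b 0"
     "?a 2 < t20" "t20 < ?b 2" "?a 1 < t12" "t12 < ?b 1" "?a 2 < t21" "t21 < ?b 2"
    using in_open_window[OF t01(1) l(1)] in_open_window[OF t10(1) l(2)] in_open_window[OF t02(1) l(1)]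
      in_open_window[OF t20(1) l(3)] in_open_window[OF t12(1) l(2)] in_open_window[OF t21(1) l(3)]
      t01(2) t10(2) t02(2) t20(2) t12(2) t21(2) xa1 xb1 by auto
  have g0': "traces_graph D (strand 0) (\<lambda>x. 1 / 2 * x)" and g1': "traces_graph D (strand 1) (\<lambda>x. - 1 / 2 * x)"
    using g0 g1 by simp_all
  have v0: "Im (velocity D t) = Re (velocity D t) / 2" "s0 * Re (velocity D t) \<ge> 0" if "?a 0 < t" "t < ?b 0" for t
    using D.line_velocity[OF g0' that] D.heading_velocity[OF s0 that] by simp_all
  have v1: "Im (velocity D t) = - Re (velocity D t) / 2" "s1 * Re (velocity D t) \<ge> 0" if "?a 1 < t" "t < ?b 1" for t
    using D.line_velocity[OF g1' that] D.heading_velocity[OF s1 that] by simp_all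
  \<comment> \<open>The strand starts at abscissa \<open>- s2\<close>, where \<open>s2 * ?q\<close>
    equals \<open>s2 * h (- s2) + 1 / 2 > 0\<close>, and the crossing is its only zero. The same
    holds for \<open>- s2 * ?p\<close> below.\<close>
  have v20: "s2 * (Im (velocity D t20) - Re (velocity D t20) / 2) \<le> 0"
  proof (rule deriv_first_zero[where k = "\<lambda>t. s2 * ?q t" and k' = "\<lambda>t. s2 * (Im (velocity D t) - Re (velocity D t) / 2)"])
    show "((\<lambda>t. s2 * ?q t) has_real_derivative s2 * (Im (velocity D t) - Re (velocity D t) / 2)) (at t)" for t
      by (rule DERIV_cmult[OF qd])
    show "s2 * ?q (?a 2) > 0" using pt[OF ab2(1)] s2' h1 by auto
    show "?a 2 < t20" by (rule inW)
    show "s2 * ?q t20 = 0" using t20 by simp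
    show "s2 * ?q r \<noteq> 0" if "?a 2 \<le> r" "r < t20" for r
    proof
      assume "s2 * ?q r = 0"
      moreover have r: "r \<in> strand 2" using that t20(1) by auto
      ultimately have "?r r = ?r t20" using qz[of r] s2'(1) t20(2) by auto
      thus False using D.graph_Re_inj[OF g2 r t20(1)] that(2) by simp
    qed
  qed
  have v21: "s2 * (Im (velocity D t21) + Re (velocity D t21) / 2) \<ge> 0"
  proof -
    have "- s2 * (Im (velocity D t21) + Re (velocity D t21) / 2) \<le> 0"
    proof (rule deriv_first_zero[where k = "\<lambda>t. - s2 * ?p t" and k' = "\<lambda>t. - s2 * (Im (velocity D t) + Re (velocity D t) / 2)"])
      show "((\<lambda>t. - s2 * ?p t) has_real_derivative - s2 * (Im (velocity D t) + Re (velocity D t) / 2)) (at t)" for t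
        by (rule DERIV_cmult[OF pd])
      show "- s2 * ?p (?a 2) > 0" using pt[OF ab2(1)] s2' h1 by auto
      show "?a 2 < t21" by (rule inW)
      show "- s2 * ?p t21 = 0" using t21 by simp
      show "- s2 * ?p r \<noteq> 0" if "?a 2 \<le> r" "r < t21" for r
      proof
        assume "- s2 * ?p r = 0"
        moreover have r: "r \<in> strand 2" using that t21(1) by auto
        ultimately have "?r r = ?r t21" using pz[of r] s2'(1) t21(2) by auto
        thus False using D.graph_Re_inj[OF g2 r t21(1)] that(2) by simp
      qed
    qed
    thus ?thesis by simp
  qed
  have cr: "crossing D t01 t10" "crossing D t02 t20" "crossing D t12 t21"
    using strand_crossing(1)[OF l(1,2), of t01 t10] strand_crossing(1)[OF l(1,3), of t02 t20]
      strand_crossing(1)[OF l(2,3), of t12 t21] t01 t10 t02 t20 t12 t21 by simp_all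
  have v: "of_int (s 0) * Re (velocity D t01) \<ge> 0" "of_int (s 0) * Re (velocity D t02) \<ge> 0"
      "of_int (- s 1) * (- Re (velocity D t10)) \<ge> 0" "of_int (s 1) * Re (velocity D t12) \<ge> 0"
      "of_int (- s 2) * (Im (velocity D t20) - Re (velocity D t20) / 2) \<ge> 0"
      "of_int (s 2) * (Im (velocity D t21) + Re (velocity D t21) / 2) \<ge> 0"
    using v0(2)[OF inW(1,2)] v0(2)[OF inW(5,6)] v1(2)[OF inW(3,4)] v1(2)[OF inW(9,10)] v20 v21 by (simp_all add: ss del: One_nat_def)
  have sv: "s 0 = 1 \<or> s 0 = - 1" "s 1 = 1 \<or> s 1 = - 1" "s 2 = 1 \<or> s 2 = - 1"
      "- s 1 = 1 \<or> - s 1 = - 1" "- s 2 = 1 \<or> - s 2 = - 1"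
    using s_int by auto
  \<comment> \<open>On a line the cross product factors into the horizontal velocity along it and
    the rate at which the other strand changes its height above it.\<close>
  have "cross_prod (velocity D t01) (velocity D t10) = Re (velocity D t01) * (- Re (velocity D t10))"
    unfolding cross_prod_def v0(1)[OF inW(1,2)] v1(1)[OF inW(3,4)] by simp
  hence T1: "turn D t01 t10 = s 0 * (- s 1)"
    by (rule turn_eqI[OF _ D.cross_prod_nonzero[OF cr(1)] sv(1,4) v(1,3)])
  have "cross_prod (velocity D t02) (velocity D t20) = Re (velocity D t02) * (Im (velocity D t20) - Re (velocity D t20) / 2)"
    unfolding cross_prod_def v0(1)[OF inW(5,6)] by (simp add: algebra_simps)
  hence T2: "turn D t02 t20 = s 0 * (- s 2)"
    by (rule turn_eqI[OF _ D.cross_prod_nonzero[OF cr(2)] sv(1,5) v(2,5)])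
  have "cross_prod (velocity D t12) (velocity D t21) = Re (velocity D t12) * (Im (velocity D t21) + Re (velocity D t21) / 2)"
    unfolding cross_prod_def v1(1)[OF inW(9,10)] by (simp add: algebra_simps)
  hence T3: "turn D t12 t21 = s 1 * s 2"
    by (rule turn_eqI[OF _ D.cross_prod_nonzero[OF cr(3)] sv(2,3) v(4,6)])
  have order: "t < u \<longleftrightarrow> \<sigma> * ?r t < \<sigma> * ?r u" if "D.heading a b \<sigma>" "t \<in> {a..b}" "u \<in> {a..b}" for t u a b \<sigma>
  proof -
    have "t < u \<longrightarrow> \<sigma> * ?r t < \<sigma> * ?r u" "u < t \<longrightarrow> \<sigma> * ?r u < \<sigma> * ?r t"
      using that by (simp_all add: D.heading_def)
    thus ?thesis by (cases t u rule: linorder_cases) auto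
  qed
  have ne: "xa \<noteq> 0" "xb \<noteq> 0" "xa \<noteq> xb" using xa_sgn xb_sgn by auto
  have dist: "t01 \<noteq> t02" "t10 \<noteq> t12" "t20 \<noteq> t21"
  proof -
    have "?r t01 \<noteq> ?r t02" "?r t10 \<noteq> ?r t12" "?r t20 \<noteq> ?r t21"
      using ne t01(2) t02(2) t10(2) t12(2) t20(2) t21(2) by simp_all
    thus "t01 \<noteq> t02" "t10 \<noteq> t12" "t20 \<noteq> t21" by blast+
  qed
  have e_int: "e = 1 \<and> xa > 0 \<and> xb < 0 \<or> e = - 1 \<and> xa < 0 \<and> xb > 0"
    using e(1) xa_sgn xb_sgn by (auto simp: e'_def)
  \<comment> \<open>Up to the heading, order in time is order of abscissas: 0 and \<open>xa\<close>
    on strand 0, 0 and \<open>xb\<close> on strand 1, \<open>xa\<close> and \<open>xb\<close> on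
    strand 2.\<close>
  have O: "t01 < t02 \<longleftrightarrow> s 0 = e" "t10 < t12 \<longleftrightarrow> s 1 = - e" "t20 < t21 \<longleftrightarrow> s 2 = - e"
  proof -
    have "t01 < t02 \<longleftrightarrow> 0 < s0 * xa" "t10 < t12 \<longleftrightarrow> 0 < s1 * xb" "t20 < t21 \<longleftrightarrow> s2 * xa < s2 * xb"
      using order[OF s0 t01(1) t02(1)] order[OF s1 t10(1) t12(1)] order[OF s2 t20(1) t21(1)]
        t01(2) t02(2) t10(2) t12(2) t20(2) t21(2) by simp_all
    thus "t01 < t02 \<longleftrightarrow> s 0 = e" "t10 < t12 \<longleftrightarrow> s 1 = - e" "t20 < t21 \<longleftrightarrow> s 2 = - e"
      using s_int e_int by (elim disjE conjE; simp)+
  qed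
  have lt3: "i = 0 \<or> i = 1 \<or> i = 2" if "i < 3" for i :: nat using that by auto
  have uniq: "p = th i j" if "i < 3" "j < 3" "p \<in> strand i" "q \<in> strand j" "i \<noteq> j" "curve D p = curve D q" for i j p q
  proof -
    note H = that
    have c0: "?m t = ?r t / 2" if "t \<in> strand 0" for t using D.graph_point[OF g0 that] by simp
    have c1: "?m t = - ?r t / 2" if "t \<in> strand 1" for t using D.graph_point[OF g1 that] by simp
    have I0: "t = u" if "t \<in> strand 0" "u \<in> strand 0" "?r t = ?r u" for t u using D.graph_Re_inj[OF g0 that] .
    have I1: "t = u" if "t \<in> strand 1" "u \<in> strand 1" "?r t = ?r u" for t u using D.graph_Re_inj[OF g1 that] .
    have I2: "t = u" if "t \<in> strand 2" "u \<in> strand 2" "?r t = ?r u" for t u using D.graph_Re_inj[OF g2 that] .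
    consider "i = 0" "j = 1" | "i = 1" "j = 0" | "i = 0" "j = 2" | "i = 2" "j = 0" | "i = 1" "j = 2" | "i = 2" "j = 1"
      using lt3[OF H(1)] lt3[OF H(2)] H(5) by auto
    thus ?thesis
    proof cases
      case 1
      hence "?r p = 0" using c0[of p] c1[of q] H by simp
      thus ?thesis using I0[of p t01] t01 H 1 th by simp
    next
      case 2
      hence "?r p = 0" using c1[of p] c0[of q] H by simp
      thus ?thesis using I1[of p t10] t10 H 2 th by simp
    next
      case 3
      hence "?r q = xa" using c0[of p] qz[of q] H by simp
      thus ?thesis using I0[of p t02] t02 H 3 th by simp
    next
      case 4
      hence "?r p = xa" using c0[of q] qz[of p] H by simp
      thus ?thesis using I2[of p t20] t20 H 4 th by simp
    next
      case 5
      hence "?r q = xb" using c1[of p] pz[of q] H by simp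
      thus ?thesis using I1[of p t12] t12 H 5 th by simp
    next
      case 6
      hence "?r p = xb" using c1[of q] pz[of p] H by simp
      thus ?thesis using I2[of p t21] t21 H 6 th by simp
    qed
  qed
  have "triangle_config D S s e th"
    unfolding triangle_config_def
  proof (intro conjI allI ballI impI)
    fix i :: nat assume "i < 3"
    thus "s i = 1 \<or> s i = - 1" by (simp add: s_def)
    show "Re (curve D (?a i)) = - of_int (s i)"
      using lt3[OF \<open>i < 3\<close>] s0 s1 s2 ss by (auto simp: D.heading_def)
    show "inj_on (curve D) (strand i)"
      using lt3[OF \<open>i < 3\<close>] g0 g1 g2 by (auto simp: traces_graph_def)
  next
    fix i j :: nat assume ij: "i < 3" "j < 3" "i \<noteq> j"
    show "th i j \<in> strand i" using lt3[OF ij(1)] lt3[OF ij(2)] ij(3) t01(1) t02(1) t10(1) t12(1) t20(1) t21(1)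
      by (elim disjE; simp only: th; simp)
    show "curve D (th i j) = curve D (th j i)"
      using lt3[OF ij(1)] lt3[OF ij(2)] ij(3) t01(2) t02(2) t10(2) t12(2) t20(2) t21(2)
      by (elim disjE; simp only: th; simp)
  next
    fix i j p q assume "i < 3" "j < 3" "p \<in> strand i" "q \<in> strand j" "i \<noteq> j" "curve D p = curve D q"
    thus "p = th i j" by (rule uniq)
  qed (use T1 T2 T3 dist O th in simp_all)
  thus ?thesis by blast
qed

end

lemma
  assumes "triangle_config D S s e th"
  shows triangle_unique: "\<And>i j p q. i < 3 \<Longrightarrow> j < 3 \<Longrightarrow> p \<in> strand_times S i \<Longrightarrow> q \<in> strand_times S j \<Longrightarrow>
      i \<noteq> j \<Longrightarrow> curve D p = curve D q \<Longrightarrow> p = th i j"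
    and triangle_meet: "\<And>i j. i < 3 \<Longrightarrow> j < 3 \<Longrightarrow> i \<noteq> j \<Longrightarrow>
      th i j \<in> strand_times S i \<and> curve D (th i j) = curve D (th j i)"
    and triangle_inj: "\<And>i. i < 3 \<Longrightarrow> inj_on (curve D) (strand_times S i)"
proof -
  have *: "\<forall>i<3. \<forall>j<3. \<forall>p\<in>strand_times S i. \<forall>q\<in>strand_times S j. i \<noteq> j \<longrightarrow> curve D p = curve D q \<longrightarrow> p = th i j"
    "\<forall>i<3. \<forall>j<3. i \<noteq> j \<longrightarrow> th i j \<in> strand_times S i \<and> curve D (th i j) = curve D (th j i)"
    "\<forall>i<3. inj_on (curve D) (strand_times S i)"
    by (insert assms, unfold triangle_config_def) (elim conjE, assumption)+
  show "p = th i j" if "i < 3" "j < 3" "p \<in> strand_times S i" "q \<in> strand_times S j" "i \<noteq> j" "curve D p = curve D q"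
    for i j p q using *(1) that by blast
  show "th i j \<in> strand_times S i \<and> curve D (th i j) = curve D (th j i)" if "i < 3" "j < 3" "i \<noteq> j" for i j
    using *(2) that by blast
  show "inj_on (curve D) (strand_times S i)" if "i < 3" for i using *(3) that by blast
qed

section \<open>Matching the passages of two diagrams\<close>

context local_change_diagrams
begin

text \<open>The order-preserving bijection between the passages of two diagrams with equally many.\<close>

definition shift :: "real \<Rightarrow> real" where
  "shift p = passages D' ! passage_rank D p"

lemma strand_start_outside_strands:
  assumes i: "i < length S" and j: "j < length S"
  shows "fst (S ! i) \<le> fst (S ! j) \<or> snd (S ! j) < fst (S ! i)"
proof (cases "i = j")
  case False
  thus ?thesis using strand_disjoint[OF i j] strand_bounds(2)[OF i] by (auto simp: disjoint_iff)
qed simp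

lemma rank_first_passage:
  assumes i: "i < length S" and p: "p \<in> strand i" "\<And>q. q \<in> passage_set D \<inter> strand i \<Longrightarrow> p \<le> q"
  shows "passage_rank D p = passage_rank D (fst (S ! i))"
proof -
  have "r < fst (S ! i)" if "r \<in> passage_set D" "r < p" for r
    using p(1) p(2)[of r] that by (auto simp: not_le[symmetric])
  hence "passage_set D \<inter> {..<p} = passage_set D \<inter> {..<fst (S ! i)}" using p(1) by force
  thus ?thesis by (simp add: passage_rank_def)
qed

context
  assumes cards: "\<forall>i<length S. card (passage_set D' \<inter> strand i) = card (passage_set D \<inter> strand i)"
begin

lemma rank_eq:
  assumes "\<And>j. j < length S \<Longrightarrow> t \<le> fst (S ! j) \<or> snd (S ! j) < t"
  shows "passage_rank D' t = passage_rank D t"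
  using rank_before_strands[OF assms] local_change_diagrams.rank_before_strands[OF local_change_sym assms]
  by (simp add: passage_set_outside cards)

text \<open>The time 1 lies outside the window and after all passages, so its rank counts them
  all.\<close>

lemma n_pass_eq: "card (passage_set D') = card (passage_set D)"
proof -
  have "passage_set D \<inter> {..<1} = passage_set D" "passage_set D' \<inter> {..<1} = passage_set D'"
    by (auto simp: passage_set_def)
  moreover have "1 \<notin> W" using W_bounds[of 1] by auto
  hence "passage_rank D' 1 = passage_rank D 1" using rank_eq outside_strands by blast
  ultimately show ?thesis by (simp add: passage_rank_def)
qed

lemma rank_less: "p \<in> passage_set D \<Longrightarrow> passage_rank D p < card (passage_set D)"
  unfolding passage_rank_def by (rule psubset_card_mono[OF D.finite_passage_set]) auto

lemma rank_mono: "p \<in> passage_set D \<Longrightarrow> p < q \<Longrightarrow> passage_rank D p < passage_rank D q"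
  unfolding passage_rank_def using D.finite_passage_set by (intro psubset_card_mono) auto

lemma shift_in: "p \<in> passage_set D \<Longrightarrow> shift p \<in> passage_set D'"
  unfolding shift_def using D'.passages_in rank_less n_pass_eq by simp

lemma shift_mono: "p \<in> passage_set D \<Longrightarrow> q \<in> passage_set D \<Longrightarrow> p < q \<Longrightarrow> shift p < shift q"
  unfolding shift_def using D'.passages_mono rank_mono rank_less n_pass_eq by simp

lemma rank_shift: "p \<in> passage_set D \<Longrightarrow> passage_rank D' (shift p) = passage_rank D p"
  unfolding shift_def using D'.passage_rank_passages rank_less n_pass_eq by simp

lemma shift_eqI: "p' \<in> passage_set D' \<Longrightarrow> passage_rank D' p' = passage_rank D p \<Longrightarrow> shift p = p'"
  unfolding shift_def by (metis D'.passages_index D'.passage_rank_passages)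

lemma shift_bij: "bij_betw shift (passage_set D) (passage_set D')"
proof -
  have "inj_on shift (passage_set D)"
    by (rule inj_onI) (metis linorder_neqE order_less_irrefl shift_mono)
  moreover from this have "shift ` passage_set D = passage_set D'"
    using D'.finite_passage_set n_pass_eq shift_in by (intro card_subset_eq) (auto simp: card_image)
  ultimately show ?thesis by (simp add: bij_betw_def)
qed

lemma shift_outside: "p \<in> passage_set D - W \<Longrightarrow> shift p = p"
  using passage_set_outside rank_eq[of p] outside_strands[of p] by (intro shift_eqI) auto

lemma shift_first:
  assumes i: "i < length S" and p: "p \<in> passage_set D \<inter> strand i" "\<And>q. q \<in> passage_set D \<inter> strand i \<Longrightarrow> p \<le> q"
    and p': "p' \<in> passage_set D' \<inter> strand i" "\<And>q. q \<in> passage_set D' \<inter> strand i \<Longrightarrow> p' \<le> q"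
  shows "shift p = p'"
proof (rule shift_eqI)
  show "passage_rank D' p' = passage_rank D p"
    using rank_first_passage[OF i _ p(2)] local_change_diagrams.rank_first_passage[OF local_change_sym i _ p'(2)]
      rank_eq[of "fst (S ! i)"] strand_start_outside_strands[OF i] p(1) p'(1) by simp
qed (use p' in simp)

lemma shift_second:
  assumes i: "i < length S" and P: "passage_set D \<inter> strand i = {p, q}" "p < q"
    and P': "passage_set D' \<inter> strand i = {p', q'}" "p' < q'"
  shows "shift p = p'" "shift q = q'"
proof -
  show p: "shift p = p'" by (rule shift_first[OF i]) (use P P' in auto)
  have "p \<in> passage_set D" "q' \<in> passage_set D'" using P P' by auto
  thus "shift q = q'"
    using passage_rank_strand[OF P i] local_change_diagrams.passage_rank_strand[OF local_change_sym P' i]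
      rank_shift[of p] p by (intro shift_eqI) simp_all
qed

lemma cyc_next_shift: "p \<in> passage_set D \<Longrightarrow> cyc_next (passage_set D') (shift p) = shift (cyc_next (passage_set D) p)"
  by (rule cyc_next_mono[OF D.finite_passage_set shift_bij]) (simp_all add: shift_mono)

lemma weight_outside': "p \<in> passage_set D - W \<Longrightarrow> weight D' p = weight D p"
  by (rule weight_outside) (simp_all add: cards)

end

section \<open>Passages of the triangle\<close>

lemma strand_index_unique: "i < length S \<Longrightarrow> j < length S \<Longrightarrow> p \<in> strand i \<Longrightarrow> p \<in> strand j \<Longrightarrow> i = j"
  using strand_disjoint by blast

lemma triangle_crossing:
  assumes tr: "triangle_config D S s e th" and len: "length S = 3" and ij: "i < 3" "j < 3" "i \<noteq> j"
  shows "th i j \<in> strand i" "crossing D (th i j) (th j i)" "partner D (th i j) = th j i" "0 \<le> th i j" "th i j < 1"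
proof -
  have th: "th i j \<in> strand i" "th j i \<in> strand j" "curve D (th i j) = curve D (th j i)"
    using triangle_meet[OF tr ij] triangle_meet[OF tr ij(2,1)] ij(3) by auto
  show "th i j \<in> strand i" by (rule th)
  show "crossing D (th i j) (th j i)" "partner D (th i j) = th j i"
    using strand_crossing[OF _ _ th(1,2) ij(3) th(3)] ij len by simp_all
  show "0 \<le> th i j" "th i j < 1" using strand_times_bounds[OF _ th(1)] ij len by auto
qed

lemma triangle_passage:
  assumes tr: "triangle_config D S s e th" and len: "length S = 3" and p: "p \<in> passage_set D \<inter> W"
  obtains i j where "i < 3" "j < 3" "i \<noteq> j" "p = th i j"
proof -
  have "inj_on (curve D) (strand i)" if "i < length S" for i using triangle_inj[OF tr] that len by simp
  then obtain i j where ij: "i < length S" "j < length S" "i \<noteq> j" "p \<in> strand i"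
      "partner D p \<in> strand j" "curve D p = curve D (partner D p)" by (rule passage_in_window[OF p])
  hence "p = th i j" using triangle_unique[OF tr] len by simp
  thus ?thesis using that ij len by simp
qed

lemma triangle_layers:
  assumes tr: "triangle_config D S s e th" and len: "length S = 3"
  shows "layers D S = {(i, j). i < 3 \<and> j < 3 \<and> i \<noteq> j \<and> th i j \<in> overs D}"
proof (intro equalityI subsetI; clarify)
  fix i j assume "(i, j) \<in> layers D S"
  then obtain t u where tu: "i < 3" "j < 3" "t \<in> strand i" "u \<in> strand j" "crossing D t u" "t \<in> overs D"
    using len unfolding layers_def by auto
  have "i \<noteq> j"
  proof
    assume "i = j"
    hence "t = u" using triangle_inj[OF tr tu(1)] tu by (auto simp: crossing_def inj_on_def)
    thus False using tu(5) by (simp add: crossing_def)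
  qed
  moreover from this have "t = th i j"
    using triangle_unique[OF tr tu(1-4)] tu(5) by (simp add: crossing_def)
  ultimately show "i < 3 \<and> j < 3 \<and> i \<noteq> j \<and> th i j \<in> overs D" using tu by blast
next
  fix i j assume "i < (3::nat)" "j < (3::nat)" "i \<noteq> j" "th i j \<in> overs D"
  moreover from this have "th i j \<in> strand i" "th j i \<in> strand j" "crossing D (th i j) (th j i)"
    using triangle_crossing(1,2)[OF tr len, of i j] triangle_crossing(1)[OF tr len, of j i] by simp_all
  ultimately have "i < 3 \<and> j < 3 \<and> (\<exists>t\<in>strand i. \<exists>u\<in>strand j. crossing D t u \<and> t \<in> overs D)" by blast
  thus "(i, j) \<in> layers D S" unfolding layers_def len mem_Collect_eq prod.case .
qed

lemma triangle_passage_iff: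
  assumes tr: "triangle_config D S s e th" and len: "length S = 3" and ij: "i < 3" "j < 3" "i \<noteq> j"
  shows "th i j \<in> passage_set D \<longleftrightarrow> (i, j) \<in> layers D S \<or> (j, i) \<in> layers D S"
proof -
  note t = triangle_crossing[OF tr len ij]
  have "th i j \<in> unders D \<longleftrightarrow> th j i \<in> overs D" using D.unders_iff_overs[OF t(2)] .
  thus ?thesis using t(4,5) ij by (auto simp: triangle_layers[OF tr len] passage_set_def)
qed

lemma triangle_strand_passages:
  assumes tr: "triangle_config D S s e th" and len: "length S = 3" and i: "i < 3"
  shows "passage_set D \<inter> strand i = {th i j |j. j < 3 \<and> j \<noteq> i \<and> ((i, j) \<in> layers D S \<or> (j, i) \<in> layers D S)}"
proof (intro equalityI subsetI)
  fix p assume p: "p \<in> passage_set D \<inter> strand i"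
  hence pW: "p \<in> passage_set D \<inter> W" using strand_subset_W[of i] i len by auto
  obtain i' j where ij: "i' < 3" "j < 3" "i' \<noteq> j" "p = th i' j" by (rule triangle_passage[OF tr len pW])
  have "p \<in> strand i'" using triangle_crossing(1)[OF tr len ij(1-3)] ij(4) by simp
  hence "i' = i" using strand_index_unique[of i' i p] p ij(1) i len by simp
  thus "p \<in> {th i j |j. j < 3 \<and> j \<noteq> i \<and> ((i, j) \<in> layers D S \<or> (j, i) \<in> layers D S)}"
    using triangle_passage_iff[OF tr len ij(1-3)] p ij by auto
next
  fix p assume "p \<in> {th i j |j. j < 3 \<and> j \<noteq> i \<and> ((i, j) \<in> layers D S \<or> (j, i) \<in> layers D S)}"
  then obtain j where "j < 3" "j \<noteq> i" "(i, j) \<in> layers D S \<or> (j, i) \<in> layers D S" "p = th i j" by blast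
  thus "p \<in> passage_set D \<inter> strand i"
    using triangle_passage_iff[OF tr len i, of j] triangle_crossing(1)[OF tr len i, of j] by auto
qed

lemma triangle_turn:
  assumes tr: "triangle_config D S s e th" and len: "length S = 3"
  shows "turn D (th 0 1) (th 1 0) = - s 0 * s 1" "turn D (th 1 0) (th 0 1) = s 0 * s 1"
    "turn D (th 0 2) (th 2 0) = - s 0 * s 2" "turn D (th 2 0) (th 0 2) = s 0 * s 2"
    "turn D (th 1 2) (th 2 1) = s 1 * s 2" "turn D (th 2 1) (th 1 2) = - s 1 * s 2"
proof -
  show a: "turn D (th 0 1) (th 1 0) = - s 0 * s 1" "turn D (th 0 2) (th 2 0) = - s 0 * s 2"
    "turn D (th 1 2) (th 2 1) = s 1 * s 2"
    by (insert tr, unfold triangle_config_def) (elim conjE, assumption)+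
  show "turn D (th 1 0) (th 0 1) = s 0 * s 1" "turn D (th 2 0) (th 0 2) = s 0 * s 2"
    "turn D (th 2 1) (th 1 2) = - s 1 * s 2"
    using D.turn_neg[OF triangle_crossing(2)[OF tr len, of 0 1]] D.turn_neg[OF triangle_crossing(2)[OF tr len, of 0 2]]
      D.turn_neg[OF triangle_crossing(2)[OF tr len, of 1 2]] a by simp_all
qed

text \<open>Turns are products of two headings up to sign, and orders compare a heading with
  \<plusminus>\<open>e\<close>; so each labelling of the strands is a finite check. This is how the
  orders \<open>m\<close> and \<open>b\<close> come to determine two of the three signs in
  \<open>triangle_weights_passage_weight\<close>.\<close>

lemma triangle_turn_order:
  assumes tr: "triangle_config D S s e th" and e: "e = 1 \<or> e = - 1" and len: "length S = 3" and ijk: "i < 3" "j < 3" "k < 3" "distinct [i, j, k]"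
  shows "turn D (th i k) (th k i) = turn D (th j k) (th k j) \<longleftrightarrow> (th i j < th i k \<longleftrightarrow> th j i < th j k)"
proof -
  have *: "\<forall>i<3. (s i = 1 \<or> s i = - 1) \<and> Re (curve D (fst (S ! i))) = - of_int (s i)"
      "th 0 1 \<noteq> th 0 2" "th 1 0 \<noteq> th 1 2" "th 2 0 \<noteq> th 2 1"
      "th 0 1 < th 0 2 \<longleftrightarrow> s 0 = e" "th 1 0 < th 1 2 \<longleftrightarrow> s 1 = - e" "th 2 0 < th 2 1 \<longleftrightarrow> s 2 = - e"
    by (insert tr, unfold triangle_config_def) (elim conjE, assumption)+
  have s: "s 0 = 1 \<or> s 0 = - 1" "s 1 = 1 \<or> s 1 = - 1" "s 2 = 1 \<or> s 2 = - 1"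
    using *(1) by simp_all
  have o: "th 0 2 < th 0 1 \<longleftrightarrow> s 0 \<noteq> e" "th 1 2 < th 1 0 \<longleftrightarrow> s 1 \<noteq> - e" "th 2 1 < th 2 0 \<longleftrightarrow> s 2 \<noteq> - e"
    using *(2-7) by linarith+
  note o = o *(5-7)
  note T = triangle_turn[OF tr len]
  have "i = 0 \<or> i = 1 \<or> i = 2" "j = 0 \<or> j = 1 \<or> j = 2" "k = 0 \<or> k = 1 \<or> k = 2"
    using ijk by auto
  then consider "i = 0" "j = 1" "k = 2" | "i = 0" "j = 2" "k = 1" | "i = 1" "j = 0" "k = 2"
    | "i = 1" "j = 2" "k = 0" | "i = 2" "j = 0" "k = 1" | "i = 2" "j = 1" "k = 0"
    using ijk(4) by auto
  thus ?thesis
  proof cases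
    case 1
    show ?thesis unfolding 1 T o using s e by auto
  next
    case 2
    show ?thesis unfolding 2 T o using s e by auto
  next
    case 3
    show ?thesis unfolding 3 T o using s e by auto
  next
    case 4
    show ?thesis unfolding 4 T o using s e by auto
  next
    case 5
    show ?thesis unfolding 5 T o using s e by auto
  next
    case 6
    show ?thesis unfolding 6 T o using s e by auto
  qed
qed

text \<open>Transports the data of \<open>D'\<close> back along \<open>shift\<close>, so that only
  determinants over the passage times of \<open>D\<close> have to be compared.\<close>

lemma zpa_det_relabel:
  assumes cards: "\<forall>i<length S. card (passage_set D' \<inter> strand i) = card (passage_set D \<inter> strand i)"
    and ne: "passage_set D \<noteq> {}"
    and det: "alex_det (passage_set D) lam oth ov = alex_det (passage_set D) (weight D) (partner D) (\<lambda>p. p \<in> overs D)"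
    and lam: "\<And>p. p \<in> passage_set D \<Longrightarrow> weight D' (shift p) = lam p"
    and oth: "\<And>p. p \<in> passage_set D \<Longrightarrow> oth p \<in> passage_set D \<and> partner D' (shift p) = shift (oth p)"
    and ov: "\<And>p. p \<in> passage_set D \<Longrightarrow> shift p \<in> overs D' \<longleftrightarrow> ov p"
  shows "unit_equiv (zpa_det D') (zpa_det D)"
proof -
  note [simp] = cyc_next_shift[OF cards] shift_in[OF cards]
  have "alex_det (passage_set D') (weight D') (partner D') (\<lambda>p. p \<in> overs D') = alex_det (passage_set D) lam oth ov"
    by (rule alex_det_relabel[OF D.finite_passage_set shift_bij[OF cards]]) (use lam oth ov in simp_all)
  hence "unit_equiv (marked_det D' {}) (marked_det D {})"
    using det unit_equiv_refl marked_det_empty local_change_diagrams.marked_det_empty[OF local_change_sym] by simp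
  moreover have "passage_set D' \<noteq> {}"
  proof -
    obtain p where "p \<in> passage_set D" using ne by blast
    thus ?thesis using shift_in[OF cards, of p] by blast
  qed
  ultimately show ?thesis using ne by (intro zpa_det_transport[OF D D', of "{}" "{}"]) simp_all
qed

lemma relabel_outside:
  assumes cards: "\<forall>i<length S. card (passage_set D' \<inter> strand i) = card (passage_set D \<inter> strand i)"
    and p: "p \<in> passage_set D - W"
  shows "weight D' (shift p) = weight D p" "partner D' (shift p) = shift (partner D p)"
    "shift p \<in> overs D' \<longleftrightarrow> p \<in> overs D"
proof -
  have "partner D p \<in> passage_set D - W" using p partner_inside[of p] D.partner_in[of p] by simp
  thus "weight D' (shift p) = weight D p" "partner D' (shift p) = shift (partner D p)"
    "shift p \<in> overs D' \<longleftrightarrow> p \<in> overs D"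
    using p by (simp_all add: shift_outside[OF cards] weight_outside'[OF cards] partner_outside overs_outside)
qed

lemma triangle_inj_index:
  assumes tr: "triangle_config D S s e th" and len: "length S = 3" and ij: "i < 3" "j < 3" "k < 3" "i \<noteq> j" "i \<noteq> k" "th i j = th i k"
  shows "j = k"
proof -
  have "th j i = th k i"
    using triangle_crossing(3)[OF tr len ij(1,2,4)] triangle_crossing(3)[OF tr len ij(1,3,5)] ij(6) by simp
  moreover have "th j i \<in> strand j" "th k i \<in> strand k"
    using triangle_crossing(1)[OF tr len, of j i] triangle_crossing(1)[OF tr len, of k i] ij by auto
  ultimately show ?thesis using strand_index_unique[of j k "th j i"] ij(2,3) len by simp
qed

lemma triangle_card:
  assumes tr: "triangle_config D S s e th" and len: "length S = 3" and i: "i < 3"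
  shows "card (passage_set D \<inter> strand i) = card {j. j < 3 \<and> j \<noteq> i \<and> ((i, j) \<in> layers D S \<or> (j, i) \<in> layers D S)}"
proof -
  let ?J = "{j. j < 3 \<and> j \<noteq> i \<and> ((i, j) \<in> layers D S \<or> (j, i) \<in> layers D S)}"
  have "passage_set D \<inter> strand i = th i ` ?J"
    unfolding triangle_strand_passages[OF tr len i] by blast
  moreover have "inj_on (th i) ?J"
    by (rule inj_onI) (rule triangle_inj_index[OF tr len i], auto)
  ultimately show ?thesis by (simp add: card_image)
qed

text \<open>A heading is visible at the starting point of its strand, which the move keeps.\<close>

lemma triangle_heading_eq:
  assumes tr: "triangle_config D S s e th" and tr': "triangle_config D' S s' e' th'" and len: "length S = 3" and i: "i < 3"
  shows "s' i = s i"
proof -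
  have "\<forall>i<3. (s i = 1 \<or> s i = - 1) \<and> Re (curve D (fst (S ! i))) = - of_int (s i)"
    by (insert tr, unfold triangle_config_def) (elim conjE, assumption)
  hence "Re (curve D (fst (S ! i))) = - of_int (s i)" using i by blast
  moreover have "\<forall>i<3. (s' i = 1 \<or> s' i = - 1) \<and> Re (curve D' (fst (S ! i))) = - of_int (s' i)"
    by (insert tr', unfold triangle_config_def) (elim conjE, assumption)
  hence "Re (curve D' (fst (S ! i))) = - of_int (s' i)" using i by blast
  ultimately show ?thesis using strand_endpoints(1)[of i] i len by simp
qed

lemma index_cases:
  fixes i j :: nat
  assumes "i < 3" "j < 3" "i \<noteq> j"
  obtains "i = 0" "j = 1" | "i = 1" "j = 0" | "i = 0" "j = 2" | "i = 2" "j = 0" | "i = 1" "j = 2" | "i = 2" "j = 1"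
proof -
  have "i = 0 \<or> i = 1 \<or> i = 2" "j = 0 \<or> j = 1 \<or> j = 2" using assms by auto
  thus ?thesis using that assms(3) by auto
qed

text \<open>Turns depend on the headings alone, not on the side \<open>e\<close> on which the third
  strand passes.\<close>

lemma triangle_turn_eq:
  assumes tr: "triangle_config D S s e th" and tr': "triangle_config D' S s' e' th'" and len: "length S = 3"
    and ij: "i < 3" "j < 3" "i \<noteq> j"
  shows "turn D' (th' i j) (th' j i) = turn D (th i j) (th j i)"
proof -
  note T = triangle_turn[OF tr len] and T' = local_change_diagrams.triangle_turn[OF local_change_sym tr' len]
  have s: "s' 0 = s 0" "s' 1 = s 1" "s' 2 = s 2" using triangle_heading_eq[OF tr tr' len] by simp_all
  show ?thesis
    by (rule index_cases[OF ij]; simp only: T T' s)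
qed

text \<open>The order of the two crossings on each strand compares its heading with
  \<plusminus>\<open>e\<close>, so changing the sign of \<open>e\<close> reverses it on all three
  strands.\<close>

lemma triangle_order_flip:
  assumes tr: "triangle_config D S s e th" and tr': "triangle_config D' S s' (- e) th'" and e: "e = 1 \<or> e = - 1" and len: "length S = 3"
    and ijk: "i < 3" "j < 3" "k < 3" "distinct [i, j, k]"
  shows "th' i k < th' i j \<longleftrightarrow> th i j < th i k"
proof -
  have *: "\<forall>i<3. (s i = 1 \<or> s i = - 1) \<and> Re (curve D (fst (S ! i))) = - of_int (s i)"
      "th 0 1 \<noteq> th 0 2" "th 1 0 \<noteq> th 1 2" "th 2 0 \<noteq> th 2 1"
      "th 0 1 < th 0 2 \<longleftrightarrow> s 0 = e" "th 1 0 < th 1 2 \<longleftrightarrow> s 1 = - e" "th 2 0 < th 2 1 \<longleftrightarrow> s 2 = - e"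
    by (insert tr, unfold triangle_config_def) (elim conjE, assumption)+
  have **: "th' 0 1 \<noteq> th' 0 2" "th' 1 0 \<noteq> th' 1 2" "th' 2 0 \<noteq> th' 2 1"
      "th' 0 1 < th' 0 2 \<longleftrightarrow> s' 0 = - e" "th' 1 0 < th' 1 2 \<longleftrightarrow> s' 1 = - (- e)" "th' 2 0 < th' 2 1 \<longleftrightarrow> s' 2 = - (- e)"
    by (insert tr', unfold triangle_config_def) (elim conjE, assumption)+
  have s: "s 0 = 1 \<or> s 0 = - 1" "s 1 = 1 \<or> s 1 = - 1" "s 2 = 1 \<or> s 2 = - 1" using *(1) by simp_all
  have s': "s' 0 = s 0" "s' 1 = s 1" "s' 2 = s 2" using triangle_heading_eq[OF tr tr' len] by simp_all
  have a: "th' 0 2 < th' 0 1 \<longleftrightarrow> s' 0 \<noteq> - e" "th' 1 2 < th' 1 0 \<longleftrightarrow> s' 1 \<noteq> - (- e)" "th' 2 1 < th' 2 0 \<longleftrightarrow> s' 2 \<noteq> - (- e)"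
    using ** by linarith+
  have F: "th' 0 2 < th' 0 1 \<longleftrightarrow> th 0 1 < th 0 2" "th' 1 2 < th' 1 0 \<longleftrightarrow> th 1 0 < th 1 2" "th' 2 1 < th' 2 0 \<longleftrightarrow> th 2 0 < th 2 1"
    unfolding a *(5-7) s' using s e by auto
  have G: "th' 0 1 < th' 0 2 \<longleftrightarrow> th 0 2 < th 0 1" "th' 1 0 < th' 1 2 \<longleftrightarrow> th 1 2 < th 1 0" "th' 2 0 < th' 2 1 \<longleftrightarrow> th 2 1 < th 2 0"
    using F *(2-4) **(1-3) by linarith+
  have jk: "j \<noteq> i" "k \<noteq> i" "k \<noteq> j" "i \<noteq> j" using ijk by auto
  show ?thesis
  proof (rule index_cases[OF ijk(1,2) jk(4)])
    assume "i = 0" "j = 1" hence "k = 2" using ijk jk by linarith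
    thus ?thesis using F \<open>i = 0\<close> \<open>j = 1\<close> by simp
  next
    assume "i = 1" "j = 0" hence "k = 2" using ijk jk by linarith
    thus ?thesis using F \<open>i = 1\<close> \<open>j = 0\<close> by simp
  next
    assume "i = 0" "j = 2" hence "k = 1" using ijk jk by linarith
    thus ?thesis using G \<open>i = 0\<close> \<open>j = 2\<close> by simp
  next
    assume "i = 2" "j = 0" hence "k = 1" using ijk jk by linarith
    thus ?thesis using F \<open>i = 2\<close> \<open>j = 0\<close> by simp
  next
    assume "i = 1" "j = 2" hence "k = 0" using ijk jk by linarith
    thus ?thesis using G \<open>i = 1\<close> \<open>j = 2\<close> by simp
  next
    assume "i = 2" "j = 1" hence "k = 0" using ijk jk by linarith
    thus ?thesis using G \<open>i = 2\<close> \<open>j = 1\<close> by simp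
  qed
qed

lemma move_III_mixed:
  assumes tr: "triangle_config D S s e th" and tr': "triangle_config D' S s' e' th'" and len: "length S = 3"
    and lay: "layers D S = {(i, j)}" and lay': "layers D' S = {(i, j)}"
  shows "unit_equiv (zpa_det D') (zpa_det D)"
proof -
  interpret sym: local_change_diagrams D' D S by (rule local_change_sym)
  have ij: "i < 3" "j < 3" "i \<noteq> j" "th i j \<in> overs D" using lay triangle_layers[OF tr len] by auto
  have o': "th' i j \<in> overs D'" using lay' sym.triangle_layers[OF tr' len] by auto
  have cards: "\<forall>a<length S. card (passage_set D' \<inter> strand a) = card (passage_set D \<inter> strand a)"
    using triangle_card[OF tr len] sym.triangle_card[OF tr' len] lay lay' len by simp
  have X: "passage_set D \<inter> strand i = {th i j}" "passage_set D \<inter> strand j = {th j i}"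
    using triangle_strand_passages[OF tr len ij(1)] triangle_strand_passages[OF tr len ij(2)] ij lay by auto
  have X': "passage_set D' \<inter> strand i = {th' i j}" "passage_set D' \<inter> strand j = {th' j i}"
    using sym.triangle_strand_passages[OF tr' len ij(1)] sym.triangle_strand_passages[OF tr' len ij(2)] ij lay' by auto
  have sh: "shift (th i j) = th' i j" "shift (th j i) = th' j i"
    by (rule shift_first[OF cards, of i]; use X X' ij len in simp)
       (rule shift_first[OF cards, of j]; use X X' ij len in simp)
  have P: "th i j \<in> passage_set D" "th j i \<in> passage_set D" using X by auto
  note c = triangle_crossing[OF tr len ij(1-3)] and d = triangle_crossing[OF tr len ij(2,1) ij(3)[symmetric]]
  note c' = sym.triangle_crossing[OF tr' len ij(1-3)] and d' = sym.triangle_crossing[OF tr' len ij(2,1) ij(3)[symmetric]]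
  have r: "passage_rank D' (th' i j) = passage_rank D (th i j)" "passage_rank D' (th' j i) = passage_rank D (th j i)"
    using rank_shift[OF cards P(1)] rank_shift[OF cards P(2)] sh by simp_all
  have ov: "th j i \<notin> overs D" "th' j i \<notin> overs D'"
    using D.partner_overs[OF P(1)] D'.partner_overs[of "th' i j"] X' c c' ij(4) o' by auto
  have w: "weight D' (th' i j) = weight D (th i j)" "weight D' (th' j i) = weight D (th j i)"
    using r ij(4) o' ov triangle_turn_eq[OF tr tr' len ij(1-3)] triangle_turn_eq[OF tr tr' len ij(2,1) ij(3)[symmetric]]
    by (simp_all add: weight_def is_even_def c d c' d')
  have inside: "p = th i j \<or> p = th j i" if p: "p \<in> passage_set D \<inter> W" for p
  proof -
    obtain a b where ab: "a < 3" "b < 3" "a \<noteq> b" "p = th a b" by (rule triangle_passage[OF tr len p])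
    thus ?thesis using triangle_passage_iff[OF tr len ab(1-3)] p lay by auto
  qed
  show ?thesis
  proof (rule zpa_det_relabel[OF cards _ refl])
    show "passage_set D \<noteq> {}" using P by auto
    fix p assume p: "p \<in> passage_set D"
    consider "p \<in> passage_set D - W" | "p = th i j" | "p = th j i" using p inside by blast
    note cs = this
    show "weight D' (shift p) = weight D p"
      using cs by cases (simp_all add: relabel_outside[OF cards] sh w)
    show "partner D p \<in> passage_set D \<and> partner D' (shift p) = shift (partner D p)"
      using cs by cases (simp_all add: relabel_outside[OF cards] D.partner_in p sh c c' d d' P)
    show "shift p \<in> overs D' \<longleftrightarrow> p \<in> overs D"
      using cs by cases (simp_all add: relabel_outside[OF cards] sh ij(4) o' ov)
  qed
qed

text \<open>Strands \<open>i\<close>, \<open>j\<close>, \<open>k\<close> are top, middle and bottom.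
  After pulling the data of \<open>D'\<close> back to the times of \<open>D\<close>, this is an
  instance of \<open>alex_det_move_III\<close>; the assumption \<open>first\<close> provides its
  order on the top strand.\<close>

lemma move_III_classical:
  assumes tr: "triangle_config D S s e th" and tr': "triangle_config D' S s' (- e) th'" and e: "e = 1 \<or> e = - 1" and len: "length S = 3"
    and ijk: "i < 3" "j < 3" "k < 3" "distinct [i, j, k]"
    and lay: "layers D S = {(i, j), (i, k), (j, k)}" and lay': "layers D' S = {(i, j), (i, k), (j, k)}"
    and first: "th i j < th i k"
  shows "unit_equiv (zpa_det D') (zpa_det D)"
proof -
  interpret sym: local_change_diagrams D' D S by (rule local_change_sym)
  let ?P = "passage_set D" and ?P' = "passage_set D'"
  have l3: "x = i \<or> x = j \<or> x = k" if "x < 3" for x using that ijk by auto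
  have cards: "\<forall>a<length S. card (?P' \<inter> strand a) = card (?P \<inter> strand a)"
    using triangle_card[OF tr len] sym.triangle_card[OF tr' len] lay lay' len by simp
  have pair: "(x, y) \<in> {(i, j), (i, k), (j, k)} \<or> (y, x) \<in> {(i, j), (i, k), (j, k)}" if "x < 3" "y < 3" "x \<noteq> y" for x y
    using l3[OF that(1)] l3[OF that(2)] that(3) by auto
  have thP: "th x y \<in> ?P" "th' x y \<in> ?P'" if "x < 3" "y < 3" "x \<noteq> y" for x y
    using triangle_passage_iff[OF tr len that] sym.triangle_passage_iff[OF tr' len that] lay lay' pair[OF that] by auto
  have st: "?P \<inter> strand x = {th x y, th x z}" "?P' \<inter> strand x = {th' x y, th' x z}"
    if "x < 3" "y < 3" "z < 3" "distinct [x, y, z]" for x y z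
  proof -
    have idx: "a < 3 \<and> a \<noteq> x \<longleftrightarrow> a = y \<or> a = z" for a using that by auto
    have L: "a < 3 \<and> a \<noteq> x \<and> ((x, a) \<in> {(i, j), (i, k), (j, k)} \<or> (a, x) \<in> {(i, j), (i, k), (j, k)}) \<longleftrightarrow> a = y \<or> a = z" for a
      using idx[of a] pair[OF that(1), of a] by blast
    show "?P \<inter> strand x = {th x y, th x z}"
      unfolding triangle_strand_passages[OF tr len that(1)] lay L by blast
    show "?P' \<inter> strand x = {th' x y, th' x z}"
      unfolding sym.triangle_strand_passages[OF tr' len that(1)] lay' L by blast
  qed
  \<comment> \<open>The map \<open>shift\<close> preserves the position on a strand, while the move
    reverses the order of the crossings. So it takes the passage through one crossing to the passage
    through the other.\<close>
  have sh: "shift (th x y) = th' x z" "even (passage_rank D (th x y)) \<longleftrightarrow> odd (passage_rank D (th x z))"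
    if xyz: "x < 3" "y < 3" "z < 3" "distinct [x, y, z]" for x y z
  proof -
    have xl: "x < length S" using that len by simp
    have ne: "th x y \<noteq> th x z" using triangle_inj_index[OF tr len, of x y z] xyz by auto
    show "shift (th x y) = th' x z"
    proof (cases "th x y < th x z")
      case True
      have "th' x z < th' x y" using triangle_order_flip[OF tr tr' e len xyz] True by simp
      thus ?thesis using shift_second(1)[OF cards xl st(1)[OF xyz] True, of "th' x z" "th' x y"] st(2)[OF xyz]
        by (simp add: insert_commute)
    next
      case False
      hence lt: "th x z < th x y" using ne by simp
      have xzy: "x < 3" "z < 3" "y < 3" "distinct [x, z, y]" using xyz by auto
      have "th' x y < th' x z" using triangle_order_flip[OF tr tr' e len xzy] lt by simp
      thus ?thesis using shift_second(2)[OF cards xl st(1)[OF xzy] lt, of "th' x y" "th' x z"] st(2)[OF xyz] by simp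
    qed
    show "even (passage_rank D (th x y)) \<longleftrightarrow> odd (passage_rank D (th x z))"
    proof (cases "th x y < th x z")
      case True
      thus ?thesis using passage_rank_strand[OF st(1)[OF xyz] True xl] by simp
    next
      case False
      hence lt: "th x z < th x y" using ne by simp
      have "?P \<inter> strand x = {th x z, th x y}" using st(1)[OF xyz] by auto
      thus ?thesis using passage_rank_strand[OF _ lt xl] by simp
    qed
  qed
  have third: "\<exists>z<3. distinct [x, y, z]" if "x < 3" "y < 3" "x \<noteq> y" for x y :: nat
    using l3[OF that(1)] l3[OF that(2)] that(3) ijk by auto
  \<comment> \<open>Each passage moves to the adjacent position. Both ranks of a crossing change
    parity, hence its evenness is preserved.\<close>
  have r: "even (passage_rank D' (th' x y)) \<longleftrightarrow> odd (passage_rank D (th x y))" if xy: "x < 3" "y < 3" "x \<noteq> y" for x y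
  proof -
    obtain z where z: "z < 3" "distinct [x, y, z]" using third[OF xy] by blast
    have "passage_rank D' (th' x y) = passage_rank D (th x z)"
      using sh(1)[of x z y] rank_shift[OF cards, of "th x z"] thP(1)[of x z] xy z by auto
    thus ?thesis using sh(2)[of x y z] xy z by simp
  qed
  note c = triangle_crossing[OF tr len] and c' = sym.triangle_crossing[OF tr' len]
  have ev: "is_even D' (th' x y) = is_even D (th x y)" if xy: "x < 3" "y < 3" "x \<noteq> y" for x y
    unfolding is_even_def c(3)[OF xy] c'(3)[OF xy] even_add
    using r[OF xy] r[OF xy(2,1) xy(3)[symmetric]] by blast
  have ov1: "th x y \<in> overs D \<longleftrightarrow> (x, y) \<in> {(i, j), (i, k), (j, k)}" if "x < 3" "y < 3" "x \<noteq> y" for x y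
    unfolding lay[symmetric] triangle_layers[OF tr len] using that by simp
  have ov2: "th' x y \<in> overs D' \<longleftrightarrow> (x, y) \<in> {(i, j), (i, k), (j, k)}" if "x < 3" "y < 3" "x \<noteq> y" for x y
    unfolding lay'[symmetric] sym.triangle_layers[OF tr' len] using that by simp
  note ov = ov1 ov2
  have w: "weight D' (th' x y) = weight D (th x y)" if xy: "x < 3" "y < 3" "x \<noteq> y" for x y
    using ev[OF xy] triangle_turn_eq[OF tr tr' len xy] ov1[OF xy] ov2[OF xy]
    by (simp add: weight_def c(3)[OF xy] c'(3)[OF xy])
  \<comment> \<open>Whether the middle and the bottom strand meet the top strand before each
    other.\<close>
  define m b where "m = (th j i < th j k)" and "b = (th k i < th k j)"
  define p1 q1 p2 q2 where "p1 = (if m then th j i else th j k)" and "q1 = (if m then th j k else th j i)"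
    and "p2 = (if b then th k i else th k j)" and "q2 = (if b then th k j else th k i)"
  \<comment> \<open>The data of \<open>D'\<close>, read at the times of \<open>D\<close>.\<close>
  define lam' oth' ov' where "lam' = (\<lambda>p. weight D' (shift p))"
    and "oth' = (\<lambda>p. inv_into ?P shift (partner D' (shift p)))" and "ov' = (\<lambda>p. shift p \<in> overs D')"
  have ij: "i \<noteq> j" "i \<noteq> k" "j \<noteq> k" "j \<noteq> i" "k \<noteq> i" "k \<noteq> j" using ijk by auto
  have inv: "inv_into ?P shift (shift p) = p" if "p \<in> ?P" for p
    using shift_bij[OF cards] that by (simp add: bij_betw_def)
  have S: "shift (th i j) = th' i k" "shift (th i k) = th' i j" "shift (th j i) = th' j k" "shift (th j k) = th' j i"
    "shift (th k i) = th' k j" "shift (th k j) = th' k i"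
    using sh(1) ijk ij by simp_all
  have pa': "partner D' (th' i j) = th' j i" "partner D' (th' i k) = th' k i" "partner D' (th' j i) = th' i j"
    "partner D' (th' j k) = th' k j" "partner D' (th' k i) = th' i k" "partner D' (th' k j) = th' j k"
    using c'(3) ijk ij by simp_all
  have pa: "partner D (th i j) = th j i" "partner D (th i k) = th k i" "partner D (th j i) = th i j"
    "partner D (th j k) = th k j" "partner D (th k i) = th i k" "partner D (th k j) = th j k"
    using c(3) ijk ij by simp_all
  have TP: "th i j \<in> ?P" "th i k \<in> ?P" "th j i \<in> ?P" "th j k \<in> ?P" "th k i \<in> ?P" "th k j \<in> ?P"
    using thP(1) ijk ij by simp_all
  have iS: "inv_into ?P shift (th' i j) = th i k" "inv_into ?P shift (th' i k) = th i j"
    "inv_into ?P shift (th' j k) = th j i" "inv_into ?P shift (th' j i) = th j k"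
    "inv_into ?P shift (th' k j) = th k i" "inv_into ?P shift (th' k i) = th k j"
    using inv TP S by metis+
  have ne: "th j i \<noteq> th j k" "th k i \<noteq> th k j"
    using triangle_inj_index[OF tr len] ijk ij by blast+
  have stj: "?P \<inter> strand j = {p1, q1}" "p1 < q1" and stk: "?P \<inter> strand k = {p2, q2}" "p2 < q2"
    using st(1)[of j i k] st(1)[of k i j] ijk ij ne by (auto simp: p1_def q1_def p2_def q2_def m_def b_def)
  have sti: "?P \<inter> strand i = {th i j, th i k}" using st(1)[of i j k] ijk by simp
  have sl: "i < length S" "j < length S" "k < length S" using ijk len by simp_all
  have nxt: "cyc_next ?P (th i j) = th i k" "cyc_next ?P p1 = q1" "cyc_next ?P p2 = q2"
    using cyc_next_strand[OF D.finite_passage_set sti first sl(1)]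
      cyc_next_strand[OF D.finite_passage_set stj sl(2)] cyc_next_strand[OF D.finite_passage_set stk sl(3)] by simp_all
  define X where "X = {th i j, th i k, p1, q1, p2, q2}"
  have X: "X = {th i j, th i k, th j i, th j k, th k i, th k j}"
    by (auto simp: X_def p1_def q1_def p2_def q2_def)
  have XW: "?P \<inter> W = X"
  proof (intro equalityI subsetI)
    fix p assume p: "p \<in> ?P \<inter> W"
    obtain x y where xy: "x < 3" "y < 3" "x \<noteq> y" "p = th x y" by (rule triangle_passage[OF tr len p])
    thus "p \<in> X" using l3[OF xy(1)] l3[OF xy(2)] by (auto simp: X)
  next
    fix p assume "p \<in> X"
    moreover have "th x y \<in> W" if "x < 3" "y < 3" "x \<noteq> y" for x y
      using c(1)[OF that] strand_subset_W[of x] that len by auto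
    ultimately show "p \<in> ?P \<inter> W" using TP ijk ij by (auto simp: X)
  qed
  have mem: "th i j \<in> ?P" "th i k \<in> ?P" "p1 \<in> ?P" "q1 \<in> ?P" "p2 \<in> ?P" "q2 \<in> ?P"
    using TP stj stk by auto
  have dist: "distinct [th i j, th i k, p1, q1, p2, q2]"
  proof -
    have sub: "{th i j, th i k} \<subseteq> strand i" "{p1, q1} \<subseteq> strand j" "{p2, q2} \<subseteq> strand k"
      unfolding sti[symmetric] stj(1)[symmetric] stk(1)[symmetric] by (rule Int_lower2)+
    have disj: "A \<inter> B = {}" if "A \<subseteq> strand x" "B \<subseteq> strand y" "strand x \<inter> strand y = {}" for A B x y
      using that by blast
    have "{th i j, th i k} \<inter> {p1, q1} = {}" "{th i j, th i k} \<inter> {p2, q2} = {}" "{p1, q1} \<inter> {p2, q2} = {}"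
      by (rule disj[OF sub(1,2) strand_disjoint[OF sl(1,2) ij(1)]] disj[OF sub(1,3) strand_disjoint[OF sl(1,3) ij(2)]]
        disj[OF sub(2,3) strand_disjoint[OF sl(2,3) ij(3)]])+
    thus ?thesis using first stj(2) stk(2) by auto
  qed
  have O: "th i j \<in> overs D" "th i k \<in> overs D" "th j k \<in> overs D" "th j i \<notin> overs D" "th k i \<notin> overs D" "th k j \<notin> overs D"
    "th' i j \<in> overs D'" "th' i k \<in> overs D'" "th' j k \<in> overs D'" "th' j i \<notin> overs D'" "th' k i \<notin> overs D'" "th' k j \<notin> overs D'"
    using ov ijk ij by simp_all
  have out: "p \<in> ?P - W" if "p \<in> ?P - X" for p using that XW by blast
  have outp: "partner D p \<in> ?P - X" if "p \<in> ?P - X" for p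
    using out[OF that] partner_inside[of p] D.partner_in[of p] XW by blast
  have outeq: "lam' p = weight D p" "ov' p \<longleftrightarrow> p \<in> overs D" "oth' p = partner D p" if "p \<in> ?P - X" for p
    using relabel_outside[OF cards out[OF that]] outp[OF that] inv[of "partner D p"]
    by (simp_all add: lam'_def ov'_def oth'_def)
  have tw: "triangle_weights m b (weight D (th i j)) (weight D (th j i)) (weight D (th i k)) (weight D (th k i))
      (weight D (th j k)) (weight D (th k j))"
  proof -
    \<comment> \<open>On each strand the two ranks have odd sum, so the six ranks together do. A
      crossing is even iff its own two ranks have odd sum; so the number of even crossings is
      odd.\<close>
    have e1: "is_even D (th i j) \<longleftrightarrow> (is_even D (th i k) \<longleftrightarrow> is_even D (th j k))"
    proof -
      have "even (passage_rank D (th i j)) \<longleftrightarrow> odd (passage_rank D (th i k))"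
        "even (passage_rank D (th j i)) \<longleftrightarrow> odd (passage_rank D (th j k))"
        "even (passage_rank D (th k i)) \<longleftrightarrow> odd (passage_rank D (th k j))"
        using sh(2)[of i j k] sh(2)[of j i k] sh(2)[of k i j] ijk ij by simp_all
      thus ?thesis unfolding is_even_def pa even_add by argo
    qed
    let ?k = "\<lambda>x y. turn D (th x y) (th y x)"
    have k: "?k j k = 1 \<or> ?k j k = - 1" "?k i j = 1 \<or> ?k i j = - 1" "?k i k = 1 \<or> ?k i k = - 1" by (auto simp: turn_def)
    have neg: "?k j i = - ?k i j" "?k k i = - ?k i k" "?k k j = - ?k j k"
      by (rule D.turn_neg[OF c(2)]; fact ijk(1) ijk(2) ijk(3) ij)+
    \<comment> \<open>Combined with \<open>first\<close>, the orders on the middle and the bottom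
      strand express two orientations by that of the crossing of \<open>j\<close> and
      \<open>k\<close>.\<close>
    have "?k i k = ?k j k \<longleftrightarrow> m"
      using triangle_turn_order[OF tr e len ijk] first by (simp add: m_def)
    moreover have "?k i j = ?k k j \<longleftrightarrow> \<not> b"
      using triangle_turn_order[OF tr e len, of i k j] first ijk ij by (auto simp: b_def)
    ultimately have "?k i j = (if b then ?k j k else - ?k j k)" "?k i k = (if m then ?k j k else - ?k j k)"
      using k neg by auto
    note T = triangle_weights_passage_weight[OF k(1) e1 this]
    have W: "weight D (th i j) = passage_weight (is_even D (th i j)) True (?k i j)"
      "weight D (th i k) = passage_weight (is_even D (th i k)) True (?k i k)"
      "weight D (th j k) = passage_weight (is_even D (th j k)) True (?k j k)"
      using O by (simp_all add: weight_def pa)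
    have W': "weight D (th j i) = passage_weight (is_even D (th i j)) False (- ?k i j)"
      "weight D (th k i) = passage_weight (is_even D (th i k)) False (- ?k i k)"
      "weight D (th k j) = passage_weight (is_even D (th j k)) False (- ?k j k)"
      using D.weight_partner[OF TP(1)] D.weight_partner[OF TP(2)] D.weight_partner[OF TP(4)] O by (simp_all add: pa)
    show ?thesis unfolding W W' by (rule T)
  qed
  have det: "alex_det ?P lam' oth' ov' = alex_det ?P (weight D) (partner D) (\<lambda>p. p \<in> overs D)"
  proof (rule alex_det_move_III[where m = m and b = b and mt = "th j i" and mb = "th j k" and bt = "th k i" and bm = "th k j",
        OF D.finite_passage_set mem dist nxt])
    show "(th j i, th j k) = (if m then (p1, q1) else (q1, p1))" "(th k i, th k j) = (if b then (p2, q2) else (q2, p2))"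
      by (simp_all add: p1_def q1_def p2_def q2_def)
    show "triangle_weights m b (weight D (th i j)) (weight D (th j i)) (weight D (th i k)) (weight D (th k i))
      (weight D (th j k)) (weight D (th k j))" by (rule tw)
    fix p assume "p \<in> ?P - {th i j, th i k, p1, q1, p2, q2}"
    hence p: "p \<in> ?P - X" by (simp add: X_def)
    show "partner D p \<notin> {th i j, th i k, p1, q1, p2, q2}" using outp[OF p] by (simp add: X_def)
    show "lam' p = weight D p \<and> ov' p = (p \<in> overs D)" using outeq[OF p] by simp
    show "oth' p = partner D p \<and> lam' (partner D p) = weight D (partner D p)"
      using outeq[OF p] outeq[OF outp[OF p]] by simp
  qed (use O w ijk ij in \<open>simp_all add: lam'_def ov'_def oth'_def pa pa' S iS\<close>)
  show ?thesis
  proof (rule zpa_det_relabel[OF cards _ det])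
    show "?P \<noteq> {}" using TP by auto
    fix p assume p: "p \<in> ?P"
    show "weight D' (shift p) = lam' p" by (simp add: lam'_def)
    show "shift p \<in> overs D' \<longleftrightarrow> ov' p" by (simp add: ov'_def)
    have "partner D' (shift p) \<in> shift ` ?P"
      using shift_bij[OF cards] D'.partner_in[OF shift_in[OF cards p]] by (simp add: bij_betw_def)
    thus "oth' p \<in> ?P \<and> partner D' (shift p) = shift (oth' p)"
      by (simp add: oth'_def inv_into_into f_inv_into_f)
  qed
qed

end

lemma move_III_invariance:
  assumes D: "diagram D" and D': "diagram D'" and move: "move_III D D'"
  shows "unit_equiv (zpa_det D') (zpa_det D)"
proof -
  from move obtain S f g where len: "length S = 3" and lc: "local_change S D D'"
    and lines: "\<forall>E \<in> {D, D'}. traces_graph E (strand_times S 0) (\<lambda>x. x / 2) \<and>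
                       traces_graph E (strand_times S 1) (\<lambda>x. - x / 2)"
    and g2: "traces_graph D (strand_times S 2) f" "traces_graph D' (strand_times S 2) g"
    and fg: "f 0 > 0" "g 0 < 0"
    and h: "\<forall>h \<in> {f, g}. \<bar>h (-1)\<bar> < 1 / 2 \<and> \<bar>h 1\<bar> < 1 / 2 \<and>
           (\<exists>!x. x \<in> {-1..1} \<and> h x = x / 2) \<and> (\<exists>!x. x \<in> {-1..1} \<and> h x = - x / 2)"
    and lay: "layers D S = layers D' S"
    and cases: "layers D S = {} \<or> (\<exists>i j. layers D S = {(i, j)}) \<or>
         (\<exists>i j k. distinct [i, j, k] \<and> layers D S = {(i, j), (i, k), (j, k)})"
    unfolding move_III_def by (elim exE conjE)
  interpret local_change_diagrams D D' S by (intro local_change_diagrams.intro D D' lc)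
  interpret sym: local_change_diagrams D' D S by (rule local_change_sym)
  have F: "\<bar>f (-1)\<bar> < 1 / 2 \<and> \<bar>f 1\<bar> < 1 / 2 \<and>
      (\<exists>!x. x \<in> {-1..1} \<and> f x = x / 2) \<and> (\<exists>!x. x \<in> {-1..1} \<and> f x = - x / 2)"
    by (rule bspec[OF h]) simp
  note hf = F[THEN conjunct1] F[THEN conjunct2, THEN conjunct1] F[THEN conjunct2, THEN conjunct2, THEN conjunct1]
    F[THEN conjunct2, THEN conjunct2, THEN conjunct2]
  have G: "\<bar>g (-1)\<bar> < 1 / 2 \<and> \<bar>g 1\<bar> < 1 / 2 \<and>
      (\<exists>!x. x \<in> {-1..1} \<and> g x = x / 2) \<and> (\<exists>!x. x \<in> {-1..1} \<and> g x = - x / 2)"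
    by (rule bspec[OF h]) simp
  note hg = G[THEN conjunct1] G[THEN conjunct2, THEN conjunct1] G[THEN conjunct2, THEN conjunct2, THEN conjunct1]
    G[THEN conjunct2, THEN conjunct2, THEN conjunct2]
  have lD: "traces_graph D (strand 0) (\<lambda>x. x / 2)" "traces_graph D (strand 1) (\<lambda>x. - x / 2)"
    "traces_graph D' (strand 0) (\<lambda>x. x / 2)" "traces_graph D' (strand 1) (\<lambda>x. - x / 2)"
    using lines by blast+
  have "\<exists>s th. triangle_config D S s 1 th"
    by (rule ex_triangle[OF len lD(1,2) g2(1) _ _ hf]) (use fg in simp_all)
  then obtain s th where tr: "triangle_config D S s 1 th" by blast
  have "\<exists>s th. triangle_config D' S s (- 1) th"
    by (rule sym.ex_triangle[OF len lD(3,4) g2(2) _ _ hg]) (use fg in simp_all)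
  then obtain s' th' where tr': "triangle_config D' S s' (- 1) th'" by blast
  consider "layers D S = {}" | i j where "layers D S = {(i, j)}"
    | i j k where "distinct [i, j, k]" "layers D S = {(i, j), (i, k), (j, k)}"
    using cases by blast
  thus ?thesis
  proof cases
    case 1
    have "passage_set D \<inter> W = {}"
    proof (rule equals0I)
      fix p assume p: "p \<in> passage_set D \<inter> W"
      obtain i j where ij: "i < 3" "j < 3" "i \<noteq> j" "p = th i j" by (rule triangle_passage[OF tr len p])
      thus False using triangle_passage_iff[OF tr len ij(1-3)] p 1 by simp
    qed
    moreover have "passage_set D' \<inter> W = {}"
    proof (rule equals0I)
      fix p assume p: "p \<in> passage_set D' \<inter> W"
      obtain i j where ij: "i < 3" "j < 3" "i \<noteq> j" "p = th' i j" by (rule sym.triangle_passage[OF tr' len p])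
      thus False using sym.triangle_passage_iff[OF tr' len ij(1-3)] p 1 lay by simp
    qed
    ultimately show ?thesis by (rule zpa_det_no_classical_crossings)
  next
    case (2 i j)
    thus ?thesis using lay by (intro move_III_mixed[OF tr tr' len]) auto
  next
    case (3 i j k)
    have "(i, j) \<in> layers D S" "(i, k) \<in> layers D S" using 3 by auto
    hence ijk: "i < 3" "j < 3" "k < 3" using triangle_layers[OF tr len] by auto
    show ?thesis
    proof (cases "th i j < th i k")
      case True
      show ?thesis by (rule move_III_classical[OF tr tr' _ len ijk 3 _ True]) (use 3 lay in simp_all)
    next
      case False
      \<comment> \<open>The order on the top strand is the wrong one for \<open>D\<close>, hence the
        right one for \<open>D'\<close>; the move is read backwards.\<close>
      have "i \<noteq> j" "i \<noteq> k" "j \<noteq> k" using 3 by auto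
      hence "th i k < th i j" using False triangle_inj_index[OF tr len ijk] by force
      moreover have "1 = 1 \<or> (1::int) = - 1" "distinct [i, k, j]" using 3 by auto
      ultimately have f': "th' i j < th' i k"
        using triangle_order_flip[OF tr tr' _ len ijk(1,3,2)] by simp
      have tr1: "triangle_config D S s (- (- 1)) th" using tr by simp
      have "unit_equiv (zpa_det D) (zpa_det D')"
        by (rule sym.move_III_classical[OF tr' tr1 _ len ijk 3(1) _ _ f']) (use 3 lay in simp_all)
      thus ?thesis by (rule unit_equiv_sym)
    qed
  qed
qed

section \<open>Invariance and the lower bound\<close>

lemma diagram_step_invariance:
  assumes "diagram_step D D'"
  shows "unit_equiv (zpa_det D') (zpa_det D)"
proof -
  have "diagram D" "diagram D'" using assms by (auto simp: diagram_step_def diagram_def)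
  thus ?thesis
    using assms reparametrization_invariance planar_isotopy_invariance move_I_invariance move_II_invariance
      move_III_invariance unfolding diagram_step_def by blast
qed

lemma equivclp_invariance:
  assumes "equivclp diagram_step D D'"
  shows "unit_equiv (zpa_det D) (zpa_det D')"
  using assms
proof (induction rule: equivclp_induct)
  case base
  show ?case by (rule unit_equiv_refl)
next
  case (step y z)
  have "unit_equiv (zpa_det y) (zpa_det z)"
    using step(2) diagram_step_invariance unit_equiv_sym by blast
  thus ?case using step(3) unit_equiv_trans by blast
qed

theorem corollary2p4:
  fixes K :: "vdiagram set" and P :: laurent
  assumes "K \<in> virtual_knots"
    and "is_z_parity_alexander K P"
    and "z_bound P > 0"
  shows "z_bound P + 1 \<le> int (crossing_number K)"
proof -
  let ?R = "{(D, D'). is_diagram D \<and> equivclp diagram_step D D'}"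
  obtain D0 where D0: "is_diagram D0" "K = ?R `` {D0}"
    using assms(1) unfolding virtual_knots_def by (auto elim!: quotientE)
  have K: "equivclp diagram_step D0 D" if "D \<in> K" for D using that D0 by auto
  have diag: "is_diagram D" if "equivclp diagram_step D0 D" for D
    using that
  proof (induction rule: equivclp_induct)
    case (step y z)
    thus ?case by (auto simp: diagram_step_def)
  qed (rule D0)
  obtain D1 a b where D1: "D1 \<in> K" "P = monom_stz a b 0 * zpa_det D1 \<or> P = - (monom_stz a b 0 * zpa_det D1)"
    using assms(2) unfolding is_z_parity_alexander_def by blast
  \<comment> \<open>The minimum is attained, by \<open>D2\<close>. Since \<open>P\<close> comes from
    \<open>D1\<close>, invariance has to carry its exponents over to \<open>D2\<close>, where the
    degree bound is applied.\<close>
  have "\<exists>n. \<exists>D\<in>K. n = card (real_crossings D)" using D1 by blast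
  hence "\<exists>D\<in>K. crossing_number K = card (real_crossings D)"
    unfolding crossing_number_def by (rule LeastI_ex)
  then obtain D2 where D2: "D2 \<in> K" "crossing_number K = card (real_crossings D2)" by blast
  have "unit_equiv P (zpa_det D1)" using D1(2) unfolding unit_equiv_def by blast
  moreover have "unit_equiv (zpa_det D1) (zpa_det D2)"
    using equivclp_invariance[OF K[OF D1(1)]] equivclp_invariance[OF K[OF D2(1)]]
    by (blast intro: unit_equiv_trans unit_equiv_sym)
  ultimately have "z_exponents P = z_exponents (zpa_det D2)"
    by (intro z_exponents_unit_equiv) (rule unit_equiv_trans)
  moreover have "diagram D2" using diag[OF K[OF D2(1)]] by (simp add: diagram_def)
  ultimately show ?thesis using diagram.z_bound_crossings[of D2 P] assms(3) D2(2) by simp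
qed

end
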